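(* Suppose $U$ satisfies the Main Assumption (with sets $\Omega_1,\dots,\Omega_n$ and function $\mu$). Then for every extremal $t\mapsto(x(t),y(t),z(t))$, $t\in[0,T]$, of problem (P) there exist - constants $\gamma\in\{0,1,-1\}$ and $A=(A_1,\dots,A_n)\in\mathbb{R}^n_+$, not both zero (i.e. not $\gamma=0$ and $A=0$ simultaneously); - a constant $\theta^\circ_{i0}\in\mathbb{R}$ for each $i$ with $A_i>0$; - a measurable function $\lambda(t)=(\lambda_1(t),\dots,\lambda_n(t))$ with $\lambda(t)\in\partial s_\Xi(A)$ for a.e. $t$, such that $\lambda_i\equiv 0$ for every $i$ with $A_i=0$ whenever $\gamma\ne0$, such that: 1. If $\gamma\neq 0$: for each $i$ with $A_i>0$, \[ x_i=\gamma A_i\big(\sin_{\Omega_i^\circ}\theta_i^\circ-\sin_{\Omega_i^\circ}\theta_{i0}^\circ\big),\qquad y_i=\gamma A_i\big(\cos_{\Omega_i^\circ}\theta_{i0}^\circ-\cos_{\Omega_i^\circ}\theta_i^\circ\big), \] where $\theta_i^\circ(t)=\theta_{i0}^\circ+\frac{\gamma}{A_i}\int_0^t\lambda_i(\tau)\,d\tau$; for each $i$ with $A_i=0$, $x_i\equiv y_i\equiv0$; and \[ 2z=\gamma\, s_\Xi(A)\,t+\sum_{i:A_i>0}A_i^2\big(\sin_{\Omega_i^\circ}\theta_{i0}^\circ\cos_{\Omega_i^\circ}\theta_i^\circ-\cos_{\Omega_i^\circ}\theta_{i0}^\circ\sin_{\Omega_i^\circ}\theta_i^\circ\big). \] 2.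 If $\gamma=0$: for each $i$, \[ x_i(t)=\int_0^t\lambda_i(\tau)\cos_{\Omega_i}\theta_i(\tau)\,d\tau,\qquad y_i(t)=\int_0^t\lambda_i(\tau)\sin_{\Omega_i}\theta_i(\tau)\,d\tau, \] where $\theta_i(t)$ is a measurable function with $\theta_i(t)\xleftrightarrow{\Omega_i}\theta^\circ_{i0}$ for a.e. $t$ if $A_i>0$, and an arbitrary measurable function if $A_i=0$; and $z(t)=\frac12\int_0^t\sum_i\big(x_i\dot y_i-\dot x_iy_i\big)\,d\tau$. Conversely, every trajectory of one of the forms described in items 1 and 2 (with data $\gamma,A,\theta^\circ_{i0},\lambda,\theta_i$ satisfying the stated conditions) is an extremal of problem (P).
   Context: Heisenberg group: $\mathbb{H}_{2n+1}=\{(x,y,z):x\in\mathbb{R}^n,y\in\mathbb{R}^{n*},z\in\mathbb{R}\}$ with product $(x^1,y^1,z^1)(x^2,y^2,z^2)=(x^1+x^2,y^1+y^2,z^1+z^2+\frac12(\langle x^1,y^2\rangle-\langle x^2,y^1\rangle))$ and identity $0$. Problem (P): given a compact convex $U\subset\mathbb{R}^n\times\mathbb{R}^{n*}$ with $0\in\operatorname{int}U$, minimize $T$ over Lipschitz curves $q(t)=(x(t),y(t),z(t))$, $t\in[0,T]$, with $q(0)=0$, $q(T)=q_1$, $(\dot x,\dot y)\in U$ a.e. and $\dot z=\frac12\sum_{i=1}^n(x_i\dot y_i-\dot x_iy_i)$ (this is the left-invariant sub-Finsler problem $\dot q\in qU$). An extremal is the projection to $\mathbb{H}_{2n+1}$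 of a solution of the Pontryagin maximum principle (normal or abnormal) for this time-optimal problem. Main Assumption: there are compact convex sets $\Omega_i\subset\mathbb{R}^2$ with $0\in\operatorname{int}\Omega_i$, $i=1,\dots,n$, and a continuous convex positively homogeneous function $\mu:\mathbb{R}^n_+\to\mathbb{R}_+$, nondecreasing in each argument and strictly positive outside the origin, such that $U=\{(\dot x,\dot y):\mu(\mu_{\Omega_1}(\dot x_1,\dot y_1),\dots,\mu_{\Omega_n}(\dot x_n,\dot y_n))\le1\}$, where $\mu_\Omega$ is the Minkowski functional of $\Omega$. Put $\Xi=\{\lambda\in\mathbb{R}^n:\lambda_i\ge0,\ \mu(\lambda)\le1\}$, $s_\Xi(A)=\max_{\lambda\in\Xi}\sum_iA_i\lambda_i$ its support function, and $\partial s_\Xi(A)$ its subdifferential (equal to $\arg\max_{\lambda\in\Xi}\sum_iA_i\lambda_i$). Convex trigonometry: for a compact convex $\Omega\subset\mathbb{R}^2$ with $0\in\operatorname{int}\Omega$ and area $\mathbb{S}$, and $\theta\in[0,2\mathbb{S})$, let $P_\theta\in\partial\Omega$ be the point such that the area of the sector of $\Omega$ swept counterclockwise from the positive $x$-axis to the ray $OP_\theta$ equals $\theta/2$; $(\cos_\Omega\theta,\sin_\Omega\theta)$ are the coordinates of $P_\theta$, and these functions are extended to $\mathbb{R}$ as $2\mathbb{S}$-periodic. The polar set is $\Omega^\circ=\{(p,q):pu+qv\le1\ \forall(u,v)\in\Omega\}$ (again compact convex with $0$ in its interior, area $\mathbb{S}^\circ$), and $\cos_{\Omega^\circ},\sin_{\Omega^\circ}$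 are defined the same way. We write $\theta\xleftrightarrow{\Omega}\theta^\circ$ if $\cos_\Omega\theta\cos_{\Omega^\circ}\theta^\circ+\sin_\Omega\theta\sin_{\Omega^\circ}\theta^\circ=1$ (equivalently, the covector $(\cos_{\Omega^\circ}\theta^\circ,\sin_{\Omega^\circ}\theta^\circ)$ defines a supporting half-plane of $\Omega$ at $P_\theta$). *)

theory Defs
  imports "HOL-Analysis.Analysis"
begin

definition minkowski_fn :: "(real \<times> real) set \<Rightarrow> real \<times> real \<Rightarrow> real" where
  "minkowski_fn \<Omega> p = Inf {t. 0 < t \<and> (1 / t) *\<^sub>R p \<in> \<Omega>}"

definition polar2 :: "(real \<times> real) set \<Rightarrow> (real \<times> real) set" where
  "polar2 \<Omega> = {(p, q). \<forall>(u, v) \<in> \<Omega>. p * u + q * v \<le> 1}"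

definition area :: "(real \<times> real) set \<Rightarrow> real" where
  "area \<Omega> = measure lborel \<Omega>"

definition sector :: "(real \<times> real) set \<Rightarrow> real \<Rightarrow> (real \<times> real) set" where
  "sector \<Omega> \<phi> = {(r * cos a, r * sin a) | r a.
      0 \<le> r \<and> 0 \<le> a \<and> a \<le> \<phi> \<and> (r * cos a, r * sin a) \<in> \<Omega>}"

text \<open>The point \<open>P_\<theta>\<close> of the boundary (for \<open>\<theta> \<in> [0, 2 S)\<close>): the sector
  from the positive x-axis to the ray \<open>OP_\<theta>\<close> has area \<open>\<theta>/2\<close>.\<close>
definition conv_point :: "(real \<times> real) set \<Rightarrow> real \<Rightarrow> real \<times> real" where
  "conv_point \<Omega> \<theta> = (THE P. P \<in> frontier \<Omega> \<and>
     (\<exists>\<phi> r. 0 \<le> \<phi> \<and> \<phi> < 2 * pi \<and> 0 < r \<and> P = (r * cos \<phi>, r * sin \<phi>) \<and>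
            area (sector \<Omega> \<phi>) = \<theta> / 2))"

definition cos_cv :: "(real \<times> real) set \<Rightarrow> real \<Rightarrow> real" where
  "cos_cv \<Omega> \<theta> = fst (conv_point \<Omega> (\<theta> - 2 * area \<Omega> * of_int \<lfloor>\<theta> / (2 * area \<Omega>)\<rfloor>))"

definition sin_cv :: "(real \<times> real) set \<Rightarrow> real \<Rightarrow> real" where
  "sin_cv \<Omega> \<theta> = snd (conv_point \<Omega> (\<theta> - 2 * area \<Omega> * of_int \<lfloor>\<theta> / (2 * area \<Omega>)\<rfloor>))"

definition corresp :: "(real \<times> real) set \<Rightarrow> real \<Rightarrow> real \<Rightarrow> bool" where
  "corresp \<Omega> \<theta> \<theta>' \<longleftrightarrow>
     cos_cv \<Omega> \<theta> * cos_cv (polar2 \<Omega>) \<theta>' + sin_cv \<Omega> \<theta> * sin_cv (polar2 \<Omega>) \<theta>' = 1"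

definition orthant :: "(real^'n) set" where
  "orthant = {l. \<forall>i. 0 \<le> l $ i}"

definition main_assumption :: "('n::finite \<Rightarrow> (real \<times> real) set) \<Rightarrow> (real^'n \<Rightarrow> real) \<Rightarrow> bool" where
  "main_assumption \<Omega> \<mu> \<longleftrightarrow>
     (\<forall>i. compact (\<Omega> i) \<and> convex (\<Omega> i) \<and> 0 \<in> interior (\<Omega> i)) \<and>
     continuous_on orthant \<mu> \<and> convex_on orthant \<mu> \<and>
     (\<forall>c l. 0 \<le> c \<longrightarrow> l \<in> orthant \<longrightarrow> \<mu> (c *\<^sub>R l) = c * \<mu> l) \<and>
     (\<forall>l l'. l \<in> orthant \<longrightarrow> l' \<in> orthant \<longrightarrow> (\<forall>i. l $ i \<le> l' $ i) \<longrightarrow> \<mu> l \<le> \<mu> l') \<and>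
     (\<forall>l \<in> orthant. 0 \<le> \<mu> l) \<and>
     (\<forall>l \<in> orthant. l \<noteq> 0 \<longrightarrow> 0 < \<mu> l)"

definition U_of :: "('n::finite \<Rightarrow> (real \<times> real) set) \<Rightarrow> (real^'n \<Rightarrow> real) \<Rightarrow> ((real^'n) \<times> (real^'n)) set" where
  "U_of \<Omega> \<mu> = {(u, v). \<mu> (\<chi> i. minkowski_fn (\<Omega> i) (u $ i, v $ i)) \<le> 1}"

definition Xi :: "(real^'n \<Rightarrow> real) \<Rightarrow> (real^'n) set" where
  "Xi \<mu> = {l. (\<forall>i. 0 \<le> l $ i) \<and> \<mu> l \<le> 1}"

definition supp_Xi :: "(real^'n \<Rightarrow> real) \<Rightarrow> real^'n \<Rightarrow> real" where
  "supp_Xi \<mu> A = Sup ((\<lambda>l. A \<bullet> l) ` Xi \<mu>)"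

definition subdiff_Xi :: "(real^'n \<Rightarrow> real) \<Rightarrow> real^'n \<Rightarrow> (real^'n) set" where
  "subdiff_Xi \<mu> A = {l. \<forall>B. supp_Xi \<mu> A + (B - A) \<bullet> l \<le> supp_Xi \<mu> B}"

definition abs_cont_on :: "real \<Rightarrow> real \<Rightarrow> (real \<Rightarrow> 'a::real_normed_vector) \<Rightarrow> bool" where
  "abs_cont_on a b f \<longleftrightarrow>
     (\<forall>\<epsilon>>0. \<exists>\<delta>>0. \<forall>(m::nat) (s::nat \<Rightarrow> real) (e::nat \<Rightarrow> real).
        (\<forall>k<m. a \<le> s k \<and> s k \<le> e k \<and> e k \<le> b) \<and>
        (\<forall>k<m. \<forall>j<m. k \<noteq> j \<longrightarrow> e k \<le> s j \<or> e j \<le> s k) \<and>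
        (\<Sum>k<m. e k - s k) < \<delta> \<longrightarrow>
        (\<Sum>k<m. norm (f (e k) - f (s k))) < \<epsilon>)"

definition admissible :: "((real^'n) \<times> (real^'n)) set \<Rightarrow> real \<Rightarrow>
    (real \<Rightarrow> real^'n) \<Rightarrow> (real \<Rightarrow> real^'n) \<Rightarrow> (real \<Rightarrow> real) \<Rightarrow> bool" where
  "admissible U T x y z \<longleftrightarrow> 0 < T \<and>
     (\<exists>C. C-lipschitz_on {0..T} (\<lambda>t. (x t, y t, z t))) \<and>
     x 0 = 0 \<and> y 0 = 0 \<and> z 0 = 0 \<and>
     (AE t in lborel. t \<in> {0<..<T} \<longrightarrow>
        (\<exists>x' y' z'. (x has_vector_derivative x') (at t) \<and> (y has_vector_derivative y') (at t) \<and>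
            (z has_real_derivative z') (at t) \<and> (x', y') \<in> U \<and>
            z' = 1/2 * (\<Sum>i\<in>UNIV. x t $ i * y' $ i - x' $ i * y t $ i)))"

text \<open>Pontryagin function \<open>H = \<langle>\<psi>, q u\<rangle>\<close>.\<close>
definition hamiltonian :: "real^'n \<Rightarrow> real^'n \<Rightarrow> real \<Rightarrow> real^'n \<Rightarrow> real^'n \<Rightarrow>
    real^'n \<Rightarrow> real^'n \<Rightarrow> real" where
  "hamiltonian px py pz x y u v =
     px \<bullet> u + py \<bullet> v + pz * (1/2 * (\<Sum>i\<in>UNIV. x $ i * v $ i - u $ i * y $ i))"

text \<open>Extremal: projection of a (normal or abnormal) solution of the Pontryagin
  maximum principle of the time-optimal problem (P).\<close>
definition extremal :: "((real^'n) \<times> (real^'n)) set \<Rightarrow> real \<Rightarrow>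
    (real \<Rightarrow> real^'n) \<Rightarrow> (real \<Rightarrow> real^'n) \<Rightarrow> (real \<Rightarrow> real) \<Rightarrow> bool" where
  "extremal U T x y z \<longleftrightarrow> admissible U T x y z \<and>
     (\<exists>px py pz M.
        abs_cont_on 0 T px \<and> abs_cont_on 0 T py \<and> abs_cont_on 0 T pz \<and>
        (\<forall>t\<in>{0..T}. (px t, py t, pz t) \<noteq> 0) \<and> 0 \<le> M \<and>
        (AE t in lborel. t \<in> {0<..<T} \<longrightarrow>
          (\<exists>x' y' px' py' pz'.
             (x has_vector_derivative x') (at t) \<and> (y has_vector_derivative y') (at t) \<and>
             (px has_vector_derivative px') (at t) \<and> (py has_vector_derivative py') (at t) \<and>
             (pz has_real_derivative pz') (at t) \<and>
             px' = - ((pz t / 2) *\<^sub>R y') \<and> py' = (pz t / 2) *\<^sub>R x' \<and> pz' = 0 \<and>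
             hamiltonian (px t) (py t) (pz t) (x t) (y t) x' y' = M)) \<and>
        (\<forall>t\<in>{0..T}. (SUP w\<in>U. hamiltonian (px t) (py t) (pz t) (x t) (y t) (fst w) (snd w)) = M))"

definition extremal_form :: "('n::finite \<Rightarrow> (real \<times> real) set) \<Rightarrow> (real^'n \<Rightarrow> real) \<Rightarrow> real \<Rightarrow>
    (real \<Rightarrow> real^'n) \<Rightarrow> (real \<Rightarrow> real^'n) \<Rightarrow> (real \<Rightarrow> real) \<Rightarrow> bool" where
  "extremal_form \<Omega> \<mu> T x y z \<longleftrightarrow>
   (\<exists>(\<gamma>::real) (A::real^'n) (\<theta>0::'n \<Rightarrow> real) (lam::real \<Rightarrow> real^'n).
      \<gamma> \<in> {0, 1, -1} \<and> (\<forall>i. 0 \<le> A $ i) \<and> \<not> (\<gamma> = 0 \<and> A = 0) \<and>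
      lam \<in> borel_measurable lborel \<and>
      (AE t in lborel. t \<in> {0..T} \<longrightarrow> lam t \<in> subdiff_Xi \<mu> A) \<and>
      (\<gamma> \<noteq> 0 \<longrightarrow> (\<forall>i. A $ i = 0 \<longrightarrow> (\<forall>t\<in>{0..T}. lam t $ i = 0))) \<and>
      (\<gamma> \<noteq> 0 \<longrightarrow>
        (let th = (\<lambda>i t. \<theta>0 i + \<gamma> / A $ i * integral {0..t} (\<lambda>\<tau>. lam \<tau> $ i)) in
         \<forall>t\<in>{0..T}.
           (\<forall>i. 0 < A $ i \<longrightarrow>
              x t $ i = \<gamma> * A $ i * (sin_cv (polar2 (\<Omega> i)) (th i t) - sin_cv (polar2 (\<Omega> i)) (\<theta>0 i)) \<and>
              y t $ i = \<gamma> * A $ i * (cos_cv (polar2 (\<Omega> i)) (\<theta>0 i) - cos_cv (polar2 (\<Omega> i)) (th i t))) \<and>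
           (\<forall>i. A $ i = 0 \<longrightarrow> x t $ i = 0 \<and> y t $ i = 0) \<and>
           2 * z t = \<gamma> * supp_Xi \<mu> A * t +
             (\<Sum>i\<in>{i. 0 < A $ i}. (A $ i)\<^sup>2 *
                (sin_cv (polar2 (\<Omega> i)) (\<theta>0 i) * cos_cv (polar2 (\<Omega> i)) (th i t) -
                 cos_cv (polar2 (\<Omega> i)) (\<theta>0 i) * sin_cv (polar2 (\<Omega> i)) (th i t))))) \<and>
      (\<gamma> = 0 \<longrightarrow>
        (\<exists>th::'n \<Rightarrow> real \<Rightarrow> real.
           (\<forall>i. th i \<in> borel_measurable lborel) \<and>
           (\<forall>i. 0 < A $ i \<longrightarrow> (AE t in lborel. t \<in> {0..T} \<longrightarrow> corresp (\<Omega> i) (th i t) (\<theta>0 i))) \<and>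
           (\<forall>t\<in>{0..T}.
              (\<forall>i. x t $ i = integral {0..t} (\<lambda>\<tau>. lam \<tau> $ i * cos_cv (\<Omega> i) (th i \<tau>)) \<and>
                   y t $ i = integral {0..t} (\<lambda>\<tau>. lam \<tau> $ i * sin_cv (\<Omega> i) (th i \<tau>))) \<and>
              z t = 1/2 * integral {0..t} (\<lambda>\<tau>. \<Sum>i\<in>UNIV.
                       x \<tau> $ i * (lam \<tau> $ i * sin_cv (\<Omega> i) (th i \<tau>)) -
                       (lam \<tau> $ i * cos_cv (\<Omega> i) (th i \<tau>)) * y \<tau> $ i)))))"

end

theory Submission
  imports Defs
begin

text \<open>
  On a solution of the maximum principle \<open>p\<^sub>z = c\<close> is constant and the left-invariant momentum of the
  \<open>i\<close>-th plane is \<open>h\<^sub>i = (a\<^sub>i - c y\<^sub>i, b\<^sub>i + c x\<^sub>i)\<close>. Maximality forces the velocity \<open>w\<^sub>i\<close> to satisfy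
  \<open>h\<^sub>i \<bullet> w\<^sub>i = A\<^sub>i \<lambda>\<^sub>i\<close>, where \<open>A\<^sub>i\<close> is the polar gauge of \<open>h\<^sub>i\<close>, \<open>\<lambda>\<^sub>i\<close> the gauge of \<open>w\<^sub>i\<close>, and \<open>\<lambda>\<close> lies in
  the subdifferential of \<open>s\<^sub>\<Xi>\<close> at \<open>A\<close>. Since \<open>h\<^sub>i' = c (- y\<^sub>i', x\<^sub>i')\<close> is orthogonal to \<open>w\<^sub>i\<close>, each \<open>A\<^sub>i\<close> is
  constant. For \<open>c = 0\<close> the momentum is constant and \<open>w\<^sub>i\<close> ranges over a face. For \<open>c \<noteq> 0\<close> the curve
  \<open>h\<^sub>i / A\<^sub>i\<close> runs on the boundary of the polar body sweeping twice the area at rate \<open>c \<lambda>\<^sub>i / A\<^sub>i\<close>, and the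
  convex trigonometric functions parametrize that boundary precisely by twice the swept area.
  Conversely, at a point of differentiability a curve on the boundary of the polar body moves along
  the supporting line, which determines the velocity up to a factor, and the factor is read off from
  the area rate. Everything holds almost everywhere, so one needs Lebesgue differentiation, the
  almost everywhere differentiability of Lipschitz functions, and the fact that an absolutely
  continuous function with vanishing derivative is constant.
\<close>

section \<open>Absolutely continuous and Lipschitz functions of one variable\<close>

text \<open>In general neither the bodies nor \<open>Xi \<mu>\<close> are smooth or strictly convex:
  maximizing velocities are not unique, support functions have corners, and \<open>cos_cv\<close>,
  \<open>sin_cv\<close> are merely Lipschitz. What stays differentiable everywhere is the swept area
  as a function of the polar angle, with derivative the squared radius; so areas are compared and
  the radius is never differentiated. For the same reason the constancy of \<open>A $ i\<close> does
  not come from a chain rule: the gauge of the momentum is Lipschitz, and where it is differentiable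
  it is touched from below by a linear function of the momentum. Both directions pass through the
  pivot \<open>pmp_data\<close>. A covector matters only up to a positive factor, so division by the
  absolute value of \<open>c\<close> rescales \<open>A\<close> and leaves only the sign \<gamma>.
  The formula for \<open>z\<close> is conservation of the Hamiltonian:
  \<open>supp_Xi \<mu> A\<close> equals the pairing of the initial momentum with the velocity plus
  \<open>2 * c\<close> times the derivative of \<open>z\<close>, and this can be integrated. When
  \<open>c \<noteq> 0\<close>, a plane with \<open>A $ i = 0\<close> has zero momentum at all times,
  which pins its coordinates at 0.\<close>

definition nonoverlapping :: "real \<Rightarrow> real \<Rightarrow> nat \<Rightarrow> (nat \<Rightarrow> real) \<Rightarrow> (nat \<Rightarrow> real) \<Rightarrow> bool" where
  "nonoverlapping a b m s r \<longleftrightarrow> (\<forall>k<m. a \<le> s k \<and> s k \<le> r k \<and> r k \<le> b) \<and>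
     (\<forall>k<m. \<forall>j<m. k \<noteq> j \<longrightarrow> r k \<le> s j \<or> r j \<le> s k)"

lemma abs_cont_on_iff:
  "abs_cont_on a b f \<longleftrightarrow> (\<forall>e>0. \<exists>\<delta>>0. \<forall>m s r. nonoverlapping a b m s r \<longrightarrow>
     (\<Sum>k<m. r k - s k) < \<delta> \<longrightarrow> (\<Sum>k<m. norm (f (r k) - f (s k))) < e)"
  unfolding abs_cont_on_def nonoverlapping_def by (simp only: imp_conjL)

lemma nonoverlapping_mono:
  assumes "nonoverlapping c d m s r" "a \<le> c" "d \<le> b"
  shows "nonoverlapping a b m s r"
proof -
  have "a \<le> s k \<and> s k \<le> r k \<and> r k \<le> b" if "k < m" for k
  proof -
    have "c \<le> s k \<and> s k \<le> r k \<and> r k \<le> d" using assms(1) that by (simp add: nonoverlapping_def)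
    then show ?thesis using assms(2,3) by linarith
  qed
  then show ?thesis using assms(1) by (simp add: nonoverlapping_def)
qed

lemma abs_cont_on_subinterval:
  assumes ac: "abs_cont_on a b f" and sub: "a \<le> c" "d \<le> b"
  shows "abs_cont_on c d f"
  unfolding abs_cont_on_iff
proof (intro allI impI)
  fix e :: real assume "0 < e"
  then obtain \<delta> where "\<delta> > 0" and ac: "\<forall>m s r. nonoverlapping a b m s r \<longrightarrow>
     (\<Sum>k<m. r k - s k) < \<delta> \<longrightarrow> (\<Sum>k<m. norm (f (r k) - f (s k))) < e"
    using ac unfolding abs_cont_on_iff by blast
  show "\<exists>\<delta>>0. \<forall>m s r. nonoverlapping c d m s r \<longrightarrow>
     (\<Sum>k<m. r k - s k) < \<delta> \<longrightarrow> (\<Sum>k<m. norm (f (r k) - f (s k))) < e"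
    using nonoverlapping_mono[OF _ sub] ac \<open>\<delta> > 0\<close> by (intro exI[of _ \<delta>]) simp
qed

lemma abs_cont_on_add:
  assumes "abs_cont_on a b f" "abs_cont_on a b g"
  shows "abs_cont_on a b (\<lambda>t. f t + g t)"
  unfolding abs_cont_on_iff
proof (intro allI impI)
  fix e :: real assume "0 < e"
  then have e2: "0 < e/2" by simp
  obtain d1 where d1: "d1 > 0" and ac1: "\<forall>m s r. nonoverlapping a b m s r \<longrightarrow>
     (\<Sum>k<m. r k - s k) < d1 \<longrightarrow> (\<Sum>k<m. norm (f (r k) - f (s k))) < e/2"
    using assms(1) e2 unfolding abs_cont_on_iff by blast
  obtain d2 where d2: "d2 > 0" and ac2: "\<forall>m s r. nonoverlapping a b m s r \<longrightarrow>
     (\<Sum>k<m. r k - s k) < d2 \<longrightarrow> (\<Sum>k<m. norm (g (r k) - g (s k))) < e/2"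
    using assms(2) e2 unfolding abs_cont_on_iff by blast
  show "\<exists>\<delta>>0. \<forall>m s r. nonoverlapping a b m s r \<longrightarrow> (\<Sum>k<m. r k - s k) < \<delta> \<longrightarrow>
      (\<Sum>k<m. norm (f (r k) + g (r k) - (f (s k) + g (s k)))) < e"
  proof (rule exI[of _ "min d1 d2"], intro conjI allI impI)
    show "0 < min d1 d2" using d1 d2 by simp
    fix m s r assume n: "nonoverlapping a b m s r" and l: "(\<Sum>k<m. r k - s k) < min d1 d2"
    have "(\<Sum>k<m. norm (f (r k) + g (r k) - (f (s k) + g (s k))))
        \<le> (\<Sum>k<m. norm (f (r k) - f (s k)) + norm (g (r k) - g (s k)))"
      by (intro sum_mono) (smt (verit) add_diff_add norm_triangle_ineq)
    also have "\<dots> = (\<Sum>k<m. norm (f (r k) - f (s k))) + (\<Sum>k<m. norm (g (r k) - g (s k)))"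
      by (simp add: sum.distrib)
    also have "\<dots> < e/2 + e/2"
      using n l ac1 ac2 by (intro add_strict_mono) auto
    finally show "(\<Sum>k<m. norm (f (r k) + g (r k) - (f (s k) + g (s k)))) < e" by simp
  qed
qed

text \<open>Serves two purposes: a coordinate of a vector function is dominated by the function, and
  a Lipschitz function by the linear function with its constant.\<close>

lemma abs_cont_on_dominated:
  assumes ac: "abs_cont_on a b f"
    and dom: "\<And>s t. s \<in> {a..b} \<Longrightarrow> t \<in> {a..b} \<Longrightarrow> s \<le> t \<Longrightarrow> norm (g t - g s) \<le> norm (f t - f s)"
  shows "abs_cont_on a b g"
proof -
  have le: "(\<Sum>k<m. norm (g (r k) - g (s k))) \<le> (\<Sum>k<m. norm (f (r k) - f (s k)))"
    if "nonoverlapping a b m s r" for m s r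
  proof (intro sum_mono)
    fix k assume "k \<in> {..<m}"
    then have "a \<le> s k" "s k \<le> r k" "r k \<le> b" using that by (auto simp: nonoverlapping_def)
    then show "norm (g (r k) - g (s k)) \<le> norm (f (r k) - f (s k))" by (intro dom) auto
  qed
  show ?thesis
    unfolding abs_cont_on_iff
  proof (intro allI impI)
    fix e :: real assume "0 < e"
    then obtain \<delta> where "\<delta> > 0" and ac: "\<forall>m s r. nonoverlapping a b m s r \<longrightarrow>
       (\<Sum>k<m. r k - s k) < \<delta> \<longrightarrow> (\<Sum>k<m. norm (f (r k) - f (s k))) < e"
      using ac unfolding abs_cont_on_iff by blast
    show "\<exists>\<delta>>0. \<forall>m s r. nonoverlapping a b m s r \<longrightarrow>
       (\<Sum>k<m. r k - s k) < \<delta> \<longrightarrow> (\<Sum>k<m. norm (g (r k) - g (s k))) < e"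
    proof (intro exI[of _ \<delta>] conjI allI impI)
      fix m s r assume "nonoverlapping a b m s r" "(\<Sum>k<m. r k - s k) < \<delta>"
      then show "(\<Sum>k<m. norm (g (r k) - g (s k))) < e"
        using ac by (intro order_le_less_trans[OF le]) auto
    qed fact
  qed
qed

lemma lipschitz_imp_abs_cont_on:
  fixes f :: "real \<Rightarrow> 'a::real_normed_vector"
  assumes "C-lipschitz_on {a..b} f"
  shows "abs_cont_on a b f"
proof (rule abs_cont_on_dominated)
  have C: "0 \<le> C" using assms lipschitz_on_nonneg by blast
  show "abs_cont_on a b (\<lambda>t. C * t)"
    unfolding abs_cont_on_iff
  proof (intro allI impI)
    fix e :: real assume e: "0 < e"
    \<comment> \<open>Dividing by \<open>C + 1\<close> instead of \<open>C\<close> leaves a positive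
      bound also when \<open>C = 0\<close>.\<close>
    have "(\<Sum>k<m. norm (C * r k - C * s k)) < e"
      if n: "nonoverlapping a b m s r" and l: "(\<Sum>k<m. r k - s k) < e / (C+1)" for m s r
    proof -
      have "(\<Sum>k<m. norm (C * r k - C * s k)) = C * (\<Sum>k<m. r k - s k)"
        unfolding sum_distrib_left using n C
        by (intro sum.cong) (auto simp: nonoverlapping_def abs_mult right_diff_distrib[symmetric])
      also have "\<dots> \<le> (C+1) * (\<Sum>k<m. r k - s k)"
        using n by (intro mult_right_mono sum_nonneg) (auto simp: nonoverlapping_def)
      also have "\<dots> < e" using l C by (simp add: field_simps)
      finally show ?thesis .
    qed
    then show "\<exists>\<delta>>0. \<forall>m s r. nonoverlapping a b m s r \<longrightarrow> (\<Sum>k<m. r k - s k) < \<delta> \<longrightarrow>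
        (\<Sum>k<m. norm (C * r k - C * s k)) < e"
      using e C by (intro exI[of _ "e/(C+1)"]) simp
  qed
  show "norm (f t - f s) \<le> norm (C * t - C * s)" if "s \<in> {a..b}" "t \<in> {a..b}" "s \<le> t" for s t
    using lipschitz_onD[OF assms, of t s] that C
    by (simp add: dist_norm abs_mult right_diff_distrib[symmetric])
qed

text \<open>A gauge forces the intervals tagged in the exceptional null set into an open set of small
  measure, where absolute continuity controls the increments; the other intervals contribute
  \<open>o(length)\<close>.\<close>

lemma abs_cont_on_deriv_zero_endpoints:
  fixes f :: "real \<Rightarrow> real"
  assumes ac: "abs_cont_on a b f" and ab: "a \<le> b"
    and der: "AE t in lborel. t \<in> {a<..<b} \<longrightarrow> (f has_real_derivative 0) (at t)"
  shows "f b = f a"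
proof (cases "a = b")
  case False
  then have ab: "a < b" using ab by simp
  have "\<bar>f b - f a\<bar> \<le> e" if e: "e > 0" for e
  proof -
    have "0 < e/2" using e by simp
    with ac obtain \<delta> where d0: "\<delta> > 0" and ac: "\<forall>m s r. nonoverlapping a b m s r \<longrightarrow>
       (\<Sum>k<m. r k - s k) < \<delta> \<longrightarrow> (\<Sum>k<m. norm (f (r k) - f (s k))) < e/2"
      unfolding abs_cont_on_iff by blast
    obtain N0 where N0: "N0 \<in> null_sets lborel"
      and N0': "\<And>t. t \<notin> N0 \<Longrightarrow> t \<in> {a<..<b} \<Longrightarrow> (f has_real_derivative 0) (at t)"
      using der by (auto elim!: AE_E3)
    \<comment> \<open>Nothing is known about derivatives at the endpoints, so they join the
      exceptional set.\<close>
    define N where "N = N0 \<union> {a, b}"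
    have N: "N \<in> null_sets lborel"
      unfolding N_def by (intro null_sets.Un N0) (auto intro: finite_imp_null_set_lborel)
    then have NB: "N \<in> sets borel" and N_em: "emeasure lborel N = 0" by auto
    obtain W where W: "open W" "N \<subseteq> W" "emeasure lborel (W - N) < ennreal \<delta>"
      using outer_regular_lborel[OF NB d0] by blast
    have em_W: "emeasure lborel W < ennreal \<delta>"
      using W N emeasure_Diff_null_set[OF N, of W] by (auto simp: borel_open)
    define \<epsilon> where "\<epsilon> = e / (2 * (b - a))"
    have eps: "\<epsilon> > 0" using e ab by (simp add: \<epsilon>_def)
    have "\<exists>d>0. \<forall>y. \<bar>y - t\<bar> < d \<longrightarrow> \<bar>f y - f t\<bar> \<le> \<epsilon> * \<bar>y - t\<bar>" if "t \<notin> N" "t \<in> {a..b}" for t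
    proof -
      have "(f has_derivative (\<lambda>x. 0)) (at t)"
        using N0'[of t] that by (simp add: N_def has_field_derivative_def lambda_zero)
      then have "\<exists>d>0. \<forall>y. norm (y - t) < d \<longrightarrow> norm (f y - f t - 0) \<le> \<epsilon> * norm (y - t)"
        using eps unfolding has_derivative_at_alt by blast
      then show ?thesis by simp
    qed
    then obtain d where d: "\<And>t. t \<notin> N \<Longrightarrow> t \<in> {a..b} \<Longrightarrow> d t > 0 \<and> (\<forall>y. \<bar>y - t\<bar> < d t \<longrightarrow> \<bar>f y - f t\<bar> \<le> \<epsilon> * \<bar>y - t\<bar>)"
      by metis
    define G where "G = (\<lambda>t. if t \<in> N then W else if t \<in> {a..b} then ball t (d t) else UNIV)"
    have "gauge G" unfolding gauge_def G_def using W d by auto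
    then obtain p where p: "p tagged_division_of {a..b}" and fine: "G fine p"
      using fine_division_exists_real by blast
    have fin: "finite p" using p by blast
    define inc where "inc = (\<lambda>(x::real, K). f (Sup K) - f (Inf K))"
    have K_int: "\<exists>u v. K = {u..v} \<and> u \<le> v \<and> a \<le> u \<and> v \<le> b \<and> u \<le> x \<and> x \<le> v" if "(x,K) \<in> p" for x K
    proof -
      obtain u v where uv: "K = cbox u v" using p \<open>(x,K) \<in> p\<close> by blast
      have "x \<in> K" "K \<subseteq> {a..b}" using p that by (blast, metis tagged_division_ofD(3) that)
      then show ?thesis using uv by (intro exI[of _ u] exI[of _ v]) auto
    qed
    have len: "(\<Sum>(x,K)\<in>p. Sup K - Inf K) = b - a"
      using additive_tagged_division_1[of a b p "\<lambda>x. x"] ab p by simp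
    have tel: "(\<Sum>z\<in>p. inc z) = f b - f a"
      using additive_tagged_division_1[of a b p f] ab p by (simp add: inc_def)
    \<comment> \<open>Degenerate cells have empty interior and could lie inside another cell, which
      would spoil \<open>disj\<close>. Their increments vanish, so they are dropped here.\<close>
    define p1 where "p1 = {z \<in> p. fst z \<in> N \<and> Inf (snd z) < Sup (snd z)}"
    define p2 where "p2 = {z \<in> p. fst z \<notin> N}"
    have split: "(\<Sum>z\<in>p. inc z) = (\<Sum>z\<in>p1. inc z) + (\<Sum>z\<in>p2. inc z)"
    proof -
      have "(\<Sum>z\<in>p1. inc z) + (\<Sum>z\<in>p2. inc z) = (\<Sum>z\<in>p1 \<union> p2. inc z)"
        by (rule sum.union_disjoint[symmetric]) (use fin in \<open>auto simp: p1_def p2_def\<close>)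
      also have "\<dots> = (\<Sum>z\<in>p. inc z)"
      proof (rule sum.mono_neutral_left)
        show "\<forall>z\<in>p - (p1 \<union> p2). inc z = 0"
        proof
          fix z assume z: "z \<in> p - (p1 \<union> p2)"
          obtain x K where xK: "z = (x,K)" by fastforce
          obtain u v where uv: "K = {u..v}" "u \<le> v" using K_int[of x K] z xK by blast
          then have "u = v" using z xK by (auto simp: p1_def p2_def)
          then show "inc z = 0" using uv xK by (simp add: inc_def)
        qed
      qed (use fin in \<open>auto simp: p1_def p2_def\<close>)
      finally show ?thesis by simp
    qed
    have "\<bar>\<Sum>z\<in>p2. inc z\<bar> \<le> (\<Sum>z\<in>p2. \<epsilon> * (Sup (snd z) - Inf (snd z)))"
    proof (rule order_trans[OF sum_abs], rule sum_mono)
      fix z assume z: "z \<in> p2"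
      obtain x K where xK: "z = (x,K)" by fastforce
      have xp: "(x,K) \<in> p" and xN: "x \<notin> N" using z xK by (auto simp: p2_def)
      obtain u v where uv: "K = {u..v}" "u \<le> x" "x \<le> v" "a \<le> u" "v \<le> b" using K_int[OF xp] by blast
      have xab: "x \<in> {a..b}" using uv by auto
      have "K \<subseteq> G x" using fine xp by (auto simp: fine_def)
      then have "K \<subseteq> ball x (d x)" using xN xab by (simp add: G_def)
      moreover have "u \<in> K" "v \<in> K" using uv by auto
      ultimately have "u \<in> ball x (d x)" "v \<in> ball x (d x)" by blast+
      then have "\<bar>u - x\<bar> < d x" "\<bar>v - x\<bar> < d x" by (auto simp: dist_real_def)
      then have "\<bar>f u - f x\<bar> \<le> \<epsilon> * \<bar>u - x\<bar>" "\<bar>f v - f x\<bar> \<le> \<epsilon> * \<bar>v - x\<bar>"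
        using d[OF xN xab] by blast+
      then have "\<bar>f v - f u\<bar> \<le> \<epsilon> * \<bar>u - x\<bar> + \<epsilon> * \<bar>v - x\<bar>" by linarith
      also have "\<dots> = \<epsilon> * (v - u)" using uv by (simp add: algebra_simps)
      finally show "\<bar>inc z\<bar> \<le> \<epsilon> * (Sup (snd z) - Inf (snd z))"
        using uv by (simp add: inc_def xK)
    qed
    also have "\<dots> \<le> (\<Sum>z\<in>p. \<epsilon> * (Sup (snd z) - Inf (snd z)))"
    proof (rule sum_mono2[OF fin])
      fix z assume "z \<in> p - p2"
      then show "0 \<le> \<epsilon> * (Sup (snd z) - Inf (snd z))"
        using K_int[of "fst z" "snd z"] eps by auto
    qed (auto simp: p2_def)
    also have "\<dots> = \<epsilon> * (b - a)"
      unfolding sum_distrib_left[symmetric] len[symmetric] by (simp add: case_prod_unfold)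
    also have "\<dots> = e/2" using ab by (simp add: \<epsilon>_def field_simps)
    finally have 2: "\<bar>\<Sum>z\<in>p2. inc z\<bar> \<le> e/2" .
    have fin1: "finite p1" using fin by (simp add: p1_def)
    obtain h where h: "bij_betw h {0..<card p1} p1" using ex_bij_betw_nat_finite[OF fin1] by blast
    define m where "m = card p1"
    define s where "s = (\<lambda>k. Inf (snd (h k)))"
    define r where "r = (\<lambda>k. Sup (snd (h k)))"
    have hp: "h k \<in> p1" if "k < m" for k using h that by (auto simp: m_def bij_betw_def)
    have hK: "snd (h k) = {s k..r k} \<and> s k < r k \<and> a \<le> s k \<and> r k \<le> b \<and> {s k..r k} \<subseteq> W" if "k < m" for k
    proof -
      obtain x K where xK: "h k = (x,K)" by fastforce
      have xp: "(x,K) \<in> p" and xN: "x \<in> N" and lt: "Inf K < Sup K" using hp[OF that] xK by (auto simp: p1_def)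
      obtain u v where uv: "K = {u..v}" "u \<le> v" "a \<le> u" "v \<le> b" using K_int[OF xp] by blast
      have "K \<subseteq> G x" using fine xp by (auto simp: fine_def)
      then have "K \<subseteq> W" using xN by (simp add: G_def)
      then show ?thesis using uv lt by (auto simp: s_def r_def xK)
    qed
    have disj: "r k \<le> s j \<or> r j \<le> s k" if "k < m" "j < m" "k \<noteq> j" for k j
    proof -
      have "h k \<noteq> h j" using h that by (auto simp: m_def bij_betw_def inj_on_def)
      moreover have "h k \<in> p" "h j \<in> p" using hp that by (auto simp: p1_def)
      ultimately have "interior (snd (h k)) \<inter> interior (snd (h j)) = {}"
        using tagged_division_ofD(5)[OF p, of "fst (h k)" "snd (h k)" "fst (h j)" "snd (h j)"] by auto
      then have "{s k<..<r k} \<inter> {s j<..<r j} = {}" using hK that by simp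
      moreover have "(max (s k) (s j) + min (r k) (r j)) / 2 \<in> {s k<..<r k} \<inter> {s j<..<r j}"
        if "\<not> (r k \<le> s j \<or> r j \<le> s k)"
        using that hK \<open>k < m\<close> \<open>j < m\<close> by (auto simp: max_def min_def)
      ultimately show ?thesis by blast
    qed
    have sr: "s k \<le> r k" if "k < m" for k using hK[OF that] by simp
    have "ennreal (\<Sum>k<m. r k - s k) = (\<Sum>k<m. emeasure lborel {s k<..<r k})"
      by (subst sum_ennreal[symmetric]) (auto simp: sr)
    also have "\<dots> = emeasure lborel (\<Union>k<m. {s k<..<r k})"
    proof (rule sum_emeasure)
      show "disjoint_family_on (\<lambda>k. {s k<..<r k}) {..<m}"
        unfolding disjoint_family_on_def
      proof (intro ballI impI)
        fix k j assume "k \<in> {..<m}" "j \<in> {..<m}" "k \<noteq> j"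
        then show "{s k<..<r k} \<inter> {s j<..<r j} = {}" using disj[of k j] by auto
      qed
    qed auto
    also have "\<dots> \<le> emeasure lborel W"
    proof (rule emeasure_mono)
      show "(\<Union>k<m. {s k<..<r k}) \<subseteq> W" using hK by fastforce
    qed (use W in auto)
    also note em_W
    finally have "(\<Sum>k<m. r k - s k) < \<delta>"
      by (subst (asm) ennreal_less_iff) (auto intro!: sum_nonneg simp: sr)
    then have "(\<Sum>k<m. norm (f (r k) - f (s k))) < e/2"
    proof (rule ac[rule_format, rotated])
      show "nonoverlapping a b m s r" using hK disj sr by (auto simp: nonoverlapping_def)
    qed
    moreover have "(\<Sum>z\<in>p1. inc z) = (\<Sum>k<m. f (r k) - f (s k))"
      using sum.reindex_bij_betw[OF h, of inc]
      by (simp add: inc_def case_prod_unfold r_def s_def m_def atLeast0LessThan)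
    ultimately have 1: "\<bar>\<Sum>z\<in>p1. inc z\<bar> \<le> e/2"
      using sum_abs[of "\<lambda>k. f (r k) - f (s k)" "{..<m}"] unfolding real_norm_def by linarith
    show ?thesis using 1 2 split tel by linarith
  qed
  then have "\<bar>f b - f a\<bar> \<le> 0 + e" if "e > 0" for e using that by simp
  then have "\<bar>f b - f a\<bar> \<le> 0" by (rule field_le_epsilon)
  then show ?thesis by simp
qed simp

lemma abs_cont_on_deriv_zero_const:
  fixes f :: "real \<Rightarrow> real"
  assumes ac: "abs_cont_on a b f"
    and der: "AE t in lborel. t \<in> {a<..<b} \<longrightarrow> (f has_real_derivative 0) (at t)"
    and t: "t \<in> {a..b}"
  shows "f t = f a"
proof (rule abs_cont_on_deriv_zero_endpoints[of a t f])
  show "abs_cont_on a t f" using ac t by (auto intro: abs_cont_on_subinterval)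
  show "AE s in lborel. s \<in> {a<..<t} \<longrightarrow> (f has_real_derivative 0) (at s)"
    using der by eventually_elim (use t in auto)
qed (use t in auto)

text \<open>The difference is Lipschitz, hence absolutely continuous, with zero derivative off a
  null set. Most integrated identities below are verified in this way, on derivatives.\<close>

lemma lipschitz_eq_if_same_deriv:
  fixes f g :: "real \<Rightarrow> real"
  assumes "C-lipschitz_on {a..b} f" "D-lipschitz_on {a..b} g"
    and der: "AE t in lborel. t \<in> {a<..<b} \<longrightarrow>
      (\<exists>d. (f has_real_derivative d) (at t) \<and> (g has_real_derivative d) (at t))"
    and t: "t \<in> {a..b}"
    and "f a = g a"
  shows "f t = g t"
proof -
  have "(C + D)-lipschitz_on {a..b} (\<lambda>t. f t - g t)"
    using assms by (intro lipschitz_intros)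
  then have "abs_cont_on a b (\<lambda>t. f t - g t)" by (rule lipschitz_imp_abs_cont_on)
  then have "f t - g t = f a - g a"
  proof (rule abs_cont_on_deriv_zero_const)
    show "AE t in lborel. t \<in> {a<..<b} \<longrightarrow> ((\<lambda>t. f t - g t) has_real_derivative 0) (at t)"
      using der by eventually_elim (auto intro!: derivative_eq_intros)
  qed (rule t)
  then show ?thesis using assms by simp
qed

section \<open>Lebesgue differentiation and differentiability of Lipschitz functions almost
  everywhere\<close>

lemma negligible_imp_AE_lborel:
  assumes "negligible N"
  shows "AE x in lborel. x \<notin> N"
proof -
  have "N \<in> null_sets (completion lborel)" using assms by (simp add: negligible_iff_null_sets)
  then obtain N' where "N' \<in> null_sets lborel" "N \<subseteq> N'" unfolding null_sets_completion_iff2 by blast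
  then show ?thesis by (intro AE_I'[of N']) auto
qed

text \<open>The differentiation theorem is used in its one-sided form, for averages over
  \<open>{x..x + h}\<close>; applied to the reflected function it supplies the left derivative. The
  null set is the same for all lower limits \<open>a\<close>.\<close>

lemma integral_has_real_derivative_AE:
  fixes g :: "real \<Rightarrow> real"
  assumes int: "\<And>a b. g integrable_on {a..b}"
  shows "AE x in lborel. \<forall>a<x. ((\<lambda>t. integral {a..t} g) has_real_derivative g x) (at x)"
proof -
  obtain N1 where N1: "negligible N1" and D1: "\<And>x e. x \<notin> N1 \<Longrightarrow> 0 < e \<Longrightarrow>
      \<exists>d>0. \<forall>h. 0 < h \<and> h < d \<longrightarrow> \<bar>integral {x..x + h} g / h - g x\<bar> < e"
    using integrable_ccontinuous_explicit[where f = g] int by (auto simp: divide_inverse_commute)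
  have "(\<lambda>x. g (- x)) integrable_on {a..b}" for a b
    using Henstock_Kurzweil_Integration.integrable_reflect_real[where f = g and a = "-b" and b = "-a"] int by simp
  then obtain N2 where N2: "negligible N2" and D2: "\<And>x e. x \<notin> N2 \<Longrightarrow> 0 < e \<Longrightarrow>
      \<exists>d>0. \<forall>h. 0 < h \<and> h < d \<longrightarrow> \<bar>integral {x..x + h} (\<lambda>x. g (-x)) / h - g (-x)\<bar> < e"
    using integrable_ccontinuous_explicit[where f = "\<lambda>x. g (-x)"] by (auto simp: divide_inverse_commute)
  have "negligible (uminus ` N2)"
    by (rule negligible_locally_Lipschitz_image[OF _ N2]) (auto intro!: exI[of _ "UNIV :: real set"] exI[of _ "1 :: real"])
  then have neg: "negligible (N1 \<union> uminus ` N2)" using N1 by (rule negligible_Un[rotated])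
  show ?thesis
    using negligible_imp_AE_lborel[OF neg]
  proof eventually_elim
    case (elim x)
    then have x1: "x \<notin> N1" and x2: "-x \<notin> N2" by (auto simp: image_iff)
    show ?case
    proof (intro allI impI)
      fix a assume a: "a < x"
      let ?F = "\<lambda>t. integral {a..t} g"
      show "(?F has_real_derivative g x) (at x)"
        unfolding DERIV_def LIM_eq
      proof (intro allI impI)
        fix e :: real assume e: "0 < e"
        obtain d1 where d1: "d1 > 0" "\<And>h. 0 < h \<Longrightarrow> h < d1 \<Longrightarrow> \<bar>integral {x..x + h} g / h - g x\<bar> < e"
          using D1[OF x1 e] by blast
        obtain d2 where d2: "d2 > 0" "\<And>h. 0 < h \<Longrightarrow> h < d2 \<Longrightarrow>
            \<bar>integral {-x..-x + h} (\<lambda>x. g (-x)) / h - g x\<bar> < e"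
          using D2[OF x2 e] by auto
        show "\<exists>s>0. \<forall>h. h \<noteq> 0 \<and> norm (h - 0) < s \<longrightarrow> norm ((?F (x + h) - ?F x) / h - g x) < e"
        proof (intro exI[of _ "min (min d1 d2) (x - a)"] conjI allI impI)
          fix h :: real assume h: "h \<noteq> 0 \<and> norm (h - 0) < min (min d1 d2) (x - a)"
          show "norm ((?F (x + h) - ?F x) / h - g x) < e"
          proof (cases "h > 0")
            case True
            have "?F x + integral {x..x+h} g = ?F (x + h)"
              using True a int by (intro Henstock_Kurzweil_Integration.integral_combine) auto
            then have "?F (x + h) - ?F x = integral {x..x+h} g" by simp
            then show ?thesis using d1(2)[of h] True h by simp
          next
            case False
            then have hn: "h < 0" using h by auto
            have "?F (x + h) + integral {x+h..x} g = ?F x"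
              using hn h a int by (intro Henstock_Kurzweil_Integration.integral_combine) auto
            then have "?F (x + h) - ?F x = - integral {x+h..x} g" by simp
            also have "integral {x+h..x} g = integral {-x..-x + (-h)} (\<lambda>x. g (-x))"
              using Henstock_Kurzweil_Integration.integral_reflect_real[where f = g and a = "x+h" and b = x] by (simp add: add.commute)
            finally show ?thesis using d2(2)[of "-h"] hn h by simp
          qed
        qed (use d1 d2 a in auto)
      qed
    qed
  qed
qed

text \<open>Adding a steep linear function turns \<open>f\<close> into an increasing bi-Lipschitz
  bijection \<open>K\<close> with inverse \<open>J\<close>. Since \<open>K\<close> maps null sets to
  null sets, the image of Lebesgue measure under \<open>J\<close>, which gives \<open>{a..b}\<close>
  the mass \<open>K b - K a\<close>, is absolutely continuous. Its Radon-Nikodym density integrates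
  to \<open>K\<close>, and Lebesgue differentiation applies.\<close>

lemma lipschitz_real_differentiable_AE_UNIV:
  fixes f :: "real \<Rightarrow> real"
  assumes lip: "C-lipschitz_on UNIV f"
  shows "AE t in lborel. \<exists>d. (f has_real_derivative d) (at t)"
proof -
  \<comment> \<open>The slope \<open>C + 1\<close> exceeds the Lipschitz constant by 1, so
    \<open>K\<close> grows at least as fast as the identity. Hence it is onto and its inverse is
    1-Lipschitz.\<close>
  define K where "K = (\<lambda>x. f x + (C + 1) * x)"
  have C: "C \<ge> 0" using lip lipschitz_on_nonneg by blast
  have f_diff: "\<bar>f y - f x\<bar> \<le> C * \<bar>y - x\<bar>" for x y
    using lipschitz_onD[OF lip, of y x] by (simp add: dist_real_def)
  have K_ge: "y - x \<le> K y - K x" if "x \<le> y" for x y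
    using f_diff[of y x] that by (simp add: K_def algebra_simps)
  have K_lip: "\<bar>K y - K x\<bar> \<le> (2 * C + 1) * \<bar>y - x\<bar>" for x y
  proof -
    have "\<bar>K y - K x\<bar> \<le> \<bar>f y - f x\<bar> + \<bar>(C + 1) * (y - x)\<bar>"
      by (simp add: K_def algebra_simps abs_if)
    also have "\<dots> \<le> C * \<bar>y - x\<bar> + (C + 1) * \<bar>y - x\<bar>" using f_diff C by (simp add: abs_mult)
    finally show ?thesis by (simp add: algebra_simps)
  qed
  have "continuous_on UNIV f" by (rule lipschitz_on_continuous_on[OF lip])
  then have contK: "continuous_on UNIV K" unfolding K_def by (intro continuous_intros)
  have K_less: "K x < K y \<longleftrightarrow> x < y" for x y
    using K_ge[of x y] K_ge[of y x] by (cases "x < y") auto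
  then have K_le: "K x \<le> K y \<longleftrightarrow> x \<le> y" for x y by (meson not_le)
  have "\<exists>x. K x = y" for y
  proof -
    define r where "r = \<bar>y - K 0\<bar>"
    have "K (-r) \<le> y" "y \<le> K r" using K_ge[of "-r" 0] K_ge[of 0 r] by (auto simp: r_def)
    then show ?thesis
      using IVT'[of K "-r" y r] continuous_on_subset[OF contK] by (auto simp: r_def)
  qed
  then obtain J where KJ: "\<And>y. K (J y) = y" by metis
  have JK: "J (K x) = x" for x by (metis K_less KJ less_irrefl linorder_less_linear)
  have J_mono: "J x \<le> J y \<longleftrightarrow> x \<le> y" for x y by (metis KJ K_le)
  have J_lip: "\<bar>J y - J x\<bar> \<le> 1 * \<bar>y - x\<bar>" for x y
    using K_ge[of "J x" "J y"] K_ge[of "J y" "J x"] KJ by (cases "J x \<le> J y") auto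
  have "1-lipschitz_on UNIV J" using J_lip by (intro lipschitz_onI) (auto simp: dist_real_def)
  then have "continuous_on UNIV J" by (rule lipschitz_on_continuous_on)
  then have J_meas[measurable]: "J \<in> borel_measurable borel" by (rule borel_measurable_continuous_onI)
  define \<nu> where "\<nu> = distr lborel borel J"
  have vimage: "J -` A = K ` A" for A
  proof (intro set_eqI iffI)
    fix y assume "y \<in> J -` A"
    then show "y \<in> K ` A" using KJ[of y] by (intro image_eqI[of _ _ "J y"]) auto
  qed (use JK in auto)
  have em: "emeasure \<nu> A = emeasure lborel (J -` A)" if "A \<in> sets borel" for A
    using that by (simp add: \<nu>_def emeasure_distr)
  have ac: "absolutely_continuous lborel \<nu>"
    unfolding absolutely_continuous_def
  proof
    fix A :: "real set" assume A: "A \<in> null_sets lborel"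
    then have AB: "A \<in> sets borel" by auto
    have "negligible A"
      using A by (simp add: negligible_iff_null_sets null_sets_completionI)
    then have "negligible (K ` A)"
    proof (rule negligible_locally_Lipschitz_image[rotated])
      fix x assume "x \<in> A"
      show "\<exists>T B. open T \<and> x \<in> T \<and> (\<forall>y\<in>A \<inter> T. norm (K y - K x) \<le> B * norm (y - x))"
        using K_lip by (intro exI[of _ UNIV] exI[of _ "2*C+1"]) auto
    qed simp
    then have "J -` A \<in> null_sets (completion lborel)" by (simp add: vimage negligible_iff_null_sets)
    moreover have "J -` A \<in> sets lborel" using measurable_sets[OF J_meas AB] by simp
    ultimately have "J -` A \<in> null_sets lborel" by (simp add: null_sets_completion_iff)
    then show "A \<in> null_sets \<nu>" using em[OF AB] AB by (auto simp: null_sets_def \<nu>_def)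
  qed
  obtain f' where f'[measurable]: "f' \<in> borel_measurable lborel" and dens: "density lborel f' = \<nu>"
    using sigma_finite_measure.Radon_Nikodym[OF sigma_finite_lborel ac] by (auto simp: \<nu>_def)
  define g where "g = (\<lambda>x. enn2real (f' x))"
  have g_int: "(g has_integral (K b - K a)) {a..b}" if ab: "a \<le> b" for a b
  proof -
    have "a \<le> J y \<longleftrightarrow> K a \<le> y" "J y \<le> b \<longleftrightarrow> y \<le> K b" for y
      using J_mono[of "K a" y] J_mono[of y "K b"] by (simp_all add: JK)
    then have "J -` {a..b} = {K a..K b}" by auto
    then have n: "(\<integral>\<^sup>+x. f' x * indicator {a..b} x \<partial>lborel) = ennreal (K b - K a)"
      using em[of "{a..b}"] ab K_le by (simp add: dens[symmetric] emeasure_density)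
    then have "AE x in lborel. f' x * indicator {a..b} x \<noteq> \<infinity>"
      by (intro nn_integral_PInf_AE) auto
    then have "(\<integral>\<^sup>+x. ennreal (g x * indicator {a..b} x) \<partial>lborel) = (\<integral>\<^sup>+x. f' x * indicator {a..b} x \<partial>lborel)"
      by (intro nn_integral_cong_AE, eventually_elim)
         (auto simp: g_def indicator_def ennreal_enn2real_if)
    then have "((\<lambda>x. g x * indicator {a..b} x) has_integral (K b - K a)) UNIV"
      using n ab K_le
      by (intro nn_integral_has_integral) (auto simp: g_def)
    then show ?thesis
      by (subst has_integral_restrict_UNIV[symmetric]) (simp add: indicator_def of_bool_def if_distrib cong: if_cong)
  qed
  have "g integrable_on {a..b}" for a b
    using g_int[of a b] by (cases "a \<le> b") (auto simp: integrable_on_def)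
  from integral_has_real_derivative_AE[OF this] show ?thesis
  proof eventually_elim
    case (elim x)
    then have "((\<lambda>t. integral {x - 1..t} g) has_real_derivative g x) (at x)" by simp
    then have "((\<lambda>t. K t - K (x - 1)) has_real_derivative g x) (at x)"
      by (rule has_field_derivative_transform_within_open[where S = "{x - 1<..}"])
         (use g_int in \<open>auto intro!: integral_unique less_imp_le\<close>)
    from DERIV_add[OF this DERIV_const[of "K (x - 1)"]]
    have "(K has_real_derivative g x) (at x)" by simp
    then have "((\<lambda>t. K t - (C + 1) * t) has_real_derivative g x - (C + 1)) (at x)"
      by (auto intro!: derivative_eq_intros)
    then show ?case by (auto simp: K_def)
  qed
qed

text \<open>Projecting the argument to the interval is 1-Lipschitz. The constant extension makes
  global theorems available for functions given on an interval.\<close>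

lemma lipschitz_on_clamp:
  fixes f :: "real \<Rightarrow> 'a::metric_space"
  assumes "C-lipschitz_on {a..b} f" "a \<le> b"
  shows "C-lipschitz_on UNIV (\<lambda>t. f (max a (min b t)))"
proof (rule lipschitz_onI)
  show "0 \<le> C" using assms lipschitz_on_nonneg by blast
  fix x y
  have "dist (f (max a (min b x))) (f (max a (min b y))) \<le> C * dist (max a (min b x)) (max a (min b y))"
    using assms(2) by (intro lipschitz_onD[OF assms(1)]) auto
  also have "\<dots> \<le> C * dist x y"
    using \<open>0 \<le> C\<close> by (intro mult_left_mono) (auto simp: dist_real_def)
  finally show "dist (f (max a (min b x))) (f (max a (min b y))) \<le> C * dist x y" .
qed

lemma lipschitz_real_differentiable_AE:
  fixes f :: "real \<Rightarrow> real"
  assumes lip: "C-lipschitz_on {a..b} f"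
  shows "AE t in lborel. t \<in> {a<..<b} \<longrightarrow> (\<exists>d. (f has_real_derivative d) (at t))"
proof (cases "a \<le> b")
  case True
  show ?thesis
    using lipschitz_real_differentiable_AE_UNIV[OF lipschitz_on_clamp[OF lip True]]
  proof eventually_elim
    case (elim t)
    then show ?case
      by (auto intro!: exI elim!: has_field_derivative_transform_within_open[where S = "{a<..<b}"]
          simp: max_def min_def)
  qed
qed simp

text \<open>Difference quotients along the fixed sequence \<open>1 / Suc n\<close> are Borel
  functions of \<open>t\<close>, and so is their \<open>lim\<close>, whatever value it takes where
  the sequence diverges. This later gives velocities that depend measurably on time.\<close>

lemma measurable_derivative:
  fixes f :: "real \<Rightarrow> real"
  assumes cont: "continuous_on {a..b} f" and ab: "a \<le> b"
  obtains D where "D \<in> borel_measurable borel"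
    "\<And>t d. t \<in> {a<..<b} \<Longrightarrow> (f has_real_derivative d) (at t) \<Longrightarrow> D t = d"
proof -
  define F where "F = (\<lambda>t. f (max a (min b t)))"
  have "continuous_on UNIV F" unfolding F_def
    by (rule continuous_on_compose2[OF cont]) (use ab in \<open>auto intro!: continuous_intros\<close>)
  then have [measurable]: "F \<in> borel_measurable borel" by (rule borel_measurable_continuous_onI)
  define D where "D = (\<lambda>t. lim (\<lambda>n. (F (t + 1 / real (Suc n)) - F t) / (1 / real (Suc n))))"
  have "D \<in> borel_measurable borel" unfolding D_def by measurable
  moreover have "D t = d" if t: "t \<in> {a<..<b}" and "(f has_real_derivative d) (at t)" for t d
  proof -
    have "(F has_real_derivative d) (at t)"
      using that(2) by (rule has_field_derivative_transform_within_open[where S = "{a<..<b}"])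
        (use t in \<open>auto simp: F_def max_def min_def\<close>)
    then have lim: "((\<lambda>h. (F (t + h) - F t) / h) \<longlongrightarrow> d) (at 0)" by (simp add: DERIV_def)
    have "(\<lambda>n. 1 / real (Suc n)) \<longlonglongrightarrow> 0" using LIMSEQ_inverse_real_of_nat by (simp add: divide_inverse)
    then have "filterlim (\<lambda>n. 1 / real (Suc n)) (at 0) sequentially"
      by (auto simp: filterlim_at)
    from filterlim_compose[OF lim this] show ?thesis unfolding D_def by (intro limI)
  qed
  ultimately show thesis by (rule that)
qed

section \<open>Gauges and polars of planar convex bodies\<close>

lemma nonneg_real_eqI:
  fixes a b :: real
  assumes "0 \<le> a" "0 \<le> b" "\<And>t. 0 < t \<Longrightarrow> a \<le> t \<longleftrightarrow> b \<le> t"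
  shows "a = b"
  \<comment> \<open>If the numbers differed, their midpoint would be an upper bound of exactly one
    of them.\<close>
  using assms(3)[of "(a + b) / 2"] assms(1,2) by (cases a b rule: linorder_cases) auto

locale conv_body =
  fixes \<Omega> :: "(real \<times> real) set"
  assumes compact_body: "compact \<Omega>" and convex_body: "convex \<Omega>" and zero_interior: "0 \<in> interior \<Omega>"
begin

abbreviation G :: "real \<times> real \<Rightarrow> real" where "G \<equiv> minkowski_fn \<Omega>"

lemma zero_in: "0 \<in> \<Omega>" using zero_interior interior_subset by blast

lemma inner_ball: obtains r where "0 < r" "cball 0 r \<subseteq> \<Omega>"
  using zero_interior by (auto simp: mem_interior_cball)

lemma outer_ball: obtains R where "0 < R" "\<And>p. p \<in> \<Omega> \<Longrightarrow> norm p \<le> R"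
  using compact_imp_bounded[OF compact_body] by (auto simp: bounded_pos)

lemma shrink: "p \<in> \<Omega> \<Longrightarrow> 0 \<le> c \<Longrightarrow> c \<le> 1 \<Longrightarrow> c *\<^sub>R p \<in> \<Omega>"
  using convexD_alt[OF convex_body zero_in, of p c] by simp

text \<open>Keeps the set whose infimum defines the gauge from being empty. The scale uses
  \<open>norm p + 1\<close> so as to be positive at \<open>p = 0\<close> too.\<close>

lemma small_scale: obtains t where "0 < t" "(1 / t) *\<^sub>R p \<in> \<Omega>"
proof -
  obtain r where r: "0 < r" "cball 0 r \<subseteq> \<Omega>" by (rule inner_ball)
  have "r * norm p \<le> r * (norm p + 1)" using r by (intro mult_left_mono) auto
  moreover have "0 < norm p + 1" by (simp add: add_nonneg_pos)
  ultimately have "(1 / ((norm p + 1) / r)) *\<^sub>R p \<in> cball 0 r"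
    using r by (simp add: pos_divide_le_eq)
  then show thesis using r by (intro that[of "(norm p + 1) / r"]) (auto simp: add_nonneg_pos)
qed

lemma gauge_nonneg: "0 \<le> G p"
  unfolding minkowski_fn_def by (rule small_scale[of p]) (auto intro!: cInf_greatest)

text \<open>Because the body is closed, the infimum in the gauge is attained at positive levels.
  Gauges can then be handled through their sublevel sets.\<close>

lemma gauge_le_iff:
  assumes t: "0 < t"
  shows "G p \<le> t \<longleftrightarrow> (1 / t) *\<^sub>R p \<in> \<Omega>"
proof
  have bdd: "bdd_below {t. 0 < t \<and> (1 / t) *\<^sub>R p \<in> \<Omega>}" by (intro bdd_belowI[of _ 0]) auto
  show "G p \<le> t" if "(1 / t) *\<^sub>R p \<in> \<Omega>"
    unfolding minkowski_fn_def using t that by (intro cInf_lower bdd) auto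
  assume le: "G p \<le> t"
  have up: "(1 / s) *\<^sub>R p \<in> \<Omega>" if "t < s" for s
  proof -
    have ne: "{t. 0 < t \<and> (1 / t) *\<^sub>R p \<in> \<Omega>} \<noteq> {}" by (rule small_scale[of p]) auto
    have "G p < s" using le that by simp
    then obtain s' where s': "0 < s'" "(1 / s') *\<^sub>R p \<in> \<Omega>" "s' < s"
      unfolding minkowski_fn_def using cInf_less_iff[OF ne bdd] by auto
    have "(s' / s) *\<^sub>R (1 / s') *\<^sub>R p \<in> \<Omega>" by (rule shrink) (use s' in auto)
    then show ?thesis using s' by simp
  qed
  have "(\<lambda>n. 1 / (t + inverse (real (Suc n)))) \<longlonglongrightarrow> 1 / (t + 0)"
    using t by (intro tendsto_divide tendsto_add tendsto_const LIMSEQ_inverse_real_of_nat) auto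
  then have "(\<lambda>n. (1 / (t + inverse (real (Suc n)))) *\<^sub>R p) \<longlonglongrightarrow> (1 / (t + 0)) *\<^sub>R p"
    by (intro tendsto_scaleR tendsto_const)
  then have lim: "(\<lambda>n. (1 / (t + inverse (real (Suc n)))) *\<^sub>R p) \<longlonglongrightarrow> (1 / t) *\<^sub>R p" by simp
  show "(1 / t) *\<^sub>R p \<in> \<Omega>"
    by (rule closed_sequentially[OF compact_imp_closed[OF compact_body] _ lim]) (rule up, simp)
qed

lemma body_iff_gauge: "p \<in> \<Omega> \<longleftrightarrow> G p \<le> 1"
  by (simp add: gauge_le_iff)

lemma gauge_zero [simp]: "G 0 = 0"
proof (rule nonneg_real_eqI)
  fix t :: real assume "0 < t"
  then show "G 0 \<le> t \<longleftrightarrow> 0 \<le> t" by (simp add: gauge_le_iff zero_in)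
qed (simp_all add: gauge_nonneg)

lemma gauge_scale:
  assumes c: "0 \<le> c"
  shows "G (c *\<^sub>R p) = c * G p"
proof (cases "c = 0")
  case False
  then have c: "0 < c" using c by simp
  show ?thesis
  proof (rule nonneg_real_eqI)
    fix t :: real assume t: "0 < t"
    have "G (c *\<^sub>R p) \<le> t \<longleftrightarrow> (1 / (t / c)) *\<^sub>R p \<in> \<Omega>" using t c by (simp add: gauge_le_iff)
    also have "\<dots> \<longleftrightarrow> G p \<le> t / c" using t c by (subst gauge_le_iff) auto
    also have "\<dots> \<longleftrightarrow> c * G p \<le> t" using c by (simp add: field_simps)
    finally show "G (c *\<^sub>R p) \<le> t \<longleftrightarrow> c * G p \<le> t" .
  qed (use c in \<open>simp_all add: gauge_nonneg\<close>)
qed simp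

lemma gauge_triangle: "G (p + q) \<le> G p + G q"
proof (rule field_le_epsilon)
  fix e :: real assume e: "0 < e"
  \<comment> \<open>A gauge may be zero; the added slack makes division by it possible.\<close>
  define s where "s = G p + e / 2"
  define t where "t = G q + e / 2"
  have st: "0 < s" "0 < t" using e gauge_nonneg[of p] gauge_nonneg[of q] by (auto simp: s_def t_def)
  have "(1 / s) *\<^sub>R p \<in> \<Omega>" "(1 / t) *\<^sub>R q \<in> \<Omega>"
    using st e by (simp_all add: gauge_le_iff[symmetric]) (simp_all add: s_def t_def)
  then have "(s / (s + t)) *\<^sub>R (1 / s) *\<^sub>R p + (t / (s + t)) *\<^sub>R (1 / t) *\<^sub>R q \<in> \<Omega>"
    using st by (intro convexD[OF convex_body]) (auto simp: add_divide_distrib[symmetric])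
  then have "(1 / (s + t)) *\<^sub>R (p + q) \<in> \<Omega>" using st by (simp add: scaleR_add_right)
  then have "G (p + q) \<le> s + t" using st by (subst gauge_le_iff) auto
  then show "G (p + q) \<le> G p + G q + e" by (simp add: s_def t_def)
qed

lemma gauge_upper: obtains C where "0 < C" "\<And>p. G p \<le> C * norm p"
proof -
  obtain r where r: "0 < r" "cball 0 r \<subseteq> \<Omega>" by (rule inner_ball)
  have "G p \<le> (1 / r) * norm p" for p
  proof (cases "p = 0")
    case False
    have "(1 / ((1 / r) * norm p)) *\<^sub>R p \<in> cball 0 r" using r False by simp
    then show ?thesis using r False by (subst gauge_le_iff) auto
  qed simp
  then show thesis using r by (intro that[of "1 / r"]) auto
qed

lemma gauge_lower: obtains c where "0 < c" "\<And>p. c * norm p \<le> G p"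
proof -
  obtain R where R: "0 < R" "\<And>p. p \<in> \<Omega> \<Longrightarrow> norm p \<le> R" by (rule outer_ball) blast
  have "(1 / R) * norm p \<le> G p" for p
  proof (rule field_le_epsilon)
    fix e :: real assume e: "0 < e"
    define t where "t = G p + e"
    have t: "0 < t" "G p \<le> t" using e gauge_nonneg[of p] by (auto simp: t_def)
    then have "(1 / t) *\<^sub>R p \<in> \<Omega>" by (simp add: gauge_le_iff)
    from R(2)[OF this] have "norm p \<le> R * t" using t by (simp add: field_simps)
    then show "(1 / R) * norm p \<le> G p + e" using R by (simp add: t_def field_simps)
  qed
  then show thesis using R by (intro that[of "1 / R"]) auto
qed

lemma gauge_pos: "p \<noteq> 0 \<Longrightarrow> 0 < G p"
proof -
  assume "p \<noteq> 0"
  obtain c where c: "0 < c" "\<And>p. c * norm p \<le> G p" by (rule gauge_lower) blast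
  have "0 < c * norm p" using c \<open>p \<noteq> 0\<close> by simp
  then show ?thesis using c(2)[of p] by linarith
qed

lemma gauge_eq_0_iff [simp]: "G p = 0 \<longleftrightarrow> p = 0"
  by (metis gauge_pos gauge_zero less_irrefl)

lemma gauge_lipschitz: obtains C where "C-lipschitz_on UNIV G"
proof -
  obtain C where C: "0 < C" "\<And>p. G p \<le> C * norm p" by (rule gauge_upper) blast
  have "dist (G p) (G q) \<le> C * dist p q" for p q
  proof -
    \<comment> \<open>The body need not be symmetric, so the two differences are estimated
      separately.\<close>
    have "G p \<le> G (p - q) + G q" "G q \<le> G (q - p) + G p"
      using gauge_triangle[of "p - q" q] gauge_triangle[of "q - p" p] by simp_all
    then show ?thesis
      using C(2)[of "p - q"] C(2)[of "q - p"]
      by (simp add: dist_norm norm_minus_commute)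
  qed
  then show thesis using C by (intro that[of C] lipschitz_onI) auto
qed

lemma continuous_gauge: "continuous_on S G"
  by (rule gauge_lipschitz) (blast intro: lipschitz_on_continuous_on continuous_on_subset)

text \<open>An interior point stays in the body after stretching by some factor
  \<open>c > 1\<close>, which pushes its gauge strictly below 1. Conversely \<open>G p < 1\<close>
  is an open condition that implies membership.\<close>

lemma frontier_iff_gauge: "p \<in> frontier \<Omega> \<longleftrightarrow> G p = 1"
proof -
  have "interior \<Omega> = {p. G p < 1}"
  proof (intro antisym subsetI)
    fix p assume p: "p \<in> interior \<Omega>"
    have "((\<lambda>c::real. c *\<^sub>R p) \<longlongrightarrow> 1 *\<^sub>R p) (at 1)" by (intro tendsto_intros)
    then have "((\<lambda>c::real. c *\<^sub>R p) \<longlongrightarrow> p) (at 1)" by simp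
    then have "\<forall>\<^sub>F c in at 1. c *\<^sub>R p \<in> interior \<Omega>"
      using p by (intro topological_tendstoD) auto
    then have "\<forall>\<^sub>F c::real in at_right 1. c *\<^sub>R p \<in> interior \<Omega>"
      by (simp add: eventually_at_split)
    moreover have "\<forall>\<^sub>F c::real in at_right 1. 1 < c" by (rule eventually_at_right_less)
    ultimately have "\<forall>\<^sub>F c::real in at_right 1. c *\<^sub>R p \<in> interior \<Omega> \<and> 1 < c"
      by (rule eventually_conj)
    from eventually_happens'[OF trivial_limit_at_right_real this]
    obtain c :: real where c: "c *\<^sub>R p \<in> interior \<Omega>" "1 < c" by blast
    then have "c *\<^sub>R p \<in> \<Omega>" using interior_subset by blast
    then have "c * G p \<le> 1" using c by (simp add: body_iff_gauge gauge_scale)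
    have "\<not> 1 \<le> G p"
    proof
      assume "1 \<le> G p"
      then have "c * 1 \<le> c * G p" using c by (intro mult_left_mono) auto
      then show False using c \<open>c * G p \<le> 1\<close> by linarith
    qed
    then show "p \<in> {p. G p < 1}" by auto
  next
    fix p assume p: "p \<in> {p. G p < 1}"
    have "open {p. G p < 1}" by (intro open_Collect_less continuous_gauge) auto
    then show "p \<in> interior \<Omega>"
      using p by (intro interiorI[of "{p. G p < 1}"]) (auto simp: body_iff_gauge)
  qed
  moreover have "closure \<Omega> = \<Omega>" using compact_imp_closed[OF compact_body] by simp
  ultimately show ?thesis by (auto simp: frontier_def body_iff_gauge)
qed

section \<open>Polar duality\<close>

lemma polar2_iff: "h \<in> polar2 \<Omega> \<longleftrightarrow> (\<forall>w\<in>\<Omega>. h \<bullet> w \<le> 1)"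
  by (cases h) (simp add: polar2_def inner_prod_def case_prod_beta)

text \<open>A ball of radius \<open>r\<close> inside the body bounds the polar by
  \<open>1 / r\<close>; a ball of radius \<open>R\<close> around the body leaves the ball of radius
  \<open>1 / R\<close> inside the polar.\<close>

lemma conv_body_polar: "conv_body (polar2 \<Omega>)"
proof
  obtain r where r: "0 < r" "cball 0 r \<subseteq> \<Omega>" by (rule inner_ball)
  obtain R where R: "0 < R" "\<And>p. p \<in> \<Omega> \<Longrightarrow> norm p \<le> R" by (rule outer_ball) blast
  have eq: "polar2 \<Omega> = (\<Inter>w\<in>\<Omega>. {h. h \<bullet> w \<le> 1})" by (rule set_eqI) (simp add: polar2_iff)
  have "closed (polar2 \<Omega>)" unfolding eq
    by (intro closed_INT ballI closed_Collect_le continuous_intros)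
  moreover have "norm h \<le> 1 / r" if "h \<in> polar2 \<Omega>" for h
  proof (cases "h = 0")
    case False
    have "(r / norm h) *\<^sub>R h \<in> cball 0 r" using r False by simp
    then have "h \<bullet> ((r / norm h) *\<^sub>R h) \<le> 1" using that r unfolding polar2_iff by blast
    then have "r * norm h \<le> 1" using False by (simp add: dot_square_norm power2_eq_square)
    then show ?thesis using r by (simp add: field_simps)
  qed (use r in simp)
  ultimately show "compact (polar2 \<Omega>)"
    unfolding compact_eq_bounded_closed bounded_iff by blast
  show "convex (polar2 \<Omega>)" unfolding eq
  proof (intro convex_INT)
    fix w
    show "convex {h. h \<bullet> w \<le> 1}" using convex_halfspace_le[of w 1] by (simp add: inner_commute)
  qed
  show "0 \<in> interior (polar2 \<Omega>)"
  proof (rule interiorI[of "ball 0 (1 / R)"])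
    show "ball 0 (1 / R) \<subseteq> polar2 \<Omega>"
    proof
      fix h :: "real \<times> real" assume h: "h \<in> ball 0 (1 / R)"
      have "h \<bullet> w \<le> 1" if "w \<in> \<Omega>" for w
      proof -
        have "h \<bullet> w \<le> norm h * norm w" by (rule norm_cauchy_schwarz)
        also have "\<dots> \<le> (1 / R) * R" using h R(2)[OF that] R(1) by (intro mult_mono) auto
        finally show ?thesis using R by simp
      qed
      then show "h \<in> polar2 \<Omega>" by (simp add: polar2_iff)
    qed
  qed (use R in auto)
qed

text \<open>The analogue of the Cauchy-Schwarz inequality for a gauge and its polar: normalize both
  vectors and use the definition of the polar.\<close>

lemma inner_le_gauges: "h \<bullet> w \<le> minkowski_fn (polar2 \<Omega>) h * G w"
proof (cases "h = 0 \<or> w = 0")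
  case True
  interpret P: conv_body "polar2 \<Omega>" by (rule conv_body_polar)
  from True show ?thesis by auto
next
  case False
  interpret P: conv_body "polar2 \<Omega>" by (rule conv_body_polar)
  have pos: "0 < P.G h" "0 < G w" using False by (auto intro: P.gauge_pos gauge_pos)
  have "(1 / P.G h) *\<^sub>R h \<in> polar2 \<Omega>" using P.gauge_le_iff[OF pos(1), of h] by simp
  moreover have "(1 / G w) *\<^sub>R w \<in> \<Omega>" using gauge_le_iff[OF pos(2), of w] by simp
  ultimately have "((1 / P.G h) *\<^sub>R h) \<bullet> ((1 / G w) *\<^sub>R w) \<le> 1" unfolding polar2_iff by blast
  then show ?thesis using pos by (simp add: field_simps)
qed

text \<open>Equality case of \<open>inner_le_gauges\<close>: the polar gauge is the support function
  of the body. The maximizer is taken on the boundary, also for \<open>h = 0\<close>, so that it can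
  later be scaled to any prescribed gauge.\<close>

lemma support_attained: obtains w where "G w = 1" "h \<bullet> w = minkowski_fn (polar2 \<Omega>) h"
proof (cases "h = 0")
  case True
  interpret P: conv_body "polar2 \<Omega>" by (rule conv_body_polar)
  define w where "w = (1 / G (1, 0)) *\<^sub>R (1::real, 0::real)"
  have "0 < G (1, 0)" by (rule gauge_pos) (simp add: zero_prod_def)
  then have "G w = 1" unfolding w_def by (subst gauge_scale) auto
  then show thesis using True by (intro that[of w]) auto
next
  case False
  interpret P: conv_body "polar2 \<Omega>" by (rule conv_body_polar)
  obtain w where w: "w \<in> \<Omega>" "\<And>v. v \<in> \<Omega> \<Longrightarrow> h \<bullet> v \<le> h \<bullet> w"
  proof -
    have cont: "continuous_on \<Omega> (\<lambda>v. h \<bullet> v)" by (intro continuous_intros)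
    show thesis
      using continuous_attains_sup[OF compact_body _ cont] zero_in that by blast
  qed
  obtain r where r: "0 < r" "cball 0 r \<subseteq> \<Omega>" by (rule inner_ball)
  have "(r / norm h) *\<^sub>R h \<in> cball 0 r" using r False by simp
  then have "h \<bullet> ((r / norm h) *\<^sub>R h) \<le> h \<bullet> w" using r w by blast
  moreover have "0 < h \<bullet> ((r / norm h) *\<^sub>R h)" using r False by simp
  ultimately have m: "0 < h \<bullet> w" by linarith
  have "(1 / (h \<bullet> w)) *\<^sub>R h \<in> polar2 \<Omega>" using w m by (auto simp: polar2_iff field_simps)
  then have le: "P.G h \<le> h \<bullet> w" using P.gauge_le_iff[OF m] by simp
  have 1: "h \<bullet> w \<le> P.G h * G w" by (rule inner_le_gauges)
  have Gw: "G w \<le> 1" using w by (simp add: body_iff_gauge)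
  have Pp: "0 < P.G h" using False by (rule P.gauge_pos)
  have "P.G h * G w \<le> P.G h * 1" using Gw Pp by (intro mult_left_mono) auto
  then have eq: "h \<bullet> w = P.G h" using 1 le by linarith
  then have "P.G h * 1 \<le> P.G h * G w" using 1 by simp
  then have "G w = 1" using Gw Pp by (simp del: mult_1_right)
  then show thesis using eq that by blast
qed

end

section \<open>Rotation invariance and triangles\<close>

definition rot :: "real \<Rightarrow> real \<times> real \<Rightarrow> real \<times> real" where
  "rot a p = (cos a * fst p - sin a * snd p, sin a * fst p + cos a * snd p)"

lemma rot_add: "rot a (rot b p) = rot (a + b) p"
  by (simp add: rot_def cos_add sin_add algebra_simps)

lemma rot_0 [simp]: "rot 0 p = p"
  by (simp add: rot_def)

lemma continuous_rot: "continuous_on S (rot a)"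
  unfolding rot_def by (intro continuous_intros)

lemma rot_measurable [measurable]: "rot a \<in> borel_measurable borel"
  by (intro borel_measurable_continuous_onI continuous_rot)

lemma emeasure_lborel_slices:
  fixes A :: "(real \<times> real) set"
  assumes "A \<in> sets borel"
  shows "emeasure lborel A = (\<integral>\<^sup>+u. emeasure lborel (Pair u -` A) \<partial>lborel)"
    and "emeasure lborel A = (\<integral>\<^sup>+v. emeasure lborel ((\<lambda>u. (u, v)) -` A) \<partial>lborel)"
proof -
  have A: "A \<in> sets (lborel \<Otimes>\<^sub>M lborel)" using assms by (simp only: lborel_prod sets_lborel)
  show "emeasure lborel A = (\<integral>\<^sup>+u. emeasure lborel (Pair u -` A) \<partial>lborel)"
    using lborel.emeasure_pair_measure_alt[OF A] by (simp add: lborel_prod)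
  show "emeasure lborel A = (\<integral>\<^sup>+v. emeasure lborel ((\<lambda>u. (u, v)) -` A) \<partial>lborel)"
    using lborel_pair.emeasure_pair_measure_alt2[OF A] by (simp add: lborel_prod)
qed

text \<open>Cavalieri: the shear translates every horizontal slice, and translations preserve
  length.\<close>

lemma emeasure_shear_fst:
  fixes A :: "(real \<times> real) set"
  assumes A: "A \<in> sets borel"
  shows "emeasure lborel ((\<lambda>p. (fst p + k * snd p, snd p)) -` A) = emeasure lborel A"
proof -
  let ?s = "\<lambda>p::real\<times>real. (fst p + k * snd p, snd p)"
  have "continuous_on UNIV ?s" by (intro continuous_intros)
  then have sA: "?s -` A \<in> sets borel"
    using measurable_sets[OF borel_measurable_continuous_onI A] by simp
  have slice: "emeasure lborel ((\<lambda>u. (u, v)) -` (?s -` A)) = emeasure lborel ((\<lambda>u. (u, v)) -` A)" for v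
  proof -
    have "continuous_on UNIV (\<lambda>u::real. (u, v))" by (intro continuous_intros)
    then have B: "(\<lambda>u. (u, v)) -` A \<in> sets borel"
      using measurable_sets[OF borel_measurable_continuous_onI A] by simp
    have "emeasure lborel ((\<lambda>u. (u, v)) -` A) = emeasure (distr lborel borel ((+) (k * v))) ((\<lambda>u. (u, v)) -` A)"
      by (simp add: lborel_distr_plus)
    also have "\<dots> = emeasure lborel ((+) (k * v) -` ((\<lambda>u. (u, v)) -` A))"
      using B by (subst emeasure_distr) auto
    also have "(+) (k * v) -` ((\<lambda>u. (u, v)) -` A) = (\<lambda>u. (u, v)) -` (?s -` A)"
      by (auto simp: add.commute)
    finally show ?thesis by simp
  qed
  have "emeasure lborel (?s -` A) = (\<integral>\<^sup>+v. emeasure lborel ((\<lambda>u. (u, v)) -` (?s -` A)) \<partial>lborel)"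
    by (rule emeasure_lborel_slices(2)[OF sA])
  also have "\<dots> = (\<integral>\<^sup>+v. emeasure lborel ((\<lambda>u. (u, v)) -` A) \<partial>lborel)"
    by (simp only: slice)
  also have "\<dots> = emeasure lborel A"
    by (rule emeasure_lborel_slices(2)[OF A, symmetric])
  finally show ?thesis .
qed

lemma emeasure_shear_snd:
  fixes A :: "(real \<times> real) set"
  assumes A: "A \<in> sets borel"
  shows "emeasure lborel ((\<lambda>p. (fst p, snd p + k * fst p)) -` A) = emeasure lborel A"
proof -
  let ?s = "\<lambda>p::real\<times>real. (fst p, snd p + k * fst p)"
  have "continuous_on UNIV ?s" by (intro continuous_intros)
  then have sA: "?s -` A \<in> sets borel"
    using measurable_sets[OF borel_measurable_continuous_onI A] by simp
  have slice: "emeasure lborel (Pair u -` (?s -` A)) = emeasure lborel (Pair u -` A)" for u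
  proof -
    have "continuous_on UNIV (Pair u :: real \<Rightarrow> _)" by (intro continuous_intros)
    then have B: "Pair u -` A \<in> sets borel"
      using measurable_sets[OF borel_measurable_continuous_onI A] by simp
    have "emeasure lborel (Pair u -` A) = emeasure (distr lborel borel ((+) (k * u))) (Pair u -` A)"
      by (simp add: lborel_distr_plus)
    also have "\<dots> = emeasure lborel ((+) (k * u) -` (Pair u -` A))"
      using B by (subst emeasure_distr) auto
    also have "(+) (k * u) -` (Pair u -` A) = Pair u -` (?s -` A)"
      by (auto simp: add.commute)
    finally show ?thesis by simp
  qed
  have "emeasure lborel (?s -` A) = (\<integral>\<^sup>+u. emeasure lborel (Pair u -` (?s -` A)) \<partial>lborel)"
    by (rule emeasure_lborel_slices(1)[OF sA])
  also have "\<dots> = (\<integral>\<^sup>+u. emeasure lborel (Pair u -` A) \<partial>lborel)"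
    by (simp only: slice)
  also have "\<dots> = emeasure lborel A"
    by (rule emeasure_lborel_slices(1)[OF A, symmetric])
  finally show ?thesis .
qed

text \<open>A rotation by less than a half turn is a product of three shears.\<close>

lemma emeasure_rot_small:
  fixes A :: "(real \<times> real) set"
  assumes A: "A \<in> sets borel" and a: "\<bar>a\<bar> < pi"
  shows "emeasure lborel (rot a -` A) = emeasure lborel A"
proof -
  define b where "b = a / 2"
  have cb: "0 < cos b" using a by (intro cos_gt_zero_pi) (auto simp: b_def)
  \<comment> \<open>The shear factors are \<open>- tan (a / 2)\<close>, \<open>sin a\<close> and
    \<open>- tan (a / 2)\<close> again. The half angle is the reason why \<open>a\<close> stays
    below a half turn.\<close>
  define t where "t = sin b / cos b"
  let ?s1 = "\<lambda>p::real\<times>real. (fst p + (- t) * snd p, snd p)"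
  let ?s2 = "\<lambda>p::real\<times>real. (fst p, snd p + sin a * fst p)"
  have sa: "sin a = 2 * sin b * cos b" and ca: "cos a = 1 - 2 * (sin b)\<^sup>2"
    using sin_double[of b] cos_double_sin[of b] by (simp_all add: b_def)
  have e1: "t * sin a = 1 - cos a" using cb by (simp add: t_def sa ca power2_eq_square)
  have "t * (1 + cos a) = sin b / cos b * (2 * (cos b)\<^sup>2)"
    unfolding t_def ca sin_squared_eq by simp
  also have "\<dots> = sin a" using cb by (simp add: sa power2_eq_square)
  finally have e2: "t * (1 + cos a) = sin a" .
  have "?s1 (?s2 (?s1 p)) = rot a p" for p
  proof -
    obtain u v where p: "p = (u, v)" by fastforce
    have x: "u - t * v - t * (v + sin a * (u - t * v)) = cos a * u - sin a * v"
    proof -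
      have "u - t * v - t * (v + sin a * (u - t * v)) = u - (t * sin a) * u - (t * (2 - t * sin a)) * v"
        by algebra
      also have "\<dots> = cos a * u - (t * (1 + cos a)) * v" by (simp add: e1 algebra_simps)
      also have "\<dots> = cos a * u - sin a * v" by (simp only: e2)
      finally show ?thesis .
    qed
    have y: "v + sin a * (u - t * v) = sin a * u + cos a * v"
    proof -
      have "v + sin a * (u - t * v) = sin a * u + (1 - t * sin a) * v" by algebra
      then show ?thesis by (simp add: e1)
    qed
    show ?thesis using x y by (simp add: p rot_def)
  qed
  then have eq: "rot a -` A = ?s1 -` (?s2 -` (?s1 -` A))" by auto
  have c1: "continuous_on UNIV ?s1" and c2: "continuous_on UNIV ?s2" by (intro continuous_intros)+
  have 1: "?s1 -` A \<in> sets borel"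
    using measurable_sets[OF borel_measurable_continuous_onI[OF c1] A] by simp
  have 2: "?s2 -` (?s1 -` A) \<in> sets borel"
    using measurable_sets[OF borel_measurable_continuous_onI[OF c2] 1] by simp
  show ?thesis unfolding eq emeasure_shear_fst[OF 2] emeasure_shear_snd[OF 1] emeasure_shear_fst[OF A] ..
qed

lemma emeasure_rot:
  fixes A :: "(real \<times> real) set"
  assumes A: "A \<in> sets borel" and a: "\<bar>a\<bar> \<le> 2 * pi"
  shows "emeasure lborel (rot a -` A) = emeasure lborel A"
proof -
  \<comment> \<open>Thirds of a full turn lie strictly below a half turn, whereas halves would reach
    it.\<close>
  have b: "\<bar>a / 3\<bar> < pi" using a pi_gt_zero by linarith
  have m: "rot (a/3) -` B \<in> sets borel" if "B \<in> sets borel" for B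
    using measurable_sets[OF rot_measurable that] by simp
  have "rot a p = rot (a/3) (rot (a/3) (rot (a/3) p))" for p by (simp add: rot_add)
  then have "rot a -` A = rot (a/3) -` (rot (a/3) -` (rot (a/3) -` A))" by auto
  then show ?thesis using A b m by (simp add: emeasure_rot_small)
qed

section \<open>Right triangles with a vertex at the origin\<close>

lemma emeasure_triangle:
  fixes A :: "(real \<times> real) set"
  assumes A: "A \<in> sets borel" and c: "0 \<le> c" and r: "0 \<le> r"
    and slice: "\<And>u. emeasure lborel (Pair u -` A) = ennreal (c * u) * indicator {0..r} u"
  shows "emeasure lborel A = ennreal (c * r\<^sup>2 / 2)"
proof -
  have "((\<lambda>u. c * u) has_integral (c * r\<^sup>2 / 2 - c * 0\<^sup>2 / 2)) {0..r}"
    using r by (intro fundamental_theorem_of_calculus)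
      (auto intro!: derivative_eq_intros simp: has_real_derivative_iff_has_vector_derivative[symmetric])
  then have I: "((\<lambda>u. c * u) has_integral (c * r\<^sup>2 / 2)) {0..r}" by simp
  have "emeasure lborel A = (\<integral>\<^sup>+u. emeasure lborel (Pair u -` A) \<partial>lborel)"
    by (rule emeasure_lborel_slices(1)[OF A])
  also have "\<dots> = (\<integral>\<^sup>+u. ennreal (c * u) * indicator {0..r} u \<partial>lborel)"
    by (simp only: slice)
  also have "\<dots> = ennreal (c * r\<^sup>2 / 2)"
    using c by (intro nn_integral_has_integral_lebesgue'[OF _ I]) auto
  finally show ?thesis .
qed

definition triangle :: "real \<Rightarrow> real \<Rightarrow> (real \<times> real) set" where
  "triangle c r = {p. 0 \<le> fst p \<and> fst p \<le> r \<and> 0 \<le> snd p \<and> snd p \<le> c * fst p}"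

text \<open>Only the two edges through the origin are removed. This is the figure to be fitted
  inside a difference of two sectors, which lacks one of its bounding rays.\<close>

definition open_triangle :: "real \<Rightarrow> real \<Rightarrow> (real \<times> real) set" where
  "open_triangle c r = {p. 0 \<le> fst p \<and> fst p \<le> r \<and> 0 < snd p \<and> snd p < c * fst p}"

lemma triangle_sets [measurable]: "triangle c r \<in> sets borel" "open_triangle c r \<in> sets borel"
proof -
  have "{p::real\<times>real. 0 \<le> fst p} \<in> sets borel" "{p::real\<times>real. fst p \<le> r} \<in> sets borel"
    "{p::real\<times>real. 0 \<le> snd p} \<in> sets borel" "{p::real\<times>real. snd p \<le> c * fst p} \<in> sets borel"
    "{p::real\<times>real. 0 < snd p} \<in> sets borel" "{p::real\<times>real. snd p < c * fst p} \<in> sets borel"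
    by (intro borel_closed borel_open closed_Collect_le open_Collect_less continuous_intros)+
  then show "triangle c r \<in> sets borel" "open_triangle c r \<in> sets borel"
    unfolding triangle_def open_triangle_def Collect_conj_eq by (simp_all add: sets.Int)
qed

lemma emeasure_triangle_closed:
  assumes "0 \<le> c" "0 \<le> r"
  shows "emeasure lborel (triangle c r) = ennreal (c * r\<^sup>2 / 2)"
proof (rule emeasure_triangle)
  fix u
  have "Pair u -` triangle c r = (if u \<in> {0..r} then {0..c * u} else {})"
    by (auto simp: triangle_def)
  then show "emeasure lborel (Pair u -` triangle c r) = ennreal (c * u) * indicator {0..r} u"
    using assms by (auto simp: indicator_def)
qed (use assms triangle_sets in auto)

lemma emeasure_triangle_open:
  assumes "0 \<le> c" "0 \<le> r"
  shows "emeasure lborel (open_triangle c r) = ennreal (c * r\<^sup>2 / 2)"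
proof (rule emeasure_triangle)
  fix u
  have "Pair u -` open_triangle c r = (if u \<in> {0..r} then {0<..<c * u} else {})"
    by (auto simp: open_triangle_def)
  then show "emeasure lborel (Pair u -` open_triangle c r) = ennreal (c * u) * indicator {0..r} u"
    using assms by (auto simp: indicator_def)
qed (use assms triangle_sets in auto)

section \<open>The area of a sector\<close>

definition dir :: "real \<Rightarrow> real \<times> real" where
  "dir a = (cos a, sin a)"

lemma norm_dir [simp]: "norm (dir a) = 1"
  by (simp add: dir_def norm_Pair)

lemma dir_nonzero [simp]: "dir a \<noteq> 0"
  using norm_dir[of a] by (metis norm_zero zero_neq_one)

lemma continuous_dir: "continuous_on S dir"
  unfolding dir_def by (intro continuous_intros)

lemma dir_eq_iff: "dir a = dir b \<longleftrightarrow> (\<exists>n::int. a = b + 2 * pi * n)"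
  unfolding dir_def prod.inject using sin_cos_eq_iff[of a b] by auto

lemma dir_periodic: "dir (a + 2 * pi * of_int n) = dir a"
  by (subst dir_eq_iff) auto

lemma polar_exists:
  obtains s a where "0 \<le> s" "0 \<le> a" "a < 2 * pi" "p = s *\<^sub>R dir a" "s = norm p"
proof (cases "p = 0")
  case True
  then show thesis by (intro that[of 0 0]) auto
next
  case False
  have "(fst p / norm p)\<^sup>2 + (snd p / norm p)\<^sup>2 = 1"
    using False by (simp add: norm_prod_def power_divide add_divide_distrib[symmetric] sum_power2_eq_zero_iff prod_eq_iff)
  then obtain t where t: "0 \<le> t" "t < 2 * pi" "fst p / norm p = cos t" "snd p / norm p = sin t"
    by (rule sincos_total_2pi)
  have "p = norm p *\<^sub>R dir t"
    unfolding dir_def t(3,4)[symmetric] using False by (simp add: prod_eq_iff)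
  then show thesis using t by (intro that[of "norm p" t]) auto
qed

lemma polar_unique:
  assumes "s *\<^sub>R dir a = s' *\<^sub>R dir b" "0 < s" "0 \<le> s'" "\<bar>a - b\<bar> < 2 * pi"
  shows "s = s'" "a = b"
proof -
  have "\<bar>s\<bar> * norm (dir a) = \<bar>s'\<bar> * norm (dir b)"
    by (simp only: norm_scaleR[symmetric] assms(1))
  then show s: "s = s'" using assms(2,3) by simp
  have "dir a = dir b" using assms(1,2) s by simp
  then obtain n :: int where n: "a = b + 2 * pi * n" by (auto simp: dir_eq_iff)
  then have "2 * pi * \<bar>real_of_int n\<bar> < 2 * pi * 1" using assms(4) by (simp add: abs_mult)
  then have "\<bar>real_of_int n\<bar> < 1" by (subst (asm) mult_less_cancel_left_pos) auto
  then show "a = b" using n by simp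
qed

lemma rot_dir: "rot a (s *\<^sub>R dir b) = s *\<^sub>R dir (a + b)"
  by (simp add: rot_def dir_def cos_add sin_add algebra_simps)

lemma arctan_polar:
  assumes "0 < u" "0 < v" "v < tan h * u" "0 < h" "h < pi / 2"
  obtains s a where "0 < s" "0 < a" "a < h" "(u, v) = s *\<^sub>R dir a" "s * cos a = u"
proof -
  define a where "a = arctan (v / u)"
  have a: "- (pi / 2) < a" "a < pi / 2" "tan a = v / u"
    unfolding a_def by (rule arctan_lbound, rule arctan_ubound, rule tan_arctan)
  have "0 < a" using assms by (simp add: a_def)
  have "v / u < tan h" using assms by (simp add: field_simps)
  then have "a < arctan (tan h)" by (simp add: a_def arctan_less_iff)
  then have "a < h" using assms by (simp add: arctan_tan)
  have ca: "0 < cos a" using a by (intro cos_gt_zero_pi)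
  define s where "s = u / cos a"
  have "s * cos a = u" using ca by (simp add: s_def)
  moreover have "s * sin a = v"
  proof -
    have "sin a = tan a * cos a" using ca by (simp add: tan_def)
    then show ?thesis using ca a assms by (simp add: s_def)
  qed
  ultimately show thesis
    using \<open>0 < a\<close> \<open>a < h\<close> ca assms by (intro that[of s a]) (auto simp: s_def dir_def)
qed

context conv_body
begin

text \<open>The radial function of the body: the distance from the origin to the boundary in
  direction \<open>dir a\<close>.\<close>

definition rho :: "real \<Rightarrow> real" where
  "rho a = 1 / G (dir a)"

lemma gauge_dir_pos: "0 < G (dir a)"
  by (rule gauge_pos) simp

lemma rho_pos: "0 < rho a"
  using gauge_dir_pos by (simp add: rho_def)

lemma continuous_rho: "continuous_on S rho"
  unfolding rho_def
  by (intro continuous_intros continuous_on_compose2[OF continuous_gauge[of UNIV] continuous_dir])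
     (use gauge_dir_pos in \<open>auto simp: less_imp_neq[symmetric]\<close>)

lemma rho_periodic: "rho (a + 2 * pi * of_int n) = rho a"
  by (simp add: rho_def dir_periodic)

lemma polar_in_body_iff: "0 \<le> s \<Longrightarrow> s *\<^sub>R dir a \<in> \<Omega> \<longleftrightarrow> s \<le> rho a"
  using gauge_dir_pos[of a] by (simp add: body_iff_gauge gauge_scale rho_def field_simps)

lemma sector_iff:
  "p \<in> sector \<Omega> \<phi> \<longleftrightarrow> (\<exists>s a. p = s *\<^sub>R dir a \<and> 0 \<le> s \<and> 0 \<le> a \<and> a \<le> \<phi> \<and> s \<le> rho a)"
proof -
  have "p \<in> sector \<Omega> \<phi> \<longleftrightarrow> (\<exists>s a. p = s *\<^sub>R dir a \<and> 0 \<le> s \<and> 0 \<le> a \<and> a \<le> \<phi> \<and> s *\<^sub>R dir a \<in> \<Omega>)"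
    by (simp add: sector_def dir_def)
  then show ?thesis by (metis polar_in_body_iff)
qed

lemma sector_subset: "sector \<Omega> \<phi> \<subseteq> \<Omega>"
  by (auto simp: sector_def)

lemma sector_mono: "\<phi> \<le> \<psi> \<Longrightarrow> sector \<Omega> \<phi> \<subseteq> sector \<Omega> \<psi>"
  by (force simp: sector_def)

text \<open>The image of a rectangle under polar coordinates is compact, and intersecting it with
  the body gives the sector. This yields measurability and finite area.\<close>

lemma compact_sector: "compact (sector \<Omega> \<phi>)"
proof -
  obtain R where R: "0 < R" "\<And>p. p \<in> \<Omega> \<Longrightarrow> norm p \<le> R" by (rule outer_ball) blast
  have "sector \<Omega> \<phi> = \<Omega> \<inter> (\<lambda>(s, a). s *\<^sub>R dir a) ` ({0..R} \<times> {0..\<phi>})"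
  proof (intro set_eqI iffI)
    fix p assume p: "p \<in> sector \<Omega> \<phi>"
    then obtain s a where sa: "p = s *\<^sub>R dir a" "0 \<le> s" "0 \<le> a" "a \<le> \<phi>" unfolding sector_iff by blast
    have "p \<in> \<Omega>" using p sector_subset by blast
    moreover have "s \<le> R" using R(2)[OF \<open>p \<in> \<Omega>\<close>] sa by simp
    ultimately show "p \<in> \<Omega> \<inter> (\<lambda>(s, a). s *\<^sub>R dir a) ` ({0..R} \<times> {0..\<phi>})"
      using sa by (intro IntI image_eqI[of _ _ "(s, a)"]) auto
  next
    fix p assume p: "p \<in> \<Omega> \<inter> (\<lambda>(s, a). s *\<^sub>R dir a) ` ({0..R} \<times> {0..\<phi>})"
    then obtain s a where "p = s *\<^sub>R dir a" "0 \<le> s" "0 \<le> a" "a \<le> \<phi>" by auto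
    moreover then have "s \<le> rho a" using p polar_in_body_iff by auto
    ultimately show "p \<in> sector \<Omega> \<phi>" unfolding sector_iff by blast
  qed
  moreover have "compact ((\<lambda>(s, a). s *\<^sub>R dir a) ` ({0..R} \<times> {0..\<phi>}))"
    unfolding case_prod_beta
    by (intro compact_continuous_image compact_Times compact_Icc continuous_intros
        continuous_on_compose2[OF continuous_dir[of UNIV]]) auto
  ultimately show ?thesis using compact_body by (simp add: compact_Int)
qed

lemma sector_sets [measurable]: "sector \<Omega> \<phi> \<in> sets borel"
  using compact_sector by (intro borel_closed compact_imp_closed)

lemma emeasure_sector_finite: "emeasure lborel (sector \<Omega> \<phi>) < \<infinity>"
  using compact_sector by (intro emeasure_bounded_finite compact_imp_bounded)

text \<open>Turned back so that it starts at the positive axis, the slice between the two angles has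
  abscissas at most \<open>M\<close> and slopes at most
  \<open>tan (\<psi> - \<phi>)\<close>.\<close>

lemma rot_vimage_diff_upper:
  assumes "0 \<le> \<phi>" "\<phi> < \<psi>" "\<psi> < \<phi> + pi / 2"
    and M: "\<And>a. \<phi> \<le> a \<Longrightarrow> a \<le> \<psi> \<Longrightarrow> rho a \<le> M"
  shows "rot \<phi> -` (sector \<Omega> \<psi> - sector \<Omega> \<phi>) \<subseteq> triangle (tan (\<psi> - \<phi>)) M"
proof
  fix p assume "p \<in> rot \<phi> -` (sector \<Omega> \<psi> - sector \<Omega> \<phi>)"
  then have q: "rot \<phi> p \<in> sector \<Omega> \<psi>" "rot \<phi> p \<notin> sector \<Omega> \<phi>" by auto
  then obtain s a where sa: "rot \<phi> p = s *\<^sub>R dir a" "0 \<le> s" "0 \<le> a" "a \<le> \<psi>" "s \<le> rho a"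
    unfolding sector_iff by blast
  have "\<phi> < a" using q(2) sa unfolding sector_iff by (meson not_le)
  have "p = rot (- \<phi>) (rot \<phi> p)" by (simp add: rot_add)
  then have p: "p = s *\<^sub>R dir (a - \<phi>)" unfolding sa(1) rot_dir by simp
  define b where "b = a - \<phi>"
  have b: "0 < b" "b \<le> \<psi> - \<phi>" "b < pi / 2" using \<open>\<phi> < a\<close> sa assms by (auto simp: b_def)
  have cb: "0 < cos b" "cos b \<le> 1" using b by (auto intro: cos_gt_zero)
  have sb: "0 < sin b" using b by (intro sin_gt_zero) auto
  have "tan b \<le> tan (\<psi> - \<phi>)"
  proof (cases "b = \<psi> - \<phi>")
    case False
    then show ?thesis using b assms by (intro less_imp_le tan_monotone) auto
  qed simp
  then have "tan b * cos b \<le> tan (\<psi> - \<phi>) * cos b" using cb by (intro mult_right_mono) auto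
  moreover have "tan b * cos b = sin b" using cb by (simp add: tan_def)
  ultimately have "sin b \<le> tan (\<psi> - \<phi>) * cos b" by simp
  then have "s * sin b \<le> s * (tan (\<psi> - \<phi>) * cos b)" using sa by (intro mult_left_mono) auto
  moreover have "s \<le> M" using sa M[of a] \<open>\<phi> < a\<close> by linarith
  moreover have "s * cos b \<le> s * 1" using sa cb by (intro mult_left_mono) auto
  ultimately show "p \<in> triangle (tan (\<psi> - \<phi>)) M"
    using sa cb sb unfolding p b_def[symmetric] triangle_def dir_def by (auto simp: algebra_simps)
qed

text \<open>With the width \<open>m * cos (\<psi> - \<phi>)\<close> the longest edge of the triangle
  has length \<open>m\<close>, so none of its points lies beyond the boundary. The bound
  \<open>\<psi> \<le> 2 * pi\<close> keeps the slice from wrapping around onto the smaller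
  sector.\<close>

lemma rot_vimage_diff_lower:
  assumes "0 \<le> \<phi>" "\<phi> < \<psi>" "\<psi> \<le> 2 * pi" "\<psi> < \<phi> + pi / 2"
    and m: "\<And>a. \<phi> \<le> a \<Longrightarrow> a \<le> \<psi> \<Longrightarrow> m \<le> rho a"
  shows "open_triangle (tan (\<psi> - \<phi>)) (m * cos (\<psi> - \<phi>)) \<subseteq> rot \<phi> -` (sector \<Omega> \<psi> - sector \<Omega> \<phi>)"
proof
  fix p assume p: "p \<in> open_triangle (tan (\<psi> - \<phi>)) (m * cos (\<psi> - \<phi>))"
  define h where "h = \<psi> - \<phi>"
  have h: "0 < h" "h < pi / 2" using assms by (auto simp: h_def)
  obtain u v where uv: "p = (u, v)" by fastforce
  have "0 < tan h * u" "0 \<le> u" using p by (auto simp: open_triangle_def uv h_def)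
  then have "0 < u" by (cases "u = 0") auto
  have u_le: "u \<le> m * cos h" using p by (simp add: open_triangle_def uv h_def)
  then obtain s a where sa: "0 < s" "0 < a" "a < h" "(u, v) = s *\<^sub>R dir a" "s * cos a = u"
  proof -
    have "0 < v" "v < tan h * u" using p by (auto simp: open_triangle_def uv h_def)
    from arctan_polar[OF \<open>0 < u\<close> this h] show thesis using that by blast
  qed
  have q: "rot \<phi> p = s *\<^sub>R dir (\<phi> + a)" unfolding uv sa(4) rot_dir ..
  have "0 < cos h" using h by (intro cos_gt_zero)
  have "cos h \<le> cos a" using sa h by (intro cos_monotone_0_pi_le) auto
  then have "s * cos h \<le> s * cos a" using sa by (intro mult_left_mono) auto
  also have "\<dots> \<le> m * cos h" using u_le sa(5) by simp
  finally have "s \<le> m" using \<open>0 < cos h\<close> by simp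
  then have "s \<le> rho (\<phi> + a)" using m[of "\<phi> + a"] sa by (simp add: h_def)
  then have "rot \<phi> p \<in> sector \<Omega> \<psi>"
    unfolding sector_iff q using sa assms by (intro exI[of _ s] exI[of _ "\<phi> + a"]) (auto simp: h_def)
  moreover have "rot \<phi> p \<notin> sector \<Omega> \<phi>"
  proof
    assume "rot \<phi> p \<in> sector \<Omega> \<phi>"
    then obtain s' b where b: "rot \<phi> p = s' *\<^sub>R dir b" "0 \<le> s'" "0 \<le> b" "b \<le> \<phi>"
      unfolding sector_iff by blast
    have "\<phi> + a = b"
      using b q sa assms by (intro polar_unique(2)[of s "\<phi> + a" s' b]) (auto simp: h_def)
    then show False using b sa by simp
  qed
  ultimately show "p \<in> rot \<phi> -` (sector \<Omega> \<psi> - sector \<Omega> \<phi>)" by simp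
qed

text \<open>The two triangles, compared after a rotation, squeeze the increment of the area. For a
  small increment of the angle both bounds behave like half a squared radius times that
  increment.\<close>

lemma area_sector_diff_bounds:
  assumes "0 \<le> \<phi>" "\<phi> < \<psi>" "\<psi> \<le> 2 * pi" "\<psi> < \<phi> + pi / 2" "0 \<le> m"
    and m: "\<And>a. \<phi> \<le> a \<Longrightarrow> a \<le> \<psi> \<Longrightarrow> m \<le> rho a"
    and M: "\<And>a. \<phi> \<le> a \<Longrightarrow> a \<le> \<psi> \<Longrightarrow> rho a \<le> M"
  shows "m\<^sup>2 / 2 * (sin (\<psi> - \<phi>) * cos (\<psi> - \<phi>)) \<le> area (sector \<Omega> \<psi>) - area (sector \<Omega> \<phi>)"
    and "area (sector \<Omega> \<psi>) - area (sector \<Omega> \<phi>) \<le> M\<^sup>2 / 2 * tan (\<psi> - \<phi>)"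
proof -
  define h where "h = \<psi> - \<phi>"
  have h: "0 < h" "h < pi / 2" using assms by (auto simp: h_def)
  have ch: "0 < cos h" using h by (intro cos_gt_zero)
  have th: "0 < tan h" using h by (intro tan_gt_zero)
  have M0: "0 \<le> M" using M[of \<phi>] rho_pos[of \<phi>] assms by linarith
  let ?D = "sector \<Omega> \<psi> - sector \<Omega> \<phi>"
  have D: "?D \<in> sets borel" by simp
  have fin: "emeasure lborel (sector \<Omega> x) \<noteq> \<infinity>" for x using emeasure_sector_finite[of x] by simp
  have em: "emeasure lborel ?D = ennreal (area (sector \<Omega> \<psi>) - area (sector \<Omega> \<phi>))"
  proof -
    have "emeasure lborel ?D = ennreal (measure lborel ?D)"
      using emeasure_mono[of ?D "sector \<Omega> \<psi>" lborel] emeasure_sector_finite[of \<psi>]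
      by (intro emeasure_eq_ennreal_measure) (auto simp: top_unique)
    also have "measure lborel ?D = area (sector \<Omega> \<psi>) - area (sector \<Omega> \<phi>)"
      unfolding area_def using assms fin[of \<psi>] by (intro measure_Diff sector_mono) auto
    finally show ?thesis .
  qed
  have le: "0 \<le> area (sector \<Omega> \<psi>) - area (sector \<Omega> \<phi>)"
    unfolding area_def using sector_mono[of \<phi> \<psi>] assms fin[of \<psi>]
    by (simp, intro measure_mono_fmeasurable) (auto simp: fmeasurable_def less_top)
  have vi: "emeasure lborel (rot \<phi> -` ?D) = emeasure lborel ?D"
    using D assms by (intro emeasure_rot) auto
  have viD: "rot \<phi> -` ?D \<in> sets borel" using measurable_sets[OF rot_measurable D] by simp
  have "ennreal (tan h * (m * cos h)\<^sup>2 / 2) = emeasure lborel (open_triangle (tan h) (m * cos h))"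
    using th ch assms(5) by (intro emeasure_triangle_open[symmetric]) auto
  also have "\<dots> \<le> emeasure lborel (rot \<phi> -` ?D)"
    using rot_vimage_diff_lower[OF assms(1-4) m] viD unfolding h_def by (intro emeasure_mono) auto
  finally have "ennreal (tan h * (m * cos h)\<^sup>2 / 2) \<le> emeasure lborel ?D" unfolding vi .
  then have "tan h * (m * cos h)\<^sup>2 / 2 \<le> area (sector \<Omega> \<psi>) - area (sector \<Omega> \<phi>)"
    unfolding em using le by (simp add: ennreal_le_iff)
  moreover have "tan h * (m * cos h)\<^sup>2 / 2 = m\<^sup>2 / 2 * (sin h * cos h)"
    using ch by (simp add: tan_def power2_eq_square)
  ultimately show "m\<^sup>2 / 2 * (sin (\<psi> - \<phi>) * cos (\<psi> - \<phi>)) \<le> area (sector \<Omega> \<psi>) - area (sector \<Omega> \<phi>)"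
    by (simp add: h_def)
  have "emeasure lborel (rot \<phi> -` ?D) \<le> emeasure lborel (triangle (tan h) M)"
    using rot_vimage_diff_upper[OF assms(1,2,4) M] unfolding h_def
    by (intro emeasure_mono) (auto simp: triangle_sets)
  also have "\<dots> = ennreal (tan h * M\<^sup>2 / 2)"
    using th M0 by (intro emeasure_triangle_closed) auto
  finally have "emeasure lborel ?D \<le> ennreal (tan h * M\<^sup>2 / 2)" unfolding vi .
  then have "area (sector \<Omega> \<psi>) - area (sector \<Omega> \<phi>) \<le> tan h * M\<^sup>2 / 2"
    unfolding em using th by (subst (asm) ennreal_le_iff) auto
  then show "area (sector \<Omega> \<psi>) - area (sector \<Omega> \<phi>) \<le> M\<^sup>2 / 2 * tan (\<psi> - \<phi>)"
    by (simp add: h_def algebra_simps)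
qed

end

lemma sin_cos_quotient_tendsto: "((\<lambda>h::real. sin h * cos h / h) \<longlongrightarrow> 1) (at 0)"
proof -
  have "((\<lambda>h::real. sin h * cos h) has_real_derivative 1) (at 0)"
    by (auto intro!: derivative_eq_intros)
  then show ?thesis by (simp add: DERIV_def)
qed

lemma tan_quotient_tendsto: "((\<lambda>h::real. tan h / h) \<longlongrightarrow> 1) (at 0)"
proof -
  have "(tan has_real_derivative inverse ((cos 0)\<^sup>2)) (at (0::real))" by (rule DERIV_tan) simp
  then show ?thesis by (simp add: DERIV_def)
qed

context conv_body
begin

text \<open>By continuity of \<open>rho\<close>, the bounds \<open>m\<close> and \<open>M\<close> of
  the squeeze may be taken as close to \<open>rho \<phi>\<close> as desired near \<phi>. Beyond one
  turn the sector no longer grows, hence the restriction to \<open>{0..2 * pi}\<close>.\<close>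

lemma area_sector_has_derivative:
  assumes \<phi>: "\<phi> \<in> {0..2 * pi}"
  shows "((\<lambda>x. area (sector \<Omega> x)) has_real_derivative (rho \<phi>)\<^sup>2 / 2) (at \<phi> within {0..2 * pi})"
proof -
  define F where "F = at \<phi> within {0..2 * pi}"
  define S where "S = (\<lambda>x. area (sector \<Omega> x))"
  define q where "q = (\<lambda>y. (S y - S \<phi>) / (y - \<phi>))"
  have abs_lim: "filterlim (\<lambda>y. \<bar>y - \<phi>\<bar>) (at 0) F"
  proof -
    have "((\<lambda>y. \<bar>y - \<phi>\<bar>) \<longlongrightarrow> \<bar>\<phi> - \<phi>\<bar>) F" unfolding F_def by (intro tendsto_intros)
    moreover have "\<forall>\<^sub>F y in F. y \<noteq> \<phi>" unfolding F_def by (auto simp: eventually_at_filter)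
    then have "\<forall>\<^sub>F y in F. \<bar>y - \<phi>\<bar> \<noteq> 0" by eventually_elim auto
    ultimately show ?thesis by (simp add: filterlim_at)
  qed
  have key: "\<forall>\<^sub>F y in F. m\<^sup>2 / 2 * (sin \<bar>y - \<phi>\<bar> * cos \<bar>y - \<phi>\<bar> / \<bar>y - \<phi>\<bar>) \<le> q y
      \<and> q y \<le> M\<^sup>2 / 2 * (tan \<bar>y - \<phi>\<bar> / \<bar>y - \<phi>\<bar>)"
    if mM: "0 \<le> m" "m < rho \<phi>" "rho \<phi> < M" for m M
  proof -
    define e where "e = min (rho \<phi> - m) (M - rho \<phi>)"
    have "e > 0" using mM by (simp add: e_def)
    then obtain d where d: "d > 0" "\<And>a. dist a \<phi> < d \<Longrightarrow> dist (rho a) (rho \<phi>) < e"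
      using continuous_rho[of UNIV] unfolding continuous_on_iff by (meson UNIV_I)
    have d: "d > 0" "\<And>a. \<bar>a - \<phi>\<bar> < d \<Longrightarrow> m < rho a \<and> rho a < M"
      using d by (fastforce simp: dist_real_def e_def)+
    have "\<forall>\<^sub>F y in F. y \<in> {0..2 * pi} \<and> y \<noteq> \<phi> \<and> dist y \<phi> < min d (pi / 2)"
      unfolding F_def eventually_at using d(1) by (intro exI[of _ "min d (pi / 2)"]) auto
    then show ?thesis
    proof eventually_elim
      case (elim y)
      then have y: "0 \<le> y" "y \<le> 2 * pi" "y \<noteq> \<phi>" "\<bar>y - \<phi>\<bar> < d" "\<bar>y - \<phi>\<bar> < pi / 2"
        by (auto simp: dist_real_def)
      have bounds: "m\<^sup>2 / 2 * (sin (b - a) * cos (b - a) / (b - a)) \<le> (S b - S a) / (b - a)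
          \<and> (S b - S a) / (b - a) \<le> M\<^sup>2 / 2 * (tan (b - a) / (b - a))"
        if ab: "a < b" "0 \<le> a" "b \<le> 2 * pi" "\<bar>a - \<phi>\<bar> < d" "\<bar>b - \<phi>\<bar> < d" "b - a < pi / 2" for a b
      proof -
        have r: "m \<le> rho c" "rho c \<le> M" if "a \<le> c" "c \<le> b" for c
        proof -
          have "\<bar>c - \<phi>\<bar> < d" using ab that by linarith
          then show "m \<le> rho c" "rho c \<le> M" using d(2)[of c] by auto
        qed
        have "m\<^sup>2 / 2 * (sin (b - a) * cos (b - a)) \<le> S b - S a" "S b - S a \<le> M\<^sup>2 / 2 * tan (b - a)"
          using area_sector_diff_bounds[of a b m M] ab mM r unfolding S_def by auto
        then show ?thesis
          unfolding times_divide_eq_right using ab(1) by (intro conjI divide_right_mono) auto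
      qed
      show ?case
      proof (cases "\<phi> < y")
        case True
        then show ?thesis using bounds[of \<phi> y] y \<phi> d(1) by (simp add: q_def)
      next
        case False
        then have "y < \<phi>" using y by simp
        moreover have "q y = (S \<phi> - S y) / (\<phi> - y)"
          unfolding q_def by (metis minus_diff_eq minus_divide_divide)
        ultimately show ?thesis using bounds[of y \<phi>] y \<phi> d(1) by simp
      qed
    qed
  qed
  have "(q \<longlongrightarrow> (rho \<phi>)\<^sup>2 / 2) F"
  proof (rule order_tendstoI)
    fix a assume a: "a < (rho \<phi>)\<^sup>2 / 2"
    \<comment> \<open>The radius at which half the square reaches \<open>a\<close>, or 0 if
      \<open>a\<close> is negative. Any \<open>m\<close> strictly between \<open>b\<close> and
      \<open>rho \<phi>\<close> then makes the lower bound exceed \<open>a\<close> in the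
      limit.\<close>
    define b where "b = sqrt (max 0 (2 * a))"
    have "b < sqrt ((rho \<phi>)\<^sup>2)" unfolding b_def using a rho_pos[of \<phi>] by (intro real_sqrt_less_mono) auto
    then have b: "0 \<le> b" "b < rho \<phi>" using rho_pos[of \<phi>] by (auto simp: b_def)
    define m where "m = (b + rho \<phi>) / 2"
    have m: "b < m" "0 \<le> m" "m < rho \<phi>" using b by (auto simp: m_def)
    have "b\<^sup>2 < m\<^sup>2" using m b by (intro power_strict_mono) auto
    moreover have "2 * a \<le> b\<^sup>2" by (simp add: b_def)
    ultimately have am: "a < m\<^sup>2 / 2 * 1" by simp
    have "((\<lambda>y. m\<^sup>2 / 2 * (sin \<bar>y - \<phi>\<bar> * cos \<bar>y - \<phi>\<bar> / \<bar>y - \<phi>\<bar>)) \<longlongrightarrow> m\<^sup>2 / 2 * 1) F"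
      by (intro tendsto_intros filterlim_compose[OF sin_cos_quotient_tendsto abs_lim])
    then have "\<forall>\<^sub>F y in F. a < m\<^sup>2 / 2 * (sin \<bar>y - \<phi>\<bar> * cos \<bar>y - \<phi>\<bar> / \<bar>y - \<phi>\<bar>)"
      using am by (rule order_tendstoD(1))
    moreover have "\<forall>\<^sub>F y in F. m\<^sup>2 / 2 * (sin \<bar>y - \<phi>\<bar> * cos \<bar>y - \<phi>\<bar> / \<bar>y - \<phi>\<bar>) \<le> q y"
      using key[OF m(2,3), of "rho \<phi> + 1"] by (simp add: eventually_conj_iff)
    ultimately
    show "\<forall>\<^sub>F y in F. a < q y" by eventually_elim linarith
  next
    fix a assume a: "(rho \<phi>)\<^sup>2 / 2 < a"
    define b where "b = sqrt (2 * a)"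
    have "sqrt ((rho \<phi>)\<^sup>2) < b" unfolding b_def using a by (intro real_sqrt_less_mono) auto
    then have b: "rho \<phi> < b" using rho_pos[of \<phi>] by auto
    define M where "M = (b + rho \<phi>) / 2"
    have M: "M < b" "rho \<phi> < M" using b by (auto simp: M_def)
    have "0 \<le> 2 * a" using a by (smt (verit) zero_le_power2 field_sum_of_halves)
    then have "b\<^sup>2 = 2 * a" by (simp add: b_def)
    moreover have "M\<^sup>2 < b\<^sup>2" using M rho_pos[of \<phi>] by (intro power_strict_mono) auto
    ultimately have am: "M\<^sup>2 / 2 * 1 < a" by simp
    have "((\<lambda>y. M\<^sup>2 / 2 * (tan \<bar>y - \<phi>\<bar> / \<bar>y - \<phi>\<bar>)) \<longlongrightarrow> M\<^sup>2 / 2 * 1) F"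
      by (intro tendsto_intros filterlim_compose[OF tan_quotient_tendsto abs_lim])
    then have "\<forall>\<^sub>F y in F. M\<^sup>2 / 2 * (tan \<bar>y - \<phi>\<bar> / \<bar>y - \<phi>\<bar>) < a"
      using am by (rule order_tendstoD(2))
    moreover have "\<forall>\<^sub>F y in F. q y \<le> M\<^sup>2 / 2 * (tan \<bar>y - \<phi>\<bar> / \<bar>y - \<phi>\<bar>)"
      using key[of 0 M] M(2) rho_pos[of \<phi>] by (simp add: eventually_conj_iff)
    ultimately
    show "\<forall>\<^sub>F y in F. q y < a" by eventually_elim linarith
  qed
  then show ?thesis unfolding has_field_derivative_iff F_def q_def S_def .
qed

lemma area_sector_0: "area (sector \<Omega> 0) = 0"
proof -
  have "emeasure lborel (Pair u -` sector \<Omega> 0) = 0" for u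
  proof -
    have "Pair u -` sector \<Omega> 0 \<subseteq> {0}" by (auto simp: sector_def)
    then have "emeasure lborel (Pair u -` sector \<Omega> 0) \<le> emeasure lborel {0::real}"
      by (intro emeasure_mono) auto
    then show ?thesis by simp
  qed
  then show ?thesis using emeasure_lborel_slices(1)[OF sector_sets[of 0]] by (simp add: area_def measure_def)
qed

lemma sector_full: "sector \<Omega> (2 * pi) = \<Omega>"
proof (intro antisym sector_subset subsetI)
  fix p assume "p \<in> \<Omega>"
  obtain s a where "0 \<le> s" "0 \<le> a" "a < 2 * pi" "p = s *\<^sub>R dir a" by (rule polar_exists)
  then show "p \<in> sector \<Omega> (2 * pi)"
    using \<open>p \<in> \<Omega>\<close> unfolding sector_iff by (metis less_imp_le polar_in_body_iff)
qed

text \<open>Twice the swept area as a function of the polar angle, extended to the whole line.\<close>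

definition Theta :: "real \<Rightarrow> real" where
  "Theta = (SOME F. F 0 = 0 \<and> (\<forall>x. (F has_real_derivative (rho x)\<^sup>2) (at x)))"

lemma Theta_props: "Theta 0 = 0 \<and> (\<forall>x. (Theta has_real_derivative (rho x)\<^sup>2) (at x))"
proof -
  have "isCont (\<lambda>x. (rho x)\<^sup>2) x" for x
    using continuous_rho[of UNIV] by (intro continuous_intros) (simp add: continuous_on_eq_continuous_at)
  then obtain F where F: "\<And>x. (F has_vector_derivative (rho x)\<^sup>2) (at x)"
    using einterval_antiderivative[of "-\<infinity>" "\<infinity>" "\<lambda>x. (rho x)\<^sup>2"] by auto
  show ?thesis
    unfolding Theta_def
  proof (rule someI[of _ "\<lambda>x. F x - F 0"], intro conjI allI)
    fix x
    have "(F has_real_derivative (rho x)\<^sup>2) (at x)"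
      using F by (simp add: has_real_derivative_iff_has_vector_derivative)
    from DERIV_diff[OF this DERIV_const[of "F 0"]]
    show "((\<lambda>x. F x - F 0) has_real_derivative (rho x)\<^sup>2) (at x)" by simp
  qed simp
qed

lemma Theta_0 [simp]: "Theta 0 = 0" and Theta_deriv: "(Theta has_real_derivative (rho x)\<^sup>2) (at x)"
  using Theta_props by auto

text \<open>Ties the analytic function to the geometric definition: on one turn both sides have the
  squared radius as derivative, and both vanish at 0.\<close>

lemma Theta_sector:
  assumes "\<phi> \<in> {0..2 * pi}"
  shows "Theta \<phi> = 2 * area (sector \<Omega> \<phi>)"
proof -
  have "\<exists>c. \<forall>x\<in>{0..2 * pi}. 2 * area (sector \<Omega> x) - Theta x = c"
  proof (rule has_field_derivative_zero_constant)
    fix x :: real assume "x \<in> {0..2 * pi}"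
    from DERIV_diff[OF DERIV_cmult[OF area_sector_has_derivative[OF this], of 2]
        has_field_derivative_at_within[OF Theta_deriv[of x]]]
    show "((\<lambda>x. 2 * area (sector \<Omega> x) - Theta x) has_real_derivative 0) (at x within {0..2 * pi})"
      by simp
  qed simp
  then obtain c where c: "\<And>x. x \<in> {0..2 * pi} \<Longrightarrow> 2 * area (sector \<Omega> x) - Theta x = c" by blast
  from c[of 0] c[OF assms] show ?thesis by (simp add: area_sector_0)
qed

lemma Theta_strict_mono: "x < y \<Longrightarrow> Theta x < Theta y"
proof (rule DERIV_pos_imp_increasing[of x y Theta])
  fix z show "\<exists>D. (Theta has_real_derivative D) (at z) \<and> 0 < D"
    using Theta_deriv[of z] rho_pos[of z] by (intro exI[of _ "(rho z)\<^sup>2"]) simp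
qed

lemma Theta_less_iff: "Theta x < Theta y \<longleftrightarrow> x < y"
  using Theta_strict_mono[of x y] Theta_strict_mono[of y x] by (cases x y rule: linorder_cases) auto

lemma Theta_eq_iff [simp]: "Theta x = Theta y \<longleftrightarrow> x = y"
  using Theta_less_iff[of x y] Theta_less_iff[of y x] by (cases x y rule: linorder_cases) auto

lemma Theta_le_iff: "Theta x \<le> Theta y \<longleftrightarrow> x \<le> y"
  by (simp only: not_less[symmetric] Theta_less_iff)

lemma Theta_full: "Theta (2 * pi) = 2 * area \<Omega>"
  using Theta_sector[of "2 * pi"] by (simp add: sector_full)

lemma area_pos: "0 < area \<Omega>"
  using Theta_strict_mono[of 0 "2 * pi"] by (simp add: Theta_full)

text \<open>Periodicity of \<open>rho\<close> makes the increment over one turn independent of the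
  starting angle, and from 0 it is twice the area. Induction gives positive multiples; negative ones
  follow by shifting back.\<close>

lemma Theta_shift: "Theta (x + 2 * pi * of_int n) = Theta x + 2 * area \<Omega> * of_int n"
proof -
  have 1: "Theta (x + 2 * pi) = Theta x + 2 * area \<Omega>" for x
  proof -
    have "((\<lambda>x. Theta (x + 2 * pi) - Theta x) has_real_derivative 0) (at x)" for x
    proof -
      have "((\<lambda>x. Theta (x + 2 * pi)) has_real_derivative (rho (x + 2 * pi))\<^sup>2) (at x)"
        using Theta_deriv[of "x + 2 * pi"] by (simp add: DERIV_shift)
      from DERIV_diff[OF this Theta_deriv[of x]] show ?thesis using rho_periodic[of x 1] by simp
    qed
    from DERIV_isconst_all[of "\<lambda>x. Theta (x + 2 * pi) - Theta x" x 0] this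
    show ?thesis by (simp add: Theta_full)
  qed
  have nat: "Theta (x + 2 * pi * real k) = Theta x + 2 * area \<Omega> * real k" for x and k :: nat
  proof (induction k)
    case (Suc k)
    have "Theta (x + 2 * pi * real (Suc k)) = Theta ((x + 2 * pi * real k) + 2 * pi)"
      by (simp add: algebra_simps)
    also have "\<dots> = Theta (x + 2 * pi * real k) + 2 * area \<Omega>" by (rule 1)
    finally show ?case using Suc by (simp add: algebra_simps)
  qed simp
  show ?thesis
  proof (cases n)
    case (nonneg k)
    then show ?thesis using nat[of x k] by simp
  next
    case (neg k)
    then have n: "real_of_int n = - real (Suc k)" by simp
    have shift: "Theta (x + 2 * pi * of_int n + 2 * pi * real (Suc k))
        = Theta (x + 2 * pi * of_int n) + 2 * area \<Omega> * real (Suc k)" by (rule nat)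
    have wrap: "x + 2 * pi * of_int n + 2 * pi * real (Suc k) = x"
      unfolding n by (simp only: mult_minus_right)
    have "2 * area \<Omega> * of_int n = - (2 * area \<Omega> * real (Suc k))"
      by (simp only: n mult_minus_right)
    then show ?thesis using shift unfolding wrap by linarith
  qed
qed

lemma Theta_surj: "\<exists>x. Theta x = y"
proof -
  define n where "n = \<lceil>\<bar>y\<bar> / (2 * area \<Omega>)\<rceil>"
  have "\<bar>y\<bar> / (2 * area \<Omega>) \<le> of_int n" by (simp add: n_def)
  then have n: "\<bar>y\<bar> \<le> 2 * area \<Omega> * of_int n" using area_pos by (simp add: field_simps)
  have T: "Theta (2 * pi * of_int k) = 2 * area \<Omega> * of_int k" for k
    using Theta_shift[of 0 k] by simp
  have n0: "0 \<le> n" unfolding n_def using area_pos by (simp add: le_ceiling_iff) (smt (verit) divide_nonneg_pos)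
  have "\<exists>x\<ge>2 * pi * of_int (- n). x \<le> 2 * pi * of_int n \<and> Theta x = y"
  proof (rule IVT')
    show "Theta (2 * pi * of_int (- n)) \<le> y" "y \<le> Theta (2 * pi * of_int n)"
      using T[of n] T[of "-n"] n by simp_all
    show "2 * pi * of_int (- n) \<le> 2 * pi * of_int n"
      using n0 by (intro mult_left_mono) auto
    show "continuous_on {2 * pi * of_int (- n)..2 * pi * of_int n} Theta"
      using Theta_deriv by (meson DERIV_atLeastAtMost_imp_continuous_on)
  qed
  then show ?thesis by blast
qed

text \<open>The inverse of \<open>Theta\<close>: the polar angle, counted over any number of turns,
  at which twice the swept area has the given value.\<close>

definition Phi :: "real \<Rightarrow> real" where
  "Phi \<theta> = (THE x. Theta x = \<theta>)"

lemma Theta_Phi [simp]: "Theta (Phi \<theta>) = \<theta>"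
proof -
  obtain x where "Theta x = \<theta>" using Theta_surj by blast
  moreover then have "Phi \<theta> = x" unfolding Phi_def by (intro the_equality) auto
  ultimately show ?thesis by simp
qed

lemma Phi_Theta [simp]: "Phi (Theta x) = x"
  using Theta_Phi[of "Theta x"] by (simp only: Theta_eq_iff)

lemma Phi_deriv: "(Phi has_real_derivative 1 / (rho (Phi \<theta>))\<^sup>2) (at \<theta>)"
proof -
  have "isCont Phi (Theta (Phi \<theta>))"
    by (rule isCont_inverse_function[of 1]) (simp_all add: DERIV_isCont[OF Theta_deriv])
  then have "(Phi has_real_derivative inverse ((rho (Phi \<theta>))\<^sup>2)) (at \<theta>)"
    using rho_pos[of "Phi \<theta>"]
    by (intro DERIV_inverse_function[where f = Theta and a = "\<theta> - 1" and b = "\<theta> + 1"] Theta_deriv) simp_all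
  then show ?thesis by (simp add: divide_inverse)
qed

definition pt :: "real \<Rightarrow> real \<times> real" where
  "pt a = rho a *\<^sub>R dir a"

lemma gauge_pt [simp]: "G (pt a) = 1"
  using gauge_dir_pos[of a] rho_pos[of a] by (simp add: pt_def gauge_scale rho_def)

lemma pt_unique: "0 < r \<Longrightarrow> G (r *\<^sub>R dir a) = 1 \<Longrightarrow> r *\<^sub>R dir a = pt a"
  using gauge_dir_pos[of a] by (simp add: pt_def gauge_scale rho_def field_simps)

text \<open>The description by \<open>THE\<close> is unique because strict monotonicity of
  \<open>Theta\<close> fixes the angle, and gauge 1 fixes the radius.\<close>

lemma conv_point_Theta:
  assumes "0 \<le> \<phi>" "\<phi> < 2 * pi"
  shows "conv_point \<Omega> (Theta \<phi>) = pt \<phi>"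
  unfolding conv_point_def
proof (rule the_equality)
  have "\<exists>\<phi>' r. 0 \<le> \<phi>' \<and> \<phi>' < 2 * pi \<and> 0 < r \<and>
      pt \<phi> = (r * cos \<phi>', r * sin \<phi>') \<and> area (sector \<Omega> \<phi>') = Theta \<phi> / 2"
  proof (rule exI[of _ \<phi>], rule exI[of _ "rho \<phi>"])
    show "0 \<le> \<phi> \<and> \<phi> < 2 * pi \<and> 0 < rho \<phi> \<and> pt \<phi> = (rho \<phi> * cos \<phi>, rho \<phi> * sin \<phi>) \<and>
        area (sector \<Omega> \<phi>) = Theta \<phi> / 2"
      using assms rho_pos[of \<phi>] Theta_sector[of \<phi>] by (simp add: pt_def dir_def)
  qed
  then show "pt \<phi> \<in> frontier \<Omega> \<and> (\<exists>\<phi>' r. 0 \<le> \<phi>' \<and> \<phi>' < 2 * pi \<and> 0 < r \<and>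
      pt \<phi> = (r * cos \<phi>', r * sin \<phi>') \<and> area (sector \<Omega> \<phi>') = Theta \<phi> / 2)"
    by (simp add: frontier_iff_gauge)
next
  fix P assume P: "P \<in> frontier \<Omega> \<and> (\<exists>\<phi>' r. 0 \<le> \<phi>' \<and> \<phi>' < 2 * pi \<and> 0 < r \<and>
      P = (r * cos \<phi>', r * sin \<phi>') \<and> area (sector \<Omega> \<phi>') = Theta \<phi> / 2)"
  then obtain \<phi>' r where r: "0 \<le> \<phi>'" "\<phi>' < 2 * pi" "0 < r" "P = r *\<^sub>R dir \<phi>'"
    "area (sector \<Omega> \<phi>') = Theta \<phi> / 2" by (auto simp: dir_def)
  then have "Theta \<phi>' = Theta \<phi>" using Theta_sector[of \<phi>'] by simp
  then have "\<phi>' = \<phi>" by simp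
  then show "P = pt \<phi>" using P r pt_unique by (simp add: frontier_iff_gauge)
qed

lemma pt_periodic: "pt (a + 2 * pi * of_int n) = pt a"
  by (simp add: pt_def dir_periodic rho_periodic)

text \<open>Replaces the periodic reduction in the definitions by one formula valid on the whole
  line. The number \<open>k\<close> of complete turns is absorbed by \<open>Theta_shift\<close> on
  one side and by periodicity of \<open>pt\<close> on the other.\<close>

lemma cos_sin_cv: "(cos_cv \<Omega> \<theta>, sin_cv \<Omega> \<theta>) = pt (Phi \<theta>)"
proof -
  define k where "k = \<lfloor>\<theta> / (2 * area \<Omega>)\<rfloor>"
  define \<theta>' where "\<theta>' = \<theta> - 2 * area \<Omega> * of_int k"
  have "of_int k \<le> \<theta> / (2 * area \<Omega>)" "\<theta> / (2 * area \<Omega>) < of_int k + 1" by (auto simp: k_def)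
  then have \<theta>': "Theta 0 \<le> Theta (Phi \<theta>')" "Theta (Phi \<theta>') < Theta (2 * pi)"
    unfolding Theta_full Theta_0 Theta_Phi using area_pos by (simp_all add: \<theta>'_def field_simps)
  have "(cos_cv \<Omega> \<theta>, sin_cv \<Omega> \<theta>) = conv_point \<Omega> (Theta (Phi \<theta>'))"
    by (simp add: cos_cv_def sin_cv_def k_def[symmetric] \<theta>'_def)
  also have "\<dots> = pt (Phi \<theta>')"
    using \<theta>' unfolding Theta_le_iff Theta_less_iff by (intro conv_point_Theta) auto
  also have "\<dots> = pt (Phi \<theta>' + 2 * pi * of_int k)" by (simp add: pt_periodic)
  also have "Phi \<theta>' + 2 * pi * of_int k = Phi (Theta (Phi \<theta>' + 2 * pi * of_int k))" by simp
  also have "Theta (Phi \<theta>' + 2 * pi * of_int k) = \<theta>" unfolding Theta_shift by (simp add: \<theta>'_def)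
  finally show ?thesis .
qed

end

section \<open>Calculus of Lipschitz functions\<close>

text \<open>Hiding the constant lets the closure properties be chained without tracking
  constants.\<close>

definition Lip :: "real \<Rightarrow> real \<Rightarrow> (real \<Rightarrow> real) \<Rightarrow> bool" where
  "Lip a b f \<longleftrightarrow> (\<exists>C. C-lipschitz_on {a..b} f)"

lemma Lip_I: "C-lipschitz_on {a..b} f \<Longrightarrow> Lip a b f"
  by (auto simp: Lip_def)

lemma Lip_cong: "Lip a b f \<Longrightarrow> (\<And>t. t \<in> {a..b} \<Longrightarrow> g t = f t) \<Longrightarrow> Lip a b g"
  unfolding Lip_def using lipschitz_on_transform by metis

lemma Lip_continuous: "Lip a b f \<Longrightarrow> continuous_on {a..b} f"
  by (auto simp: Lip_def intro: lipschitz_on_continuous_on)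

lemma Lip_bounded:
  assumes "Lip a b f" obtains B where "0 < B" "\<And>t. t \<in> {a..b} \<Longrightarrow> \<bar>f t\<bar> \<le> B"
proof -
  have "bounded (f ` {a..b})"
    using assms by (intro compact_imp_bounded compact_continuous_image Lip_continuous) auto
  then show thesis using that by (auto simp: bounded_pos)
qed

lemma Lip_const: "Lip a b (\<lambda>t. c)"
  by (rule Lip_I[of 0]) (auto intro: lipschitz_on_constant)

lemma Lip_ident: "Lip a b (\<lambda>t. t)"
  by (rule Lip_I[of 1]) (auto intro: lipschitz_onI)

lemma Lip_add: "Lip a b f \<Longrightarrow> Lip a b g \<Longrightarrow> Lip a b (\<lambda>t. f t + g t)"
  unfolding Lip_def by (blast intro: lipschitz_on_add)

lemma Lip_diff: "Lip a b f \<Longrightarrow> Lip a b g \<Longrightarrow> Lip a b (\<lambda>t. f t - g t)"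
  unfolding Lip_def by (blast intro: lipschitz_on_diff)

lemma Lip_compose:
  assumes "C-lipschitz_on UNIV F" "Lip a b f"
  shows "Lip a b (\<lambda>t. F (f t))"
proof -
  obtain D where "D-lipschitz_on {a..b} f" using assms(2) by (auto simp: Lip_def)
  then have "(C * D)-lipschitz_on {a..b} (\<lambda>t. F (f t))"
    by (rule lipschitz_on_compose2) (use assms(1) in \<open>auto intro: lipschitz_on_subset\<close>)
  then show ?thesis by (rule Lip_I)
qed

lemma Lip_mult:
  assumes f: "Lip a b f" and g: "Lip a b g"
  shows "Lip a b (\<lambda>t. f t * g t)"
proof -
  obtain B where B: "0 < B" "\<And>t. t \<in> {a..b} \<Longrightarrow> \<bar>f t\<bar> \<le> B" by (rule Lip_bounded[OF f]) blast
  obtain B' where B': "0 < B'" "\<And>t. t \<in> {a..b} \<Longrightarrow> \<bar>g t\<bar> \<le> B'" by (rule Lip_bounded[OF g]) blast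
  obtain C D where C: "C-lipschitz_on {a..b} f" and D: "D-lipschitz_on {a..b} g"
    using f g by (auto simp: Lip_def)
  have "(B * D + C * B')-lipschitz_on {a..b} (\<lambda>t. f t * g t)"
  proof (rule lipschitz_onI)
    fix s t assume st: "s \<in> {a..b}" "t \<in> {a..b}"
    have "f s * g s - f t * g t = f s * (g s - g t) + (f s - f t) * g t" by algebra
    then have "\<bar>f s * g s - f t * g t\<bar> \<le> \<bar>f s\<bar> * \<bar>g s - g t\<bar> + \<bar>f s - f t\<bar> * \<bar>g t\<bar>"
      using abs_triangle_ineq by (metis abs_mult)
    also have "\<dots> \<le> B * (D * \<bar>s - t\<bar>) + (C * \<bar>s - t\<bar>) * B'"
      using B B' st lipschitz_onD[OF C, of s t] lipschitz_onD[OF D, of s t]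
        lipschitz_on_nonneg[OF C] by (intro add_mono mult_mono) (auto simp: dist_real_def)
    finally show "dist (f s * g s) (f t * g t) \<le> (B * D + C * B') * dist s t"
      by (simp add: dist_real_def algebra_simps)
  qed (use B B' lipschitz_on_nonneg[OF C] lipschitz_on_nonneg[OF D] in auto)
  then show ?thesis by (rule Lip_I)
qed

lemma Lip_cmult: "Lip a b f \<Longrightarrow> Lip a b (\<lambda>t. c * f t)"
  by (intro Lip_mult Lip_const)

lemma Lip_inverse:
  assumes f: "Lip a b f" and c: "0 < c" "\<And>t. t \<in> {a..b} \<Longrightarrow> c \<le> f t"
  shows "Lip a b (\<lambda>t. inverse (f t))"
proof -
  obtain C where C: "C-lipschitz_on {a..b} f" using f by (auto simp: Lip_def)
  have "(C / c\<^sup>2)-lipschitz_on {a..b} (\<lambda>t. inverse (f t))"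
  proof (rule lipschitz_onI)
    fix s t assume st: "s \<in> {a..b}" "t \<in> {a..b}"
    have pos: "0 < f s" "0 < f t" using c st by (auto intro: less_le_trans)
    have "\<bar>inverse (f s) - inverse (f t)\<bar> = \<bar>f t - f s\<bar> / (f s * f t)"
      using pos by (simp add: inverse_eq_divide divide_simps abs_mult)
    also have "\<dots> \<le> (C * \<bar>s - t\<bar>) / (c * c)"
      using c st pos lipschitz_onD[OF C, of t s] lipschitz_on_nonneg[OF C]
      by (intro frac_le mult_mono) (auto simp: dist_real_def abs_minus_commute)
    finally show "dist (inverse (f s)) (inverse (f t)) \<le> C / c\<^sup>2 * dist s t"
      by (simp add: dist_real_def power2_eq_square)
  qed (use c lipschitz_on_nonneg[OF C] in auto)
  then show ?thesis by (rule Lip_I)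
qed

lemma Lip_sum: "finite I \<Longrightarrow> (\<And>i. i \<in> I \<Longrightarrow> Lip a b (f i)) \<Longrightarrow> Lip a b (\<lambda>t. \<Sum>i\<in>I. f i t)"
  by (induction I rule: finite_induct) (auto intro: Lip_const Lip_add)

lemma Lip_eq_if_same_deriv:
  assumes "Lip a b f" "Lip a b g"
    and "AE t in lborel. t \<in> {a<..<b} \<longrightarrow>
      (\<exists>d. (f has_real_derivative d) (at t) \<and> (g has_real_derivative d) (at t))"
    and "t \<in> {a..b}" "f a = g a"
  shows "f t = g t"
proof -
  obtain C D where "C-lipschitz_on {a..b} f" "D-lipschitz_on {a..b} g"
    using assms(1,2) by (auto simp: Lip_def)
  then show ?thesis using assms(3-5) by (rule lipschitz_eq_if_same_deriv)
qed

lemma Lip_differentiable_AE: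
  assumes "Lip a b f"
  shows "AE t in lborel. t \<in> {a<..<b} \<longrightarrow> (\<exists>d. (f has_real_derivative d) (at t))"
proof -
  obtain C where "C-lipschitz_on {a..b} f" using assms by (auto simp: Lip_def)
  then show ?thesis by (rule lipschitz_real_differentiable_AE)
qed

lemma bounded_deriv_imp_lipschitz:
  fixes f :: "real \<Rightarrow> real"
  assumes "\<And>x. (f has_real_derivative f' x) (at x)" "\<And>x. \<bar>f' x\<bar> \<le> C"
  shows "C-lipschitz_on UNIV f"
proof (rule lipschitz_onI)
  show "0 \<le> C" using assms(2)[of 0] by linarith
  fix x y
  have "norm (f x - f y) \<le> C * norm (x - y)"
    using assms by (intro field_differentiable_bound[of UNIV f f']) auto
  then show "dist (f x) (f y) \<le> C * dist x y" by (simp add: dist_norm)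
qed

lemma lipschitz_cos: "1-lipschitz_on UNIV (cos :: real \<Rightarrow> real)"
  by (rule bounded_deriv_imp_lipschitz[OF DERIV_cos]) simp

lemma lipschitz_sin: "1-lipschitz_on UNIV (sin :: real \<Rightarrow> real)"
  by (rule bounded_deriv_imp_lipschitz[OF DERIV_sin]) simp

lemma bounded_borel_integrable_on:
  fixes r :: "real \<Rightarrow> real"
  assumes "r \<in> borel_measurable borel" "\<And>x. \<bar>r x\<bar> \<le> B"
  shows "r integrable_on {a..b}"
proof -
  have "finite_measure (lebesgue_on {a..b})" by (intro finite_measure_lebesgue_on) auto
  moreover have "r \<in> borel_measurable lborel" using assms(1) by simp
  then have "r \<in> borel_measurable lebesgue" by (rule measurable_completion)
  then have "r \<in> borel_measurable (lebesgue_on {a..b})" by (rule measurable_restrict_space1)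
  ultimately have "integrable (lebesgue_on {a..b}) r"
    using assms(2) by (intro finite_measure.integrable_const_bound[of _ _ B]) auto
  then show ?thesis by (intro integrable_on_lebesgue_on) auto
qed

lemma Lip_integral:
  fixes r :: "real \<Rightarrow> real"
  assumes r: "r \<in> borel_measurable borel" and B: "\<And>x. \<bar>r x\<bar> \<le> B"
  shows "Lip a b (\<lambda>t. integral {a..t} r)"
proof (rule Lip_I[of B])
  have int: "r integrable_on {u..v}" for u v by (rule bounded_borel_integrable_on[OF r B])
  have B0: "0 \<le> B" using B[of 0] by linarith
  have le: "\<bar>integral {a..t} r - integral {a..s} r\<bar> \<le> B * (t - s)" if "a \<le> s" "s \<le> t" for s t
  proof -
    have "integral {a..s} r + integral {s..t} r = integral {a..t} r"
      using that int by (intro Henstock_Kurzweil_Integration.integral_combine) auto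
    then have "\<bar>integral {a..t} r - integral {a..s} r\<bar> = norm (integral {s..t} r)" by simp
    also have "\<dots> \<le> integral {s..t} (\<lambda>x. B)"
      using B int by (intro integral_norm_bound_integral) auto
    also have "\<dots> = B * (t - s)" using that by simp
    finally show ?thesis .
  qed
  show "B-lipschitz_on {a..b} (\<lambda>t. integral {a..t} r)"
  proof (rule lipschitz_onI)
    fix s t assume "s \<in> {a..b}" "t \<in> {a..b}"
    then show "dist (integral {a..s} r) (integral {a..t} r) \<le> B * dist s t"
      using le[of s t] le[of t s] by (cases "s \<le> t") (auto simp: dist_real_def abs_minus_commute)
  qed (rule B0)
qed

lemma integral_deriv_AE:
  fixes r :: "real \<Rightarrow> real"
  assumes r: "r \<in> borel_measurable borel" and B: "\<And>x. \<bar>r x\<bar> \<le> B"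
  shows "AE t in lborel. t \<in> {a<..<b} \<longrightarrow> ((\<lambda>t. integral {a..t} r) has_real_derivative r t) (at t)"
  using integral_has_real_derivative_AE[OF bounded_borel_integrable_on[OF r B]]
  by eventually_elim auto

text \<open>The half-angle formula: the tangent of half the angle is the sine divided by one plus
  the cosine. It gives the angle in the range from \<open>- pi\<close> (excluded) to
  \<open>pi\<close> by an explicit Borel expression; the first branch covers the origin and the
  negative axis, where the quotient degenerates.\<close>

definition angle :: "real \<times> real \<Rightarrow> real" where
  "angle p = (if snd p = 0 \<and> fst p \<le> 0 then pi else 2 * arctan (snd p / (norm p + fst p)))"

lemma angle_measurable [measurable]: "angle \<in> borel_measurable borel"
proof -
  have [measurable]: "(\<lambda>p::real\<times>real. fst p) \<in> borel_measurable borel"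
    "(\<lambda>p::real\<times>real. snd p) \<in> borel_measurable borel"
    by (intro borel_measurable_continuous_onI continuous_intros)+
  show ?thesis unfolding angle_def by measurable
qed

lemma polar_angle: "norm p *\<^sub>R dir (angle p) = p"
proof (cases "p = 0")
  case False
  obtain a where a: "0 \<le> a" "a < 2 * pi" "p = norm p *\<^sub>R dir a" by (rule polar_exists[of p]) metis
  \<comment> \<open>The representative in the range where half the angle is recovered by
    \<open>arctan\<close>.\<close>
  define b where "b = (if a \<le> pi then a else a - 2 * pi)"
  have "dir b = dir a" using dir_periodic[of b 1] by (auto simp: b_def)
  then have p: "p = norm p *\<^sub>R dir b" using a(3) by simp
  have b: "- pi < b" "b \<le> pi" using a by (auto simp: b_def)
  have s: "0 < norm p" using False by simp
  have f: "fst p = norm p * cos b" "snd p = norm p * sin b"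
    by (subst p, simp add: dir_def)+
  have "angle p = b"
  proof (cases "b = pi")
    case True
    then show ?thesis using f s by (simp add: angle_def)
  next
    case neq: False
    have c2: "cos b = 2 * (cos (b / 2))\<^sup>2 - 1" using cos_double_cos[of "b/2"] by simp
    have "0 < cos (b / 2)" using b neq by (intro cos_gt_zero_pi) auto
    then have c1: "0 < 1 + cos b" unfolding c2 by simp
    have "\<not> (snd p = 0 \<and> fst p \<le> 0)"
    proof
      assume "snd p = 0 \<and> fst p \<le> 0"
      then have "sin b = 0" "cos b \<le> 0" using f s by (auto simp: mult_le_0_iff)
      then have "(cos b)\<^sup>2 = 1" using sin_cos_squared_add[of b] by simp
      then show False using \<open>cos b \<le> 0\<close> c1 by (auto simp: power2_eq_1_iff)
    qed
    then have "angle p = 2 * arctan (snd p / (norm p + fst p))" by (simp add: angle_def)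
    also have "\<dots> = 2 * arctan (norm p * sin b / (norm p + norm p * cos b))" by (simp only: f)
    also have "norm p * sin b / (norm p + norm p * cos b) = sin b / (cos b + 1)"
    proof -
      have "norm p + norm p * cos b = norm p * (cos b + 1)" by (simp add: algebra_simps)
      then show ?thesis using s by simp
    qed
    also have "\<dots> = tan (b / 2)" using tan_half[of "b / 2"] by simp
    also have "arctan (tan (b / 2)) = b / 2" using b neq by (intro arctan_tan) auto
    finally show ?thesis by simp
  qed
  then show ?thesis using p by simp
qed simp

section \<open>Convex trigonometric functions\<close>

definition cv :: "(real \<times> real) set \<Rightarrow> real \<Rightarrow> real \<times> real" where
  "cv \<Omega> \<theta> = (cos_cv \<Omega> \<theta>, sin_cv \<Omega> \<theta>)"

lemma fst_cv [simp]: "fst (cv \<Omega> \<theta>) = cos_cv \<Omega> \<theta>" and snd_cv [simp]: "snd (cv \<Omega> \<theta>) = sin_cv \<Omega> \<theta>"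
  by (simp_all add: cv_def)

context conv_body
begin

lemma cv_eq_pt: "cv \<Omega> \<theta> = pt (Phi \<theta>)"
  by (simp add: cv_def cos_sin_cv)

lemma gauge_cv [simp]: "G (cv \<Omega> \<theta>) = 1"
  by (simp add: cv_eq_pt)

lemma cos_sin_cv_polar:
  "cos_cv \<Omega> \<theta> = rho (Phi \<theta>) * cos (Phi \<theta>)" "sin_cv \<Omega> \<theta> = rho (Phi \<theta>) * sin (Phi \<theta>)"
  unfolding fst_cv[symmetric] snd_cv[symmetric] cv_eq_pt pt_def dir_def by simp_all

text \<open>A Borel choice of the parameter: it inverts \<open>cv\<close> along rays, up to whole
  periods.\<close>

definition cv_arg :: "real \<times> real \<Rightarrow> real" where
  "cv_arg p = Theta (angle p)"

lemma cv_arg_measurable [measurable]: "cv_arg \<in> borel_measurable borel"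
proof -
  have "continuous_on UNIV Theta"
    using DERIV_isCont[OF Theta_deriv] by (simp add: continuous_on_eq_continuous_at)
  then have [measurable]: "Theta \<in> borel_measurable borel" by (rule borel_measurable_continuous_onI)
  show ?thesis unfolding cv_arg_def by measurable
qed

lemma gauge_cv_arg: "G p *\<^sub>R cv \<Omega> (cv_arg p) = p"
proof -
  have "G p = norm p * G (dir (angle p))"
    using gauge_scale[of "norm p" "dir (angle p)"] by (simp add: polar_angle)
  then have "G p * rho (angle p) = norm p"
    using gauge_dir_pos[of "angle p"] by (simp add: rho_def)
  then show ?thesis by (simp add: cv_eq_pt cv_arg_def pt_def polar_angle)
qed

lemma rho_bounds: obtains m M where "0 < m" "\<And>a. m \<le> rho a" "\<And>a. rho a \<le> M"
proof -
  obtain C where C: "0 < C" "\<And>p. G p \<le> C * norm p" by (rule gauge_upper) blast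
  obtain c where c: "0 < c" "\<And>p. c * norm p \<le> G p" by (rule gauge_lower) blast
  have "1 / C \<le> rho a" "rho a \<le> 1 / c" for a
    using C(2)[of "dir a"] c(2)[of "dir a"] gauge_dir_pos[of a] C(1) c(1)
    by (auto simp: rho_def intro!: divide_left_mono)
  then show thesis using C(1) by (intro that[of "1 / C" "1 / c"]) auto
qed

lemma lipschitz_Theta: obtains C where "C-lipschitz_on UNIV Theta"
proof -
  obtain m M where m: "0 < m" "\<And>a. m \<le> rho a" "\<And>a. rho a \<le> M" by (rule rho_bounds) blast
  have "\<bar>(rho a)\<^sup>2\<bar> \<le> M\<^sup>2" for a
    using m(3)[of a] rho_pos[of a] by (simp add: power_mono)
  then show thesis using bounded_deriv_imp_lipschitz[OF Theta_deriv] that by blast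
qed

lemma lipschitz_Phi: obtains C where "C-lipschitz_on UNIV Phi"
proof -
  obtain m M where m: "0 < m" "\<And>a. m \<le> rho a" "\<And>a. rho a \<le> M" by (rule rho_bounds) blast
  have "\<bar>1 / (rho a)\<^sup>2\<bar> \<le> 1 / m\<^sup>2" for a
  proof -
    have "m\<^sup>2 \<le> (rho a)\<^sup>2" using m(1) m(2)[of a] by (intro power_mono) auto
    then show ?thesis using m(1) by (simp add: frac_le)
  qed
  then show thesis using bounded_deriv_imp_lipschitz[OF Phi_deriv] that by blast
qed

lemma Lip_gauge:
  assumes f: "Lip a b f" and g: "Lip a b g"
  shows "Lip a b (\<lambda>t. G (f t, g t))"
proof -
  obtain C where C: "C-lipschitz_on UNIV G" by (rule gauge_lipschitz)
  obtain D E where D: "D-lipschitz_on {a..b} f" and E: "E-lipschitz_on {a..b} g"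
    using f g by (auto simp: Lip_def)
  have "(C * (D + E))-lipschitz_on {a..b} (\<lambda>t. G (f t, g t))"
  proof (rule lipschitz_onI)
    fix s t assume st: "s \<in> {a..b}" "t \<in> {a..b}"
    have "dist (G (f s, g s)) (G (f t, g t)) \<le> C * dist (f s, g s) (f t, g t)"
      by (rule lipschitz_onD[OF C]) auto
    also have "dist (f s, g s) (f t, g t) \<le> dist (f s) (f t) + dist (g s) (g t)"
      using norm_Pair_le[of "f s - f t" "g s - g t"] by (simp add: dist_norm)
    also have "\<dots> \<le> (D + E) * dist s t"
      using lipschitz_onD[OF D st] lipschitz_onD[OF E st] by (simp add: algebra_simps)
    finally show "dist (G (f s, g s)) (G (f t, g t)) \<le> C * (D + E) * dist s t"
      using lipschitz_on_nonneg[OF C] by (simp add: mult_left_mono mult.assoc)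
  qed (use lipschitz_on_nonneg[OF C] lipschitz_on_nonneg[OF D] lipschitz_on_nonneg[OF E] in auto)
  then show ?thesis by (rule Lip_I)
qed

text \<open>The radius is the reciprocal of a gauge that is bounded away from zero on the unit
  circle. It is therefore Lipschitz, although it may have corners.\<close>

lemma Lip_cv:
  assumes "Lip a b \<theta>"
  shows "Lip a b (\<lambda>t. cos_cv \<Omega> (\<theta> t))" "Lip a b (\<lambda>t. sin_cv \<Omega> (\<theta> t))"
proof -
  obtain C where "C-lipschitz_on UNIV Phi" by (rule lipschitz_Phi)
  then have Phi: "Lip a b (\<lambda>t. Phi (\<theta> t))" using assms by (rule Lip_compose)
  have c: "Lip a b (\<lambda>t. cos (Phi (\<theta> t)))" and s: "Lip a b (\<lambda>t. sin (Phi (\<theta> t)))"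
    using Phi by (rule Lip_compose[OF lipschitz_cos], rule Lip_compose[OF lipschitz_sin])
  obtain m where m: "0 < m" "\<And>p. m * norm p \<le> G p" by (rule gauge_lower) blast
  have "Lip a b (\<lambda>t. inverse (G (cos (Phi (\<theta> t)), sin (Phi (\<theta> t)))))"
    using Lip_gauge[OF c s] m(1)
  proof (rule Lip_inverse)
    fix t show "m \<le> G (cos (Phi (\<theta> t)), sin (Phi (\<theta> t)))"
      using m(2)[of "dir (Phi (\<theta> t))"] by (simp add: dir_def[symmetric])
  qed
  then have r: "Lip a b (\<lambda>t. rho (Phi (\<theta> t)))"
    by (simp add: rho_def dir_def inverse_eq_divide)
  show "Lip a b (\<lambda>t. cos_cv \<Omega> (\<theta> t))" "Lip a b (\<lambda>t. sin_cv \<Omega> (\<theta> t))"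
    unfolding cos_sin_cv_polar using r c s by (auto intro: Lip_mult)
qed

text \<open>Differentiating the identity \<open>cos \<phi> \<sqdot> sin_cv = sin \<phi> \<sqdot> cos_cv\<close> avoids differentiating the radius.\<close>

lemma cv_area_rate:
  assumes \<theta>: "(\<theta> has_real_derivative a) (at t)"
    and c: "((\<lambda>s. cos_cv \<Omega> (\<theta> s)) has_real_derivative c') (at t)"
    and s: "((\<lambda>s. sin_cv \<Omega> (\<theta> s)) has_real_derivative s') (at t)"
  shows "cos_cv \<Omega> (\<theta> t) * s' - sin_cv \<Omega> (\<theta> t) * c' = a"
proof -
  define \<phi> where "\<phi> = (\<lambda>s. Phi (\<theta> s))"
  define r where "r = rho (\<phi> t)"
  define \<phi>' where "\<phi>' = 1 / r\<^sup>2 * a"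
  have r: "0 < r" by (simp add: r_def rho_pos)
  have \<phi>_deriv: "(\<phi> has_real_derivative \<phi>') (at t)"
    unfolding \<phi>_def \<phi>'_def r_def by (rule DERIV_chain2[OF Phi_deriv \<theta>])
  let ?d = "(cos_cv \<Omega> (\<theta> t) * (cos (\<phi> t) * \<phi>') + c' * sin (\<phi> t))
      - (sin_cv \<Omega> (\<theta> t) * (- sin (\<phi> t) * \<phi>') + s' * cos (\<phi> t))"
  have "((\<lambda>s. cos_cv \<Omega> (\<theta> s) * sin (\<phi> s) - sin_cv \<Omega> (\<theta> s) * cos (\<phi> s)) has_real_derivative ?d) (at t)"
    by (intro DERIV_diff DERIV_mult' c s DERIV_chain2[OF DERIV_sin \<phi>_deriv] DERIV_chain2[OF DERIV_cos \<phi>_deriv])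
  moreover have "(\<lambda>s. cos_cv \<Omega> (\<theta> s) * sin (\<phi> s) - sin_cv \<Omega> (\<theta> s) * cos (\<phi> s)) = (\<lambda>s. 0)"
    by (rule ext) (simp add: cos_sin_cv_polar \<phi>_def)
  ultimately have "((\<lambda>s. 0::real) has_real_derivative ?d) (at t)" by (simp only:)
  then have "?d = 0" by (rule DERIV_unique[OF _ DERIV_const])
  \<comment> \<open>After multiplication by \<open>r\<close>, the factors \<open>r * cos\<close> and
    \<open>r * sin\<close> in front of \<open>s'\<close> and \<open>c'\<close> become the values of
    \<open>cos_cv\<close> and \<open>sin_cv\<close>.\<close>
  then have "r * ((cos_cv \<Omega> (\<theta> t) * (cos (\<phi> t) * \<phi>') + c' * sin (\<phi> t))
      - (sin_cv \<Omega> (\<theta> t) * (- sin (\<phi> t) * \<phi>') + s' * cos (\<phi> t))) = 0" by simp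
  moreover have cs: "cos_cv \<Omega> (\<theta> t) = r * cos (\<phi> t)" "sin_cv \<Omega> (\<theta> t) = r * sin (\<phi> t)"
    by (simp_all add: cos_sin_cv_polar \<phi>_def r_def)
  ultimately have "r * cos (\<phi> t) * s' - r * sin (\<phi> t) * c'
      = r\<^sup>2 * \<phi>' * ((sin (\<phi> t))\<^sup>2 + (cos (\<phi> t))\<^sup>2)"
    unfolding cs by algebra
  then show ?thesis unfolding cs using r by (simp add: \<phi>'_def)
qed

text \<open>The angle \<open>\<phi>\<close> is defined as the integral it has to be; the component \<open>w\<close> of the curve
  orthogonal to the direction \<open>\<phi>\<close> then satisfies \<open>(w\<^sup>2 / n)' = 0\<close>, \<open>n\<close> being the squared norm.\<close>

lemma cv_lift:
  fixes gx gy r :: "real \<Rightarrow> real"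
  assumes gx: "Lip 0 T gx" and gy: "Lip 0 T gy" and T: "0 \<le> T"
    and bd: "\<And>t. t \<in> {0..T} \<Longrightarrow> G (gx t, gy t) = 1"
    and r: "r \<in> borel_measurable borel" and B: "\<And>t. \<bar>r t\<bar> \<le> B"
    and der: "AE t in lborel. t \<in> {0<..<T} \<longrightarrow> (\<exists>x' y'. (gx has_real_derivative x') (at t) \<and>
        (gy has_real_derivative y') (at t) \<and> gx t * y' - gy t * x' = r t)"
    and init: "(gx 0, gy 0) = cv \<Omega> \<theta>0" and t: "t \<in> {0..T}"
  shows "(gx t, gy t) = cv \<Omega> (\<theta>0 + integral {0..t} r)"
proof -
  define n where "n = (\<lambda>t. gx t * gx t + gy t * gy t)"
  have n_Lip: "Lip 0 T n" unfolding n_def using gx gy by (intro Lip_add Lip_mult)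
  obtain C where C: "0 < C" "\<And>p. G p \<le> C * norm p" by (rule gauge_upper) blast
  have n_lower: "1 / C\<^sup>2 \<le> n t" if "t \<in> {0..T}" for t
  proof -
    have "1 / C \<le> norm (gx t, gy t)" using C(2)[of "(gx t, gy t)"] bd[OF that] C(1) by (simp add: field_simps)
    then have "(1 / C)\<^sup>2 \<le> (norm (gx t, gy t))\<^sup>2" using C(1) by (intro power_mono) auto
    then show ?thesis by (simp add: n_def norm_Pair power_divide power2_eq_square)
  qed
  have n_pos: "0 < n t" if "t \<in> {0..T}" for t
    using n_lower[OF that] C(1) by (smt (verit) zero_less_divide_1_iff zero_less_power)
  \<comment> \<open>Clamping time keeps the denominator below bounded away from zero on the whole
    line, so that \<open>f\<close> is a bounded Borel function.\<close>
  define cl where "cl = (\<lambda>t. max 0 (min T t))"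
  have cl: "cl t \<in> {0..T}" "t \<in> {0..T} \<Longrightarrow> cl t = t" for t using T by (auto simp: cl_def)
  \<comment> \<open>The angular velocity of a plane curve: the cross product of position and
    velocity divided by the squared norm.\<close>
  define f where "f = (\<lambda>t. r t / n (cl t))"
  have "continuous_on UNIV (\<lambda>t. n (cl t))"
    by (rule continuous_on_compose2[OF Lip_continuous[OF n_Lip]])
      (use cl in \<open>auto simp: cl_def intro!: continuous_intros\<close>)
  then have [measurable]: "(\<lambda>t. n (cl t)) \<in> borel_measurable borel" by (rule borel_measurable_continuous_onI)
  note r[measurable]
  have f_meas: "f \<in> borel_measurable borel" unfolding f_def by measurable
  have f_bd: "\<bar>f t\<bar> \<le> B * C\<^sup>2" for t
  proof -
    have "inverse (n (cl t)) \<le> inverse (1 / C\<^sup>2)"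
      using n_lower[OF cl(1)] C(1) by (intro le_imp_inverse_le) auto
    then have "\<bar>r t\<bar> * inverse (n (cl t)) \<le> B * C\<^sup>2"
      using B[of t] n_pos[OF cl(1), of t] by (intro mult_mono) auto
    then show ?thesis using n_pos[OF cl(1), of t] by (simp add: f_def divide_inverse abs_mult)
  qed
  define \<phi> where "\<phi> = (\<lambda>t. Phi \<theta>0 + integral {0..t} f)"
  have \<phi>_Lip: "Lip 0 T \<phi>" unfolding \<phi>_def by (intro Lip_add Lip_const Lip_integral[OF f_meas f_bd])
  have c_Lip: "Lip 0 T (\<lambda>t. cos (\<phi> t))" by (rule Lip_compose[OF lipschitz_cos \<phi>_Lip])
  have s_Lip: "Lip 0 T (\<lambda>t. sin (\<phi> t))" by (rule Lip_compose[OF lipschitz_sin \<phi>_Lip])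
  have \<phi>_der: "AE t in lborel. t \<in> {0<..<T} \<longrightarrow> (\<phi> has_real_derivative f t) (at t)"
    using integral_deriv_AE[OF f_meas f_bd, of 0 T]
  proof eventually_elim
    case (elim t)
    show ?case
    proof
      assume "t \<in> {0<..<T}"
      from DERIV_add[OF DERIV_const[of "Phi \<theta>0"] elim[rule_format, OF this]]
      show "(\<phi> has_real_derivative f t) (at t)" by (simp add: \<phi>_def)
    qed
  qed
  define w where "w = (\<lambda>t. cos (\<phi> t) * gy t - sin (\<phi> t) * gx t)"
  have w_Lip: "Lip 0 T w" unfolding w_def by (intro Lip_diff Lip_mult c_Lip s_Lip gx gy)
  define Q where "Q = (\<lambda>t. w t * w t * inverse (n t))"
  have "0 < 1 / C\<^sup>2" using C(1) by simp
  then have Q_Lip: "Lip 0 T Q" unfolding Q_def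
    by (intro Lip_mult w_Lip Lip_inverse[OF n_Lip]) (use n_lower in auto)
  have init': "gx 0 = rho (\<phi> 0) * cos (\<phi> 0)" "gy 0 = rho (\<phi> 0) * sin (\<phi> 0)"
    using init by (auto simp: cv_eq_pt pt_def dir_def \<phi>_def)
  have Q0: "Q 0 = 0" by (simp add: Q_def w_def init')
  have Q_der: "AE t in lborel. t \<in> {0<..<T} \<longrightarrow> (\<exists>d. (Q has_real_derivative d) (at t) \<and>
      ((\<lambda>t. 0::real) has_real_derivative d) (at t))"
    using der \<phi>_der
  proof eventually_elim
    case (elim t)
    show ?case
    proof
      assume t: "t \<in> {0<..<T}"
      then obtain x' y' where gx': "(gx has_real_derivative x') (at t)"
        and gy': "(gy has_real_derivative y') (at t)" and rt: "gx t * y' - gy t * x' = r t"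
        using elim by blast
      have \<phi>': "(\<phi> has_real_derivative f t) (at t)" using elim t by blast
      have nt: "0 < n t" using t by (intro n_pos) auto
      have ft: "f t * n t = gx t * y' - gy t * x'"
        using t nt rt cl(2)[of t] by (simp add: f_def)
      define w' where "w' = (y' * cos (\<phi> t) - x' * sin (\<phi> t)) - f t * (cos (\<phi> t) * gx t + sin (\<phi> t) * gy t)"
      have w_d: "(w has_real_derivative w') (at t)"
        unfolding w_def w'_def
        by (auto intro!: derivative_eq_intros gx' gy' \<phi>' simp: algebra_simps)
      define n' where "n' = 2 * (gx t * x' + gy t * y')"
      have n_d: "(n has_real_derivative n') (at t)"
        unfolding n_def n'_def by (auto intro!: derivative_eq_intros gx' gy' simp: algebra_simps)
      have "n t * w' = n t * (y' * cos (\<phi> t) - x' * sin (\<phi> t)) - (f t * n t) * (cos (\<phi> t) * gx t + sin (\<phi> t) * gy t)"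
        unfolding w'_def by algebra
      also have "\<dots> = (gx t * x' + gy t * y') * w t"
        unfolding ft unfolding n_def w_def by algebra
      finally have key: "2 * (n t * w') = n' * w t" by (simp add: n'_def)
      have inv_d: "((\<lambda>t. inverse (n t)) has_real_derivative - (inverse (n t) * n' * inverse (n t))) (at t)"
        using n_d nt by (intro DERIV_inverse') auto
      let ?d = "w t * w t * - (inverse (n t) * n' * inverse (n t)) + (w t * w' + w' * w t) * inverse (n t)"
      have Q_d: "(Q has_real_derivative ?d) (at t)"
        unfolding Q_def by (intro DERIV_mult' w_d inv_d)
      have "?d = w t * (2 * (n t * w') - n' * w t) * (inverse (n t) * inverse (n t))"
        using nt by (simp add: field_simps)
      then have "?d = 0" unfolding key by simp
      then have "(Q has_real_derivative 0) (at t)" using Q_d by (simp only:)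
      then show "\<exists>d. (Q has_real_derivative d) (at t) \<and> ((\<lambda>t. 0::real) has_real_derivative d) (at t)"
        by (intro exI[of _ 0]) simp
    qed
  qed
  have w0: "w t = 0" if "t \<in> {0..T}" for t
  proof -
    have "Q t = 0" using Lip_eq_if_same_deriv[OF Q_Lip Lip_const[of _ _ 0] Q_der that] Q0 by simp
    then show ?thesis using n_pos[OF that] by (simp add: Q_def)
  qed
  define c where "c = (\<lambda>t. cos (\<phi> t) * gx t + sin (\<phi> t) * gy t)"
  have c_cont: "continuous_on {0..T} c"
    unfolding c_def by (intro Lip_continuous Lip_add Lip_mult c_Lip s_Lip gx gy)
  have gxy: "gx t = c t * cos (\<phi> t)" "gy t = c t * sin (\<phi> t)" if "t \<in> {0..T}" for t
  proof -
    have 1: "(sin (\<phi> t))\<^sup>2 + (cos (\<phi> t))\<^sup>2 = 1" by simp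
    have "c t * cos (\<phi> t) - w t * sin (\<phi> t) = gx t * ((sin (\<phi> t))\<^sup>2 + (cos (\<phi> t))\<^sup>2)"
      "c t * sin (\<phi> t) + w t * cos (\<phi> t) = gy t * ((sin (\<phi> t))\<^sup>2 + (cos (\<phi> t))\<^sup>2)"
      unfolding c_def w_def by algebra+
    then show "gx t = c t * cos (\<phi> t)" "gy t = c t * sin (\<phi> t)" using w0[OF that] 1 by simp_all
  qed
  have c_ne: "c t \<noteq> 0" if "t \<in> {0..T}" for t
    using n_pos[OF that] gxy[OF that] by (auto simp: n_def)
  \<comment> \<open>So far the curve lies on the line through the origin in direction
    \<open>\<phi> t\<close>. The component \<open>c\<close> is continuous, never zero and positive
    at time 0, which excludes the opposite ray.\<close>
  have c_pos: "0 < c t" if t: "t \<in> {0..T}" for t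
  proof (rule ccontr)
    assume "\<not> 0 < c t"
    then have "c t \<le> 0" by simp
    have "c 0 = rho (\<phi> 0) * ((sin (\<phi> 0))\<^sup>2 + (cos (\<phi> 0))\<^sup>2)"
      unfolding c_def init' by algebra
    then have "0 \<le> c 0" using rho_pos[of "\<phi> 0"] by simp
    then obtain s where "0 \<le> s" "s \<le> t" "c s = 0"
      using IVT2'[of c t 0 0] \<open>c t \<le> 0\<close> t continuous_on_subset[OF c_cont, of "{0..t}"] by auto
    then show False using c_ne[of s] t by simp
  qed
  have g_pt: "(gx t, gy t) = pt (\<phi> t)" and c_rho: "c t = rho (\<phi> t)" if "t \<in> {0..T}" for t
  proof -
    have eq: "(gx t, gy t) = c t *\<^sub>R dir (\<phi> t)" using gxy[OF that] by (simp add: dir_def)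
    then have "G (c t *\<^sub>R dir (\<phi> t)) = 1" using bd[OF that] by simp
    from pt_unique[OF c_pos[OF that] this] show "(gx t, gy t) = pt (\<phi> t)" using eq by simp
    then have "c t *\<^sub>R dir (\<phi> t) = rho (\<phi> t) *\<^sub>R dir (\<phi> t)" using eq by (simp add: pt_def)
    then show "c t = rho (\<phi> t)" by simp
  qed
  \<comment> \<open>The squared norm \<open>n\<close> is now known to be the squared radius, so the
    factor from the derivative of \<open>Theta\<close> cancels the denominator of
    \<open>f\<close>.\<close>
  have "Theta (\<phi> t) = \<theta>0 + integral {0..t} r"
  proof (rule Lip_eq_if_same_deriv[of 0 T "\<lambda>t. Theta (\<phi> t)" "\<lambda>t. \<theta>0 + integral {0..t} r", OF _ _ _ t])
    obtain D where "D-lipschitz_on UNIV Theta" by (rule lipschitz_Theta)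
    then show "Lip 0 T (\<lambda>t. Theta (\<phi> t))" using \<phi>_Lip by (rule Lip_compose)
    show "Lip 0 T (\<lambda>t. \<theta>0 + integral {0..t} r)" by (intro Lip_add Lip_const Lip_integral[OF r B])
    show "AE t in lborel. t \<in> {0<..<T} \<longrightarrow> (\<exists>d. ((\<lambda>t. Theta (\<phi> t)) has_real_derivative d) (at t) \<and>
        ((\<lambda>t. \<theta>0 + integral {0..t} r) has_real_derivative d) (at t))"
      using \<phi>_der integral_deriv_AE[OF r B, of 0 T]
    proof eventually_elim
      case (elim t)
      show ?case
      proof
        assume t: "t \<in> {0<..<T}"
        have "((\<lambda>t. Theta (\<phi> t)) has_real_derivative (rho (\<phi> t))\<^sup>2 * f t) (at t)"
          using elim t by (intro DERIV_chain2[OF Theta_deriv]) auto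
        moreover have "(rho (\<phi> t))\<^sup>2 * f t = r t"
        proof -
          have tT: "t \<in> {0..T}" using t by simp
          have "n t = (c t)\<^sup>2 * ((sin (\<phi> t))\<^sup>2 + (cos (\<phi> t))\<^sup>2)"
            unfolding n_def gxy[OF tT] by algebra
          then have "n t = (rho (\<phi> t))\<^sup>2" using c_rho[OF tT] by simp
          then show ?thesis using cl(2)[OF tT] n_pos[OF tT] by (simp add: f_def)
        qed
        moreover have "((\<lambda>t. \<theta>0 + integral {0..t} r) has_real_derivative 0 + r t) (at t)"
          using elim t by (intro DERIV_add DERIV_const) auto
        ultimately show "\<exists>d. ((\<lambda>t. Theta (\<phi> t)) has_real_derivative d) (at t) \<and>
            ((\<lambda>t. \<theta>0 + integral {0..t} r) has_real_derivative d) (at t)" by auto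
      qed
    qed
    show "Theta (\<phi> 0) = \<theta>0 + integral {0..0} r" by (simp add: \<phi>_def)
  qed
  then have "\<phi> t = Phi (\<theta>0 + integral {0..t} r)" by (metis Phi_Theta)
  then show ?thesis using g_pt[OF t] by (simp add: cv_eq_pt)
qed

end

section \<open>The control set\<close>

lemma has_vector_derivative_vec_iff:
  fixes f :: "real \<Rightarrow> real^'n"
  shows "(f has_vector_derivative f') (at t) \<longleftrightarrow> (\<forall>i. ((\<lambda>t. f t $ i) has_real_derivative f' $ i) (at t))"
proof -
  have "(f has_vector_derivative f') (at t) \<longleftrightarrow>
      (\<forall>b\<in>Basis. ((\<lambda>t. f t \<bullet> b) has_derivative (\<lambda>h. (h *\<^sub>R f') \<bullet> b)) (at t))"
    unfolding has_vector_derivative_def by (rule has_derivative_componentwise_within)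
  also have "\<dots> \<longleftrightarrow> (\<forall>i. ((\<lambda>t. f t $ i) has_derivative (\<lambda>h. h * f' $ i)) (at t))"
    by (simp add: Basis_vec_def inner_axis)
  also have "\<dots> \<longleftrightarrow> (\<forall>i. ((\<lambda>t. f t $ i) has_real_derivative f' $ i) (at t))"
    by (simp add: has_field_derivative_def mult_commute_abs)
  finally show ?thesis .
qed

lemma Lip_vec_nth:
  fixes f :: "real \<Rightarrow> real^'n"
  assumes "C-lipschitz_on {a..b} f"
  shows "Lip a b (\<lambda>t. f t $ i)"
proof (rule Lip_I[of C], rule lipschitz_onI)
  fix s t assume "s \<in> {a..b}" "t \<in> {a..b}"
  then show "dist (f s $ i) (f t $ i) \<le> C * dist s t"
    using lipschitz_onD[OF assms] dist_vec_nth_le[of "f s" i "f t"] by force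
qed (use assms lipschitz_on_nonneg in blast)

lemma lipschitz_on_vecI:
  fixes f :: "real \<Rightarrow> real^'n"
  assumes "\<And>i. Lip a b (\<lambda>t. f t $ i)"
  obtains C where "C-lipschitz_on {a..b} f"
proof -
  obtain C where C: "\<And>i. (C i)-lipschitz_on {a..b} (\<lambda>t. f t $ i)"
    using assms unfolding Lip_def by metis
  have "(\<Sum>i\<in>UNIV. C i)-lipschitz_on {a..b} f"
  proof (rule lipschitz_onI)
    fix s t assume st: "s \<in> {a..b}" "t \<in> {a..b}"
    have "dist (f s) (f t) \<le> (\<Sum>i\<in>UNIV. \<bar>(f s - f t) $ i\<bar>)"
      unfolding dist_norm by (rule norm_le_l1_cart)
    also have "\<dots> \<le> (\<Sum>i\<in>UNIV. C i * dist s t)"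
      using lipschitz_onD[OF C st] by (intro sum_mono) (simp add: dist_real_def)
    finally show "dist (f s) (f t) \<le> (\<Sum>i\<in>UNIV. C i) * dist s t" by (simp add: sum_distrib_right)
  qed (use C lipschitz_on_nonneg in \<open>blast intro: sum_nonneg\<close>)
  then show thesis by (rule that)
qed

lemma borel_measurable_vecI:
  fixes f :: "real \<Rightarrow> real^'n"
  assumes "\<And>i. (\<lambda>t. f t $ i) \<in> borel_measurable borel"
  shows "f \<in> borel_measurable borel"
  using assms by (subst borel_measurable_euclidean_space) (auto simp: Basis_vec_def inner_axis)

lemma borel_measurable_vec_nth:
  fixes f :: "real \<Rightarrow> real^'n"
  assumes "f \<in> borel_measurable borel"
  shows "(\<lambda>t. f t $ i) \<in> borel_measurable borel"
proof -
  have "(\<lambda>t. f t \<bullet> axis i 1) \<in> borel_measurable borel" using assms by simp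
  then show ?thesis by (simp add: inner_axis)
qed

context conv_body
begin

lemma continuous_cv: "continuous_on UNIV (cos_cv \<Omega>)" "continuous_on UNIV (sin_cv \<Omega>)"
proof -
  have "continuous_on UNIV Phi"
    using DERIV_isCont[OF Phi_deriv] by (simp add: continuous_on_eq_continuous_at)
  then have "continuous_on UNIV (\<lambda>\<theta>. rho (Phi \<theta>) * cos (Phi \<theta>))"
    "continuous_on UNIV (\<lambda>\<theta>. rho (Phi \<theta>) * sin (Phi \<theta>))"
    by (intro continuous_intros continuous_on_compose2[OF continuous_rho[of UNIV]]; simp)+
  then show "continuous_on UNIV (cos_cv \<Omega>)" "continuous_on UNIV (sin_cv \<Omega>)"
    unfolding cos_sin_cv_polar[abs_def] by simp_all
qed

lemma cv_measurable [measurable]: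
  "cos_cv \<Omega> \<in> borel_measurable borel" "sin_cv \<Omega> \<in> borel_measurable borel"
  by (intro borel_measurable_continuous_onI continuous_cv)+

lemma gauge_measurable [measurable]: "G \<in> borel_measurable borel"
  by (intro borel_measurable_continuous_onI continuous_gauge)

lemma cv_bounded: obtains C where "0 < C" "\<And>\<theta>. \<bar>cos_cv \<Omega> \<theta>\<bar> \<le> C" "\<And>\<theta>. \<bar>sin_cv \<Omega> \<theta>\<bar> \<le> C"
proof -
  obtain c where c: "0 < c" "\<And>p. c * norm p \<le> G p" by (rule gauge_lower) blast
  have "norm (cv \<Omega> \<theta>) \<le> 1 / c" for \<theta>
    using c(2)[of "cv \<Omega> \<theta>"] c(1) by (simp add: field_simps)
  then have "\<bar>cos_cv \<Omega> \<theta>\<bar> \<le> 1 / c" "\<bar>sin_cv \<Omega> \<theta>\<bar> \<le> 1 / c" for \<theta>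
    using norm_fst_le[of "cos_cv \<Omega> \<theta>" "sin_cv \<Omega> \<theta>"] norm_snd_le[of "sin_cv \<Omega> \<theta>" "cos_cv \<Omega> \<theta>"]
    unfolding cv_def real_norm_def[symmetric] by (meson order_trans)+
  then show thesis using c(1) by (intro that[of "1 / c"]) auto
qed

end

section \<open>Maximizing a covector over the control set\<close>

locale sub_finsler =
  fixes \<Omega> :: "'n::finite \<Rightarrow> (real \<times> real) set" and \<mu> :: "real^'n \<Rightarrow> real"
  assumes main: "main_assumption \<Omega> \<mu>"
begin

lemma body: "conv_body (\<Omega> i)"
  using main by (simp add: main_assumption_def conv_body_def)

lemma polar_body: "conv_body (polar2 (\<Omega> i))"
  by (rule conv_body.conv_body_polar[OF body])

abbreviation bgauge :: "'n \<Rightarrow> real \<times> real \<Rightarrow> real" where "bgauge i \<equiv> minkowski_fn (\<Omega> i)"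
abbreviation pgauge :: "'n \<Rightarrow> real \<times> real \<Rightarrow> real" where "pgauge i \<equiv> minkowski_fn (polar2 (\<Omega> i))"
abbreviation bcos :: "'n \<Rightarrow> real \<Rightarrow> real" where "bcos i \<equiv> cos_cv (\<Omega> i)"
abbreviation bsin :: "'n \<Rightarrow> real \<Rightarrow> real" where "bsin i \<equiv> sin_cv (\<Omega> i)"
abbreviation pcos :: "'n \<Rightarrow> real \<Rightarrow> real" where "pcos i \<equiv> cos_cv (polar2 (\<Omega> i))"
abbreviation psin :: "'n \<Rightarrow> real \<Rightarrow> real" where "psin i \<equiv> sin_cv (polar2 (\<Omega> i))"

lemma mu_facts:
  "continuous_on orthant \<mu>" "convex_on orthant \<mu>"
  "0 \<le> c \<Longrightarrow> l \<in> orthant \<Longrightarrow> \<mu> (c *\<^sub>R l) = c * \<mu> l"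
  "l \<in> orthant \<Longrightarrow> l \<noteq> 0 \<Longrightarrow> 0 < \<mu> l"
  using main by (auto simp: main_assumption_def)

lemma Xi_eq: "Xi \<mu> = {l \<in> orthant. \<mu> l \<le> 1}"
  by (auto simp: Xi_def orthant_def)

lemma orthant_halfspaces: "orthant = (\<Inter>i. {l::real^'n. 0 \<le> l $ i})"
  by (auto simp: orthant_def)

lemma closed_orthant: "closed (orthant :: (real^'n) set)"
  unfolding orthant_halfspaces by (intro closed_INT ballI closed_Collect_le continuous_intros)

lemma zero_in_Xi: "0 \<in> Xi \<mu>"
  using mu_facts(3)[of 0 0] by (simp add: Xi_eq orthant_def)

text \<open>By compactness \<mu> has a positive minimum on the part of the unit sphere in the
  orthant, and homogeneity turns it into a lower bound proportional to the norm. An arbitrary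
  coordinate axis shows that this part is nonempty.\<close>

lemma Xi_bounded: obtains R where "0 < R" "\<And>l. l \<in> Xi \<mu> \<Longrightarrow> norm l \<le> R"
proof -
  let ?S = "sphere 0 1 \<inter> (orthant :: (real^'n) set)"
  have cpt: "compact ?S" by (intro compact_Int_closed compact_sphere closed_orthant)
  have "axis (undefined :: 'n) (1::real) \<in> ?S"
    by (simp add: orthant_def) (simp add: axis_def)
  then have ne: "?S \<noteq> {}" by blast
  have "continuous_on ?S \<mu>" using mu_facts(1) by (rule continuous_on_subset) auto
  from continuous_attains_inf[OF cpt ne this]
  obtain e where e: "e \<in> ?S" "\<And>l. l \<in> ?S \<Longrightarrow> \<mu> e \<le> \<mu> l" by blast
  have pos: "0 < \<mu> e" using e(1) by (intro mu_facts(4)) auto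
  have "norm l \<le> 1 / \<mu> e" if l: "l \<in> Xi \<mu>" for l
  proof (cases "l = 0")
    case False
    have lo: "l \<in> orthant" "\<mu> l \<le> 1" using l by (auto simp: Xi_eq)
    let ?k = "(1 / norm l) *\<^sub>R l"
    have ko: "?k \<in> orthant" using lo by (simp add: orthant_def)
    have "?k \<in> ?S" using ko False by simp
    then have "\<mu> e \<le> \<mu> ?k" by (rule e(2))
    then have "norm l * \<mu> e \<le> norm l * \<mu> ?k" by (intro mult_left_mono) auto
    also have "\<dots> = \<mu> (norm l *\<^sub>R ?k)" using ko by (intro mu_facts(3)[symmetric]) auto
    also have "\<dots> \<le> 1" using False lo by simp
    finally show ?thesis using pos by (simp add: field_simps)
  qed (use pos in simp)
  then show thesis using pos by (intro that[of "1 / \<mu> e"]) auto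
qed

lemma closed_Xi: "closed (Xi \<mu>)"
proof -
  have "closed (orthant \<inter> \<mu> -` {..1})"
    by (intro continuous_closed_preimage mu_facts closed_orthant closed_atMost)
  moreover have "Xi \<mu> = orthant \<inter> \<mu> -` {..1}" by (auto simp: Xi_eq)
  ultimately show ?thesis by simp
qed

lemma compact_Xi: "compact (Xi \<mu>)"
  using Xi_bounded closed_Xi by (metis bounded_iff compact_eq_bounded_closed)

lemma convex_Xi: "convex (Xi \<mu>)"
proof (rule convexI)
  fix k l and u v :: real
  assume kl: "k \<in> Xi \<mu>" "l \<in> Xi \<mu>" and uv: "0 \<le> u" "0 \<le> v" "u + v = 1"
  have o: "k \<in> orthant" "l \<in> orthant" and le: "\<mu> k \<le> 1" "\<mu> l \<le> 1" using kl by (auto simp: Xi_eq)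
  have "u *\<^sub>R k + v *\<^sub>R l \<in> orthant" using o uv by (simp add: orthant_def)
  moreover have "\<mu> (u *\<^sub>R k + v *\<^sub>R l) \<le> u * \<mu> k + v * \<mu> l"
    using mu_facts(2) o uv unfolding convex_on_def by blast
  moreover have "u * \<mu> k + v * \<mu> l \<le> u * 1 + v * 1"
    using uv le by (intro add_mono mult_left_mono) auto
  ultimately show "u *\<^sub>R k + v *\<^sub>R l \<in> Xi \<mu>" using uv by (simp add: Xi_eq)
qed

lemma supp_attained: obtains l where "l \<in> Xi \<mu>" "A \<bullet> l = supp_Xi \<mu> A"
  "\<And>k. k \<in> Xi \<mu> \<Longrightarrow> A \<bullet> k \<le> supp_Xi \<mu> A"
proof -
  have "continuous_on (Xi \<mu>) (\<lambda>l. A \<bullet> l)" by (intro continuous_intros)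
  from continuous_attains_sup[OF compact_Xi _ this] zero_in_Xi
  obtain l where l: "l \<in> Xi \<mu>" "\<And>k. k \<in> Xi \<mu> \<Longrightarrow> A \<bullet> k \<le> A \<bullet> l" by blast
  have "supp_Xi \<mu> A = A \<bullet> l"
    unfolding supp_Xi_def by (rule cSup_eq_maximum) (use l in auto)
  then show thesis using l that by simp
qed

lemma supp_upper: "l \<in> Xi \<mu> \<Longrightarrow> A \<bullet> l \<le> supp_Xi \<mu> A"
  by (rule supp_attained[of A]) blast

lemma supp_le: "(\<And>l. l \<in> Xi \<mu> \<Longrightarrow> A \<bullet> l \<le> s) \<Longrightarrow> supp_Xi \<mu> A \<le> s"
  by (rule supp_attained[of A]) metis

lemma supp_nonneg: "0 \<le> supp_Xi \<mu> A"
  using supp_upper[OF zero_in_Xi] by simp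

lemma supp_scale:
  assumes "0 \<le> c" shows "supp_Xi \<mu> (c *\<^sub>R A) = c * supp_Xi \<mu> A"
proof (rule antisym)
  show "supp_Xi \<mu> (c *\<^sub>R A) \<le> c * supp_Xi \<mu> A"
    using assms supp_upper by (intro supp_le) (simp add: mult_left_mono)
  obtain l where "l \<in> Xi \<mu>" "A \<bullet> l = supp_Xi \<mu> A" by (rule supp_attained[of A]) blast
  then show "c * supp_Xi \<mu> A \<le> supp_Xi \<mu> (c *\<^sub>R A)"
    using supp_upper[of l "c *\<^sub>R A"] by simp
qed

text \<open>Testing the subgradient inequality with \<open>B = A - a\<close>, where \<open>a\<close>
  is normal to a hyperplane separating \<open>l\<close> from \<open>Xi \<mu>\<close>, shows that
  \<open>l\<close> belongs to \<open>Xi \<mu>\<close>. Testing it with \<open>B = 0\<close> gives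
  maximality.\<close>

lemma subdiff_iff: "l \<in> subdiff_Xi \<mu> A \<longleftrightarrow> l \<in> Xi \<mu> \<and> A \<bullet> l = supp_Xi \<mu> A"
proof
  assume l: "l \<in> Xi \<mu> \<and> A \<bullet> l = supp_Xi \<mu> A"
  then show "l \<in> subdiff_Xi \<mu> A"
    using supp_upper[of l] by (auto simp: subdiff_Xi_def inner_diff_left)
next
  assume "l \<in> subdiff_Xi \<mu> A"
  then have sub: "supp_Xi \<mu> A + (B - A) \<bullet> l \<le> supp_Xi \<mu> B" for B by (simp add: subdiff_Xi_def)
  have Xi: "l \<in> Xi \<mu>"
  proof (rule ccontr)
    assume "l \<notin> Xi \<mu>"
    from separating_hyperplane_closed_point[OF convex_Xi closed_Xi this]
    obtain a b where ab: "a \<bullet> l < b" "\<And>k. k \<in> Xi \<mu> \<Longrightarrow> b < a \<bullet> k" by blast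
    have "supp_Xi \<mu> (A - a) \<le> supp_Xi \<mu> A - b"
    proof (rule supp_le)
      fix k assume k: "k \<in> Xi \<mu>"
      show "(A - a) \<bullet> k \<le> supp_Xi \<mu> A - b"
        using supp_upper[OF k, of A] ab(2)[OF k] by (simp add: inner_diff_left)
    qed
    moreover have "supp_Xi \<mu> A - a \<bullet> l \<le> supp_Xi \<mu> (A - a)" using sub[of "A - a"] by simp
    ultimately show False using ab(1) by linarith
  qed
  have "supp_Xi \<mu> 0 \<le> 0" by (rule supp_le) simp
  then have "supp_Xi \<mu> A \<le> A \<bullet> l" using sub[of 0] by simp
  then show "l \<in> Xi \<mu> \<and> A \<bullet> l = supp_Xi \<mu> A" using Xi supp_upper[OF Xi, of A] by simp
qed

definition gauges :: "real^'n \<Rightarrow> real^'n \<Rightarrow> real^'n" where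
  "gauges u v = (\<chi> i. bgauge i (u $ i, v $ i))"

definition polar_gauges :: "real^'n \<Rightarrow> real^'n \<Rightarrow> real^'n" where
  "polar_gauges u v = (\<chi> i. pgauge i (u $ i, v $ i))"

lemma gauges_nonneg: "0 \<le> gauges u v $ i"
  by (simp add: gauges_def conv_body.gauge_nonneg[OF body])

lemma U_iff: "(u, v) \<in> U_of \<Omega> \<mu> \<longleftrightarrow> gauges u v \<in> Xi \<mu>"
  using gauges_nonneg by (auto simp: U_of_def Xi_eq orthant_def gauges_def)

lemma pairing_le: "p $ i * u $ i + q $ i * v $ i \<le> polar_gauges p q $ i * gauges u v $ i"
  using conv_body.inner_le_gauges[OF body, of "(p $ i, q $ i)" "(u $ i, v $ i)"]
  by (simp add: polar_gauges_def gauges_def)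

lemma inner_vec_sum: "(A :: real^'n) \<bullet> l = (\<Sum>i\<in>UNIV. A $ i * l $ i)"
  by (simp add: inner_vec_def)

lemma pairing_sum_le:
  assumes "(u, v) \<in> U_of \<Omega> \<mu>"
  shows "p \<bullet> u + q \<bullet> v \<le> supp_Xi \<mu> (polar_gauges p q)"
proof -
  have "p \<bullet> u + q \<bullet> v \<le> polar_gauges p q \<bullet> gauges u v"
    unfolding inner_vec_sum sum.distrib[symmetric] by (intro sum_mono pairing_le)
  also have "\<dots> \<le> supp_Xi \<mu> (polar_gauges p q)" using assms by (intro supp_upper) (simp add: U_iff)
  finally show ?thesis .
qed

text \<open>The bound of \<open>pairing_sum_le\<close> is a sum of planar inequalities followed by
  the support inequality for \<open>Xi \<mu>\<close>. Overall equality forces equality in the last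
  one and in each summand, so the maximum decouples into the planes.\<close>

lemma pairing_max:
  assumes U: "(u, v) \<in> U_of \<Omega> \<mu>" and eq: "p \<bullet> u + q \<bullet> v = supp_Xi \<mu> (polar_gauges p q)"
  shows "gauges u v \<in> subdiff_Xi \<mu> (polar_gauges p q)"
    and "p $ i * u $ i + q $ i * v $ i = polar_gauges p q $ i * gauges u v $ i"
proof -
  have Xi: "gauges u v \<in> Xi \<mu>" using U by (simp add: U_iff)
  have le: "p \<bullet> u + q \<bullet> v \<le> polar_gauges p q \<bullet> gauges u v"
    unfolding inner_vec_sum sum.distrib[symmetric] by (intro sum_mono pairing_le)
  then have eq2: "polar_gauges p q \<bullet> gauges u v = supp_Xi \<mu> (polar_gauges p q)"
    using supp_upper[OF Xi] eq by (intro antisym) auto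
  then show "gauges u v \<in> subdiff_Xi \<mu> (polar_gauges p q)" using Xi by (simp add: subdiff_iff)
  have "(\<Sum>i\<in>UNIV. polar_gauges p q $ i * gauges u v $ i - (p $ i * u $ i + q $ i * v $ i)) = 0"
    using eq eq2 by (simp add: inner_vec_sum sum_subtractf sum.distrib)
  moreover have "0 \<le> polar_gauges p q $ i * gauges u v $ i - (p $ i * u $ i + q $ i * v $ i)" for i
    using pairing_le[of p i u q v] by simp
  ultimately show "p $ i * u $ i + q $ i * v $ i = polar_gauges p q $ i * gauges u v $ i"
    by (subst (asm) sum_nonneg_eq_0_iff) auto
qed

text \<open>The bound is attained: choose a boundary maximizer in each plane and scale these by the
  coordinates of a maximizer in \<open>Xi \<mu>\<close>. The gauge vector of the resulting control
  is that maximizer.\<close>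

lemma pairing_SUP:
  "(SUP w\<in>U_of \<Omega> \<mu>. p \<bullet> fst w + q \<bullet> snd w) = supp_Xi \<mu> (polar_gauges p q)"
proof (rule cSup_eq_maximum)
  have "\<exists>\<zeta>. bgauge i \<zeta> = 1 \<and> (p $ i, q $ i) \<bullet> \<zeta> = polar_gauges p q $ i" for i
  proof -
    obtain w where "bgauge i w = 1"
      "(p $ i, q $ i) \<bullet> w = pgauge i (p $ i, q $ i)"
      by (rule conv_body.support_attained[OF body])
    then show ?thesis by (intro exI[of _ w] conjI) (simp_all only: polar_gauges_def vec_lambda_beta)
  qed
  then obtain \<zeta> where \<zeta>: "\<And>i. bgauge i (\<zeta> i) = 1" "\<And>i. (p $ i, q $ i) \<bullet> \<zeta> i = polar_gauges p q $ i"
    by metis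
  obtain l where l: "l \<in> Xi \<mu>" "polar_gauges p q \<bullet> l = supp_Xi \<mu> (polar_gauges p q)" by (rule supp_attained) blast
  define u where "u = (\<chi> i. l $ i * fst (\<zeta> i))"
  define v where "v = (\<chi> i. l $ i * snd (\<zeta> i))"
  have l0: "0 \<le> l $ i" for i using l(1) by (simp add: Xi_def)
  have "gauges u v = l"
  proof (rule vec_eq_iff[THEN iffD2], rule allI)
    fix i
    have "(u $ i, v $ i) = l $ i *\<^sub>R \<zeta> i" by (simp add: u_def v_def prod_eq_iff)
    then show "gauges u v $ i = l $ i"
      using conv_body.gauge_scale[OF body l0[of i], of i "\<zeta> i"] \<zeta>(1)[of i] by (simp add: gauges_def)
  qed
  then have U: "(u, v) \<in> U_of \<Omega> \<mu>" using l by (simp add: U_iff)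
  have "p \<bullet> u + q \<bullet> v = (\<Sum>i\<in>UNIV. l $ i * ((p $ i, q $ i) \<bullet> \<zeta> i))"
    unfolding inner_vec_sum sum.distrib[symmetric]
    by (intro sum.cong) (auto simp: u_def v_def inner_prod_def algebra_simps)
  also have "\<dots> = polar_gauges p q \<bullet> l" unfolding \<zeta>(2) inner_vec_sum by (simp add: mult.commute)
  finally have "p \<bullet> u + q \<bullet> v = supp_Xi \<mu> (polar_gauges p q)" using l by simp
  then show "supp_Xi \<mu> (polar_gauges p q) \<in> (\<lambda>w. p \<bullet> fst w + q \<bullet> snd w) ` U_of \<Omega> \<mu>"
    using U by (intro image_eqI[of _ _ "(u, v)"]) auto
  show "r \<le> supp_Xi \<mu> (polar_gauges p q)" if "r \<in> (\<lambda>w. p \<bullet> fst w + q \<bullet> snd w) ` U_of \<Omega> \<mu>" for r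
    using that pairing_sum_le by auto
qed

end

text \<open>Collecting the coefficients of the controls turns the Hamiltonian into a linear pairing
  with the left-invariant momenta, to which \<open>pairing_SUP\<close> applies.\<close>

lemma hamiltonian_eq:
  "hamiltonian px py pz x y u v = (px - (pz / 2) *\<^sub>R y) \<bullet> u + (py + (pz / 2) *\<^sub>R x) \<bullet> v"
  unfolding hamiltonian_def inner_vec_def
  by (simp add: sum.distrib[symmetric] sum_distrib_left sum_subtractf[symmetric] algebra_simps)

section \<open>Solutions of the maximum principle\<close>

lemma lipschitz_on_fst: "C-lipschitz_on S (\<lambda>t. (f t, g t)) \<Longrightarrow> C-lipschitz_on S f"
  unfolding lipschitz_on_def using dist_fst_le by (metis fst_conv order_trans)

lemma lipschitz_on_snd: "C-lipschitz_on S (\<lambda>t. (f t, g t)) \<Longrightarrow> C-lipschitz_on S g"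
  unfolding lipschitz_on_def using dist_snd_le by (metis snd_conv order_trans)

context sub_finsler
begin

definition horizontal_velocity :: "(real \<Rightarrow> real^'n) \<Rightarrow> (real \<Rightarrow> real^'n) \<Rightarrow> (real \<Rightarrow> real) \<Rightarrow> real \<Rightarrow>
    real^'n \<Rightarrow> real^'n \<Rightarrow> bool" where
  "horizontal_velocity x y z t u v \<longleftrightarrow>
     (\<forall>i. ((\<lambda>t. x t $ i) has_real_derivative u $ i) (at t)) \<and>
     (\<forall>i. ((\<lambda>t. y t $ i) has_real_derivative v $ i) (at t)) \<and>
     (z has_real_derivative 1/2 * (\<Sum>i\<in>UNIV. x t $ i * v $ i - u $ i * y t $ i)) (at t)"

text \<open>If \<open>A\<close> consists of the polar gauges of the momentum, the last two clauses
  together say that \<open>(u, v)\<close> is an admissible control maximizing the Hamiltonian,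
  expressed plane by plane.\<close>

definition maximizing_velocity :: "(real \<Rightarrow> real^'n) \<Rightarrow> (real \<Rightarrow> real^'n) \<Rightarrow> (real \<Rightarrow> real) \<Rightarrow>
    real^'n \<Rightarrow> real^'n \<Rightarrow> real \<Rightarrow> real^'n \<Rightarrow> real \<Rightarrow> real^'n \<Rightarrow> real^'n \<Rightarrow> bool" where
  "maximizing_velocity x y z a b c A t u v \<longleftrightarrow> horizontal_velocity x y z t u v \<and>
     gauges u v \<in> subdiff_Xi \<mu> A \<and>
     (\<forall>i. (a $ i - c * y t $ i) * u $ i + (b $ i + c * x t $ i) * v $ i = A $ i * gauges u v $ i)"

text \<open>The components \<open>a - c y\<close> and \<open>b + c x\<close> are the left-invariant momenta \<open>p\<^sub>x - p\<^sub>z y / 2\<close> and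
  \<open>p\<^sub>y + p\<^sub>z x / 2\<close> of an extremal; \<open>A\<close> collects their polar gauges.\<close>

definition pmp_data :: "real \<Rightarrow> (real \<Rightarrow> real^'n) \<Rightarrow> (real \<Rightarrow> real^'n) \<Rightarrow> (real \<Rightarrow> real) \<Rightarrow>
    real^'n \<Rightarrow> real^'n \<Rightarrow> real \<Rightarrow> real^'n \<Rightarrow> bool" where
  "pmp_data T x y z a b c A \<longleftrightarrow> 0 < T \<and>
     (\<forall>i. Lip 0 T (\<lambda>t. x t $ i)) \<and> (\<forall>i. Lip 0 T (\<lambda>t. y t $ i)) \<and> Lip 0 T z \<and>
     x 0 = 0 \<and> y 0 = 0 \<and> z 0 = 0 \<and>
     (\<forall>t\<in>{0..T}. polar_gauges (a - c *\<^sub>R y t) (b + c *\<^sub>R x t) = A) \<and> (c \<noteq> 0 \<or> A \<noteq> 0) \<and>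
     (AE t in lborel. t \<in> {0<..<T} \<longrightarrow> (\<exists>u v. maximizing_velocity x y z a b c A t u v))"

lemma pmp_data_imp_extremal:
  assumes pmp: "pmp_data T x y z a b c A"
  shows "extremal (U_of \<Omega> \<mu>) T x y z"
proof -
  have T: "0 < T" and x: "\<And>i. Lip 0 T (\<lambda>t. x t $ i)" and y: "\<And>i. Lip 0 T (\<lambda>t. y t $ i)"
    and z: "Lip 0 T z" and init: "x 0 = 0" "y 0 = 0" "z 0 = 0"
    and A: "\<And>t. t \<in> {0..T} \<Longrightarrow> polar_gauges (a - c *\<^sub>R y t) (b + c *\<^sub>R x t) = A"
    and ne: "c \<noteq> 0 \<or> A \<noteq> 0"
    and ae: "AE t in lborel. t \<in> {0<..<T} \<longrightarrow> (\<exists>u v. maximizing_velocity x y z a b c A t u v)"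
    using pmp unfolding pmp_data_def by blast+
  obtain Cx where Cx: "Cx-lipschitz_on {0..T} x" using x by (rule lipschitz_on_vecI)
  obtain Cy where Cy: "Cy-lipschitz_on {0..T} y" using y by (rule lipschitz_on_vecI)
  obtain Cz where Cz: "Cz-lipschitz_on {0..T} z" using z by (auto simp: Lip_def)
  have lip: "\<exists>C. C-lipschitz_on {0..T} (\<lambda>t. (x t, y t, z t))"
    using lipschitz_on_Pair[OF Cx lipschitz_on_Pair[OF Cy Cz]] by blast
  have adm: "admissible (U_of \<Omega> \<mu>) T x y z"
    unfolding admissible_def
  proof (intro conjI T lip init)
    show "AE t in lborel. t \<in> {0<..<T} \<longrightarrow> (\<exists>x' y' z'. (x has_vector_derivative x') (at t) \<and>
        (y has_vector_derivative y') (at t) \<and> (z has_real_derivative z') (at t) \<and> (x', y') \<in> U_of \<Omega> \<mu> \<and>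
        z' = 1/2 * (\<Sum>i\<in>UNIV. x t $ i * y' $ i - x' $ i * y t $ i))"
      using ae
    proof eventually_elim
      case (elim t)
      show ?case
      proof
        assume "t \<in> {0<..<T}"
        then obtain u v where "horizontal_velocity x y z t u v" "gauges u v \<in> subdiff_Xi \<mu> A"
          using elim unfolding maximizing_velocity_def by blast
        then show "\<exists>x' y' z'. (x has_vector_derivative x') (at t) \<and>
          (y has_vector_derivative y') (at t) \<and> (z has_real_derivative z') (at t) \<and> (x', y') \<in> U_of \<Omega> \<mu> \<and>
          z' = 1/2 * (\<Sum>i\<in>UNIV. x t $ i * y' $ i - x' $ i * y t $ i)"
          unfolding horizontal_velocity_def has_vector_derivative_vec_iff U_iff subdiff_iff by blast
      qed
    qed
  qed
  \<comment> \<open>These integrate the adjoint equations. They carry half of the terms with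
    \<open>c\<close>; the other half enters through the Hamiltonian.\<close>
  define px where "px = (\<lambda>t. a - (c/2) *\<^sub>R y t)"
  define py where "py = (\<lambda>t. b + (c/2) *\<^sub>R x t)"
  have p_comb: "px t - (c/2) *\<^sub>R y t = a - c *\<^sub>R y t" "py t + (c/2) *\<^sub>R x t = b + c *\<^sub>R x t" for t
    by (simp_all add: px_def py_def vec_eq_iff)
  have "Lip 0 T (\<lambda>t. px t $ i)" "Lip 0 T (\<lambda>t. py t $ i)" for i
  proof -
    have "(\<lambda>t. px t $ i) = (\<lambda>t. a $ i - (c/2) * y t $ i)" "(\<lambda>t. py t $ i) = (\<lambda>t. b $ i + (c/2) * x t $ i)"
      by (simp_all add: px_def py_def)
    then show "Lip 0 T (\<lambda>t. px t $ i)" "Lip 0 T (\<lambda>t. py t $ i)"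
      using x y by (simp_all only: Lip_add Lip_diff Lip_const Lip_cmult)
  qed
  then obtain D E where "D-lipschitz_on {0..T} px" "E-lipschitz_on {0..T} py"
    using lipschitz_on_vecI by metis
  then have ac: "abs_cont_on 0 T px" "abs_cont_on 0 T py"
    by (auto intro: lipschitz_imp_abs_cont_on)
  have acz: "abs_cont_on 0 T (\<lambda>t. c)"
    by (rule lipschitz_imp_abs_cont_on[of 0]) (rule lipschitz_on_constant)
  have nz: "(px t, py t, c) \<noteq> 0" if "t \<in> {0..T}" for t
  proof
    assume "(px t, py t, c) = 0"
    then have "c = 0" "a = 0" "b = 0" by (auto simp: zero_prod_def px_def py_def)
    then have "A = 0" using A[of 0] T
      by (auto simp: polar_gauges_def vec_eq_iff conv_body.gauge_zero[OF polar_body, unfolded zero_prod_def])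
    then show False using ne \<open>c = 0\<close> by simp
  qed
  show ?thesis
    unfolding extremal_def
  proof (rule conjI[OF adm], rule exI[of _ px], rule exI[of _ py], rule exI[of _ "\<lambda>t. c"],
      rule exI[of _ "supp_Xi \<mu> A"], intro conjI ac acz supp_nonneg ballI)
    show "(px t, py t, c) \<noteq> 0" if "t \<in> {0..T}" for t using nz[OF that] .
    show "(SUP w\<in>U_of \<Omega> \<mu>. hamiltonian (px t) (py t) c (x t) (y t) (fst w) (snd w)) = supp_Xi \<mu> A"
      if "t \<in> {0..T}" for t
      unfolding hamiltonian_eq p_comb pairing_SUP A[OF that] ..
    show "AE t in lborel. t \<in> {0<..<T} \<longrightarrow>
          (\<exists>x' y' px' py' pz'.
             (x has_vector_derivative x') (at t) \<and> (y has_vector_derivative y') (at t) \<and>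
             (px has_vector_derivative px') (at t) \<and> (py has_vector_derivative py') (at t) \<and>
             ((\<lambda>t. c) has_real_derivative pz') (at t) \<and>
             px' = - ((c / 2) *\<^sub>R y') \<and> py' = (c / 2) *\<^sub>R x' \<and> pz' = 0 \<and>
             hamiltonian (px t) (py t) c (x t) (y t) x' y' = supp_Xi \<mu> A)"
      using ae
    proof eventually_elim
      case (elim t)
      show ?case
      proof
        assume "t \<in> {0<..<T}"
        then obtain u v where vel: "horizontal_velocity x y z t u v"
          and sub: "gauges u v \<in> subdiff_Xi \<mu> A"
          and h: "\<forall>i. (a $ i - c * y t $ i) * u $ i + (b $ i + c * x t $ i) * v $ i = A $ i * gauges u v $ i"
          using elim unfolding maximizing_velocity_def by blast
        have x': "(x has_vector_derivative u) (at t)" and y': "(y has_vector_derivative v) (at t)"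
          using vel by (simp_all add: horizontal_velocity_def has_vector_derivative_vec_iff)
        have px': "(px has_vector_derivative - ((c / 2) *\<^sub>R v)) (at t)"
          unfolding px_def by (auto intro!: derivative_eq_intros y')
        have py': "(py has_vector_derivative (c / 2) *\<^sub>R u) (at t)"
          unfolding py_def by (auto intro!: derivative_eq_intros x')
        have "(a - c *\<^sub>R y t) \<bullet> u + (b + c *\<^sub>R x t) \<bullet> v = A \<bullet> gauges u v"
          unfolding inner_vec_sum sum.distrib[symmetric] using h by (intro sum.cong) auto
        also have "\<dots> = supp_Xi \<mu> A" using sub by (simp add: subdiff_iff)
        finally have "hamiltonian (px t) (py t) c (x t) (y t) u v = supp_Xi \<mu> A"
          unfolding hamiltonian_eq p_comb .
        then show "\<exists>x' y' px' py' pz'.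
             (x has_vector_derivative x') (at t) \<and> (y has_vector_derivative y') (at t) \<and>
             (px has_vector_derivative px') (at t) \<and> (py has_vector_derivative py') (at t) \<and>
             ((\<lambda>t. c) has_real_derivative pz') (at t) \<and>
             px' = - ((c / 2) *\<^sub>R y') \<and> py' = (c / 2) *\<^sub>R x' \<and> pz' = 0 \<and>
             hamiltonian (px t) (py t) c (x t) (y t) x' y' = supp_Xi \<mu> A"
          using x' y' px' py' DERIV_const[of c] by blast
      qed
    qed
  qed
qed

text \<open>At a maximizing velocity \<open>(u, v)\<close> the support function \<open>B\<close> of the body touches the linear function
  given by the maximizer from above, so their derivatives agree; the momentum moves orthogonally to
  \<open>(u, v)\<close>, hence \<open>B' = 0\<close>.\<close>

lemma polar_gauge_deriv_zero:
  fixes x y :: "real \<Rightarrow> real"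
  assumes x: "(x has_real_derivative u) (at t)" and y: "(y has_real_derivative v) (at t)"
    and B: "((\<lambda>t. pgauge i (a - c * y t, b + c * x t)) has_real_derivative d) (at t)"
    and max: "(a - c * y t) * u + (b + c * x t) * v
      = pgauge i (a - c * y t, b + c * x t) * bgauge i (u, v)"
  shows "d = 0"
proof -
  interpret conv_body "\<Omega> i" by (rule body)
  interpret P: conv_body "polar2 (\<Omega> i)" by (rule polar_body)
  define h where "h = (\<lambda>t. (a - c * y t, b + c * x t))"
  \<comment> \<open>A boundary maximizer parallel to the velocity: the normalized velocity itself,
    or, if the velocity is zero, any maximizer.\<close>
  obtain \<zeta> where \<zeta>: "G \<zeta> = 1" "h t \<bullet> \<zeta> = P.G (h t)" and perp: "snd \<zeta> * u = fst \<zeta> * v"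
  proof (cases "(u, v) = 0")
    case True
    obtain \<zeta> where "G \<zeta> = 1" "h t \<bullet> \<zeta> = P.G (h t)" by (rule support_attained)
    then show thesis using True by (intro that[of \<zeta>]) (auto simp: zero_prod_def)
  next
    case False
    define l where "l = G (u, v)"
    have l: "0 < l" unfolding l_def using False by (rule gauge_pos)
    define \<zeta> where "\<zeta> = (1 / l) *\<^sub>R (u, v)"
    have "G \<zeta> = 1" unfolding \<zeta>_def using l by (subst gauge_scale) (auto simp: l_def)
    moreover have "h t \<bullet> \<zeta> = P.G (h t)"
    proof -
      have "h t \<bullet> \<zeta> = (1 / l) * ((a - c * y t) * u + (b + c * x t) * v)"
        by (simp add: \<zeta>_def h_def inner_prod_def algebra_simps add_divide_distrib)
      also have "\<dots> = (1 / l) * (P.G (h t) * l)" by (simp only: max h_def l_def)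
      also have "\<dots> = P.G (h t)" using l by simp
      finally show ?thesis .
    qed
    moreover have "snd \<zeta> * u = fst \<zeta> * v" by (simp add: \<zeta>_def)
    ultimately show thesis by (rule that)
  qed
  define f where "f = (\<lambda>s. P.G (h s) - ((a - c * y s) * fst \<zeta> + (b + c * x s) * snd \<zeta>))"
  have "((\<lambda>s. (a - c * y s) * fst \<zeta> + (b + c * x s) * snd \<zeta>) has_real_derivative
      (- (c * v)) * fst \<zeta> + (c * u) * snd \<zeta>) (at t)"
    by (auto intro!: derivative_eq_intros x y)
  from DERIV_diff[OF B this]
  have f_d: "(f has_real_derivative d - ((- (c * v)) * fst \<zeta> + (c * u) * snd \<zeta>)) (at t)"
    by (simp add: f_def h_def)
  have "f t \<le> f s" for s
  proof -
    have "h s \<bullet> \<zeta> \<le> P.G (h s)" using inner_le_gauges[of "h s" \<zeta>] \<zeta>(1) by simp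
    then have "0 \<le> f s" by (simp add: f_def h_def inner_prod_def)
    moreover have "f t = 0" using \<zeta>(2) by (simp add: f_def h_def inner_prod_def)
    ultimately show ?thesis by simp
  qed
  then have "d - ((- (c * v)) * fst \<zeta> + (c * u) * snd \<zeta>) = 0"
    using DERIV_local_min[OF f_d, of 1] by simp
  moreover have "(- (c * v)) * fst \<zeta> + (c * u) * snd \<zeta> = c * (snd \<zeta> * u - fst \<zeta> * v)" by algebra
  ultimately show ?thesis using perp by simp
qed

text \<open>The adjoint equations are linear in the velocities and \<open>pz\<close> is constant, so
  they integrate explicitly and leave the initial covector as the only data. The maximum condition
  then splits into planes by \<open>pairing_max\<close>, and it remains to freeze the polar
  gauges.\<close>

lemma extremal_imp_pmp_data:
  assumes ext: "extremal (U_of \<Omega> \<mu>) T x y z"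
  obtains a b c A where "pmp_data T x y z a b c A"
proof -
  have adm: "admissible (U_of \<Omega> \<mu>) T x y z" using ext by (simp add: extremal_def)
  obtain px py pz M where ac: "abs_cont_on 0 T px" "abs_cont_on 0 T py" "abs_cont_on 0 T pz"
    and nz: "\<And>t. t \<in> {0..T} \<Longrightarrow> (px t, py t, pz t) \<noteq> 0"
    and ae1: "AE t in lborel. t \<in> {0<..<T} \<longrightarrow>
          (\<exists>x' y' px' py' pz'.
             (x has_vector_derivative x') (at t) \<and> (y has_vector_derivative y') (at t) \<and>
             (px has_vector_derivative px') (at t) \<and> (py has_vector_derivative py') (at t) \<and>
             (pz has_real_derivative pz') (at t) \<and>
             px' = - ((pz t / 2) *\<^sub>R y') \<and> py' = (pz t / 2) *\<^sub>R x' \<and> pz' = 0 \<and>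
             hamiltonian (px t) (py t) (pz t) (x t) (y t) x' y' = M)"
    and sup: "\<And>t. t \<in> {0..T} \<Longrightarrow>
      (SUP w\<in>U_of \<Omega> \<mu>. hamiltonian (px t) (py t) (pz t) (x t) (y t) (fst w) (snd w)) = M"
    using ext unfolding extremal_def by blast
  have T: "0 < T" and init: "x 0 = 0" "y 0 = 0" "z 0 = 0"
    and ae2: "AE t in lborel. t \<in> {0<..<T} \<longrightarrow> (\<exists>x' y' z'. (x has_vector_derivative x') (at t) \<and>
        (y has_vector_derivative y') (at t) \<and> (z has_real_derivative z') (at t) \<and> (x', y') \<in> U_of \<Omega> \<mu> \<and>
        z' = 1/2 * (\<Sum>i\<in>UNIV. x t $ i * y' $ i - x' $ i * y t $ i))"
    using adm unfolding admissible_def by blast+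
  obtain C where C: "C-lipschitz_on {0..T} (\<lambda>t. (x t, y t, z t))"
    using adm unfolding admissible_def by blast
  have lip_fst: "C-lipschitz_on {0..T} x" and lip2: "C-lipschitz_on {0..T} (\<lambda>t. (y t, z t))"
    by (rule lipschitz_on_fst[OF C], rule lipschitz_on_snd[OF C])
  have lip_y: "C-lipschitz_on {0..T} y" and lip_z: "C-lipschitz_on {0..T} z"
    by (rule lipschitz_on_fst[OF lip2], rule lipschitz_on_snd[OF lip2])
  have xL: "Lip 0 T (\<lambda>t. x t $ i)" and yL: "Lip 0 T (\<lambda>t. y t $ i)" for i
    by (rule Lip_vec_nth[OF lip_fst], rule Lip_vec_nth[OF lip_y])
  have zL: "Lip 0 T z" using lip_z by (rule Lip_I)
  have ae: "AE t in lborel. t \<in> {0<..<T} \<longrightarrow> (\<exists>u v.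
        horizontal_velocity x y z t u v \<and>
        (u, v) \<in> U_of \<Omega> \<mu> \<and> hamiltonian (px t) (py t) (pz t) (x t) (y t) u v = M \<and>
        (\<forall>i. ((\<lambda>t. px t $ i) has_real_derivative - (pz t / 2 * v $ i)) (at t)) \<and>
        (\<forall>i. ((\<lambda>t. py t $ i) has_real_derivative pz t / 2 * u $ i) (at t)) \<and>
        (pz has_real_derivative 0) (at t))"
    using ae1 ae2
  proof eventually_elim
    case (elim t)
    show ?case
    proof
      assume t: "t \<in> {0<..<T}"
      obtain u v where u: "(x has_vector_derivative u) (at t)" and v: "(y has_vector_derivative v) (at t)"
        and p: "(px has_vector_derivative - ((pz t / 2) *\<^sub>R v)) (at t)"
          "(py has_vector_derivative (pz t / 2) *\<^sub>R u) (at t)" "(pz has_real_derivative 0) (at t)"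
        and h: "hamiltonian (px t) (py t) (pz t) (x t) (y t) u v = M"
        using elim(1) t by blast
      obtain u' v' where u': "(x has_vector_derivative u') (at t)" and v': "(y has_vector_derivative v') (at t)"
        and z': "(z has_real_derivative 1/2 * (\<Sum>i\<in>UNIV. x t $ i * v' $ i - u' $ i * y t $ i)) (at t)"
          "(u', v') \<in> U_of \<Omega> \<mu>"
        using elim(2) t by blast
      \<comment> \<open>Admissibility and the adjoint system each come with their own derivatives of
        the same curve; uniqueness identifies them.\<close>
      have eq: "u' = u" "v' = v"
        by (rule vector_derivative_unique_at[OF u' u], rule vector_derivative_unique_at[OF v' v])
      have "horizontal_velocity x y z t u v"
        using u v z'(1) unfolding horizontal_velocity_def has_vector_derivative_vec_iff eq by blast
      moreover have "(u, v) \<in> U_of \<Omega> \<mu>" using z'(2) unfolding eq .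
      moreover have "\<forall>i. ((\<lambda>t. px t $ i) has_real_derivative - (pz t / 2 * v $ i)) (at t)"
        "\<forall>i. ((\<lambda>t. py t $ i) has_real_derivative pz t / 2 * u $ i) (at t)"
        using p by (simp_all add: has_vector_derivative_vec_iff)
      ultimately show "\<exists>u v.
        horizontal_velocity x y z t u v \<and>
        (u, v) \<in> U_of \<Omega> \<mu> \<and> hamiltonian (px t) (py t) (pz t) (x t) (y t) u v = M \<and>
        (\<forall>i. ((\<lambda>t. px t $ i) has_real_derivative - (pz t / 2 * v $ i)) (at t)) \<and>
        (\<forall>i. ((\<lambda>t. py t $ i) has_real_derivative pz t / 2 * u $ i) (at t)) \<and>
        (pz has_real_derivative 0) (at t)"
        using h p(3) by blast
    qed
  qed
  define a where "a = px 0"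
  define b where "b = py 0"
  define c where "c = pz 0"
  have pz: "pz t = c" if "t \<in> {0..T}" for t
    unfolding c_def using ac(3) _ that
  proof (rule abs_cont_on_deriv_zero_const)
    show "AE t in lborel. t \<in> {0<..<T} \<longrightarrow> (pz has_real_derivative 0) (at t)"
      using ae by eventually_elim blast
  qed
  have px: "px t $ i + c / 2 * y t $ i = a $ i" if "t \<in> {0..T}" for t i
  proof -
    have "px t $ i + c / 2 * y t $ i = px 0 $ i + c / 2 * y 0 $ i"
    proof (rule abs_cont_on_deriv_zero_const[OF _ _ that])
      have "abs_cont_on 0 T (\<lambda>t. px t $ i)"
        by (rule abs_cont_on_dominated[OF ac(1)])
           (metis Finite_Cartesian_Product.norm_nth_le vector_minus_component)
      moreover have "abs_cont_on 0 T (\<lambda>t. c / 2 * y t $ i)"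
        using Lip_cmult[OF yL[of i], of "c/2"] unfolding Lip_def by (blast intro: lipschitz_imp_abs_cont_on)
      ultimately show "abs_cont_on 0 T (\<lambda>t. px t $ i + c / 2 * y t $ i)" by (rule abs_cont_on_add)
      show "AE t in lborel. t \<in> {0<..<T} \<longrightarrow> ((\<lambda>t. px t $ i + c / 2 * y t $ i) has_real_derivative 0) (at t)"
        using ae
      proof eventually_elim
        case (elim t)
        show ?case
        proof
          assume t: "t \<in> {0<..<T}"
          then obtain v where "((\<lambda>t. y t $ i) has_real_derivative v) (at t)"
            "((\<lambda>t. px t $ i) has_real_derivative - (pz t / 2 * v)) (at t)"
            using elim unfolding horizontal_velocity_def by blast
          from DERIV_add[OF this(2) DERIV_cmult[OF this(1), of "c/2"]]
          show "((\<lambda>t. px t $ i + c / 2 * y t $ i) has_real_derivative 0) (at t)" using pz[of t] t by simp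
        qed
      qed
    qed
    then show ?thesis using init by (simp add: a_def)
  qed
  have py: "py t $ i + - (c / 2) * x t $ i = b $ i" if "t \<in> {0..T}" for t i
  proof -
    have "py t $ i + - (c / 2) * x t $ i = py 0 $ i + - (c / 2) * x 0 $ i"
    proof (rule abs_cont_on_deriv_zero_const[OF _ _ that])
      have "abs_cont_on 0 T (\<lambda>t. py t $ i)"
        by (rule abs_cont_on_dominated[OF ac(2)])
           (metis Finite_Cartesian_Product.norm_nth_le vector_minus_component)
      moreover have "abs_cont_on 0 T (\<lambda>t. - (c / 2) * x t $ i)"
        using Lip_cmult[OF xL[of i], of "-(c/2)"] unfolding Lip_def by (blast intro: lipschitz_imp_abs_cont_on)
      ultimately show "abs_cont_on 0 T (\<lambda>t. py t $ i + - (c / 2) * x t $ i)" by (rule abs_cont_on_add)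
      show "AE t in lborel. t \<in> {0<..<T} \<longrightarrow> ((\<lambda>t. py t $ i + - (c / 2) * x t $ i) has_real_derivative 0) (at t)"
        using ae
      proof eventually_elim
        case (elim t)
        show ?case
        proof
          assume t: "t \<in> {0<..<T}"
          then obtain u where "((\<lambda>t. x t $ i) has_real_derivative u) (at t)"
            "((\<lambda>t. py t $ i) has_real_derivative pz t / 2 * u) (at t)"
            using elim unfolding horizontal_velocity_def by blast
          from DERIV_add[OF this(2) DERIV_cmult[OF this(1), of "-(c/2)"]]
          show "((\<lambda>t. py t $ i + - (c / 2) * x t $ i) has_real_derivative 0) (at t)" using pz[of t] t by simp
        qed
      qed
    qed
    then show ?thesis using init by (simp add: b_def)
  qed
  have momentum: "px t - (pz t / 2) *\<^sub>R y t = a - c *\<^sub>R y t" "py t + (pz t / 2) *\<^sub>R x t = b + c *\<^sub>R x t"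
    if "t \<in> {0..T}" for t
  proof -
    have "px t $ i - c / 2 * y t $ i = a $ i - c * y t $ i" "py t $ i + c / 2 * x t $ i = b $ i + c * x t $ i" for i
      using px[OF that, of i] py[OF that, of i] by (simp_all add: field_simps)
    then show "px t - (pz t / 2) *\<^sub>R y t = a - c *\<^sub>R y t" "py t + (pz t / 2) *\<^sub>R x t = b + c *\<^sub>R x t"
      using pz[OF that] by (simp_all add: vec_eq_iff)
  qed
  define B where "B = (\<lambda>t. polar_gauges (a - c *\<^sub>R y t) (b + c *\<^sub>R x t))"
  have supB: "supp_Xi \<mu> (B t) = M" if "t \<in> {0..T}" for t
    using sup[OF that] unfolding hamiltonian_eq momentum[OF that] pairing_SUP B_def .
  have ae': "AE t in lborel. t \<in> {0<..<T} \<longrightarrow> (\<exists>u v. maximizing_velocity x y z a b c (B t) t u v)"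
    using ae
  proof eventually_elim
    case (elim t)
    show ?case
    proof
      assume t: "t \<in> {0<..<T}"
      then have tT: "t \<in> {0..T}" by simp
      obtain u v where d: "horizontal_velocity x y z t u v"
        and U: "(u, v) \<in> U_of \<Omega> \<mu>" and h: "hamiltonian (px t) (py t) (pz t) (x t) (y t) u v = M"
        using elim t by blast
      have Bt: "B t = polar_gauges (a - c *\<^sub>R y t) (b + c *\<^sub>R x t)" by (simp add: B_def)
      have eq: "(a - c *\<^sub>R y t) \<bullet> u + (b + c *\<^sub>R x t) \<bullet> v = supp_Xi \<mu> (B t)"
        using h unfolding hamiltonian_eq momentum[OF tT] supB[OF tT] .
      have "gauges u v \<in> subdiff_Xi \<mu> (B t)"
        unfolding Bt by (rule pairing_max(1)[OF U eq[unfolded Bt]])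
      moreover have "\<forall>i. (a $ i - c * y t $ i) * u $ i + (b $ i + c * x t $ i) * v $ i = B t $ i * gauges u v $ i"
        using pairing_max(2)[OF U eq[unfolded Bt]] by (simp add: Bt)
      ultimately
      show "\<exists>u v. maximizing_velocity x y z a b c (B t) t u v"
        using d unfolding maximizing_velocity_def by blast
    qed
  qed
  have Bi: "B t $ i = pgauge i (a $ i - c * y t $ i, b $ i + c * x t $ i)" for t i
    by (simp add: B_def polar_gauges_def)
  \<comment> \<open>Each component is Lipschitz as a gauge of a Lipschitz curve, so it suffices that
    its derivative is zero wherever it exists together with a maximizing velocity.\<close>
  have B_const: "B t = B 0" if t: "t \<in> {0..T}" for t
  proof (rule vec_eq_iff[THEN iffD2], rule allI)
    fix i
    have BL: "Lip 0 T (\<lambda>t. B t $ i)" unfolding Bi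
      by (intro conv_body.Lip_gauge[OF polar_body] Lip_add Lip_diff Lip_const Lip_cmult xL yL)
    show "B t $ i = B 0 $ i"
    proof (rule Lip_eq_if_same_deriv[OF BL Lip_const _ t])
      show "AE t in lborel. t \<in> {0<..<T} \<longrightarrow> (\<exists>d. ((\<lambda>t. B t $ i) has_real_derivative d) (at t) \<and>
          ((\<lambda>t. B 0 $ i) has_real_derivative d) (at t))"
        using ae' Lip_differentiable_AE[OF BL]
      proof eventually_elim
        case (elim t)
        show ?case
        proof
          assume t: "t \<in> {0<..<T}"
          then obtain d where d: "((\<lambda>t. B t $ i) has_real_derivative d) (at t)" using elim by blast
          obtain u v where u: "((\<lambda>t. x t $ i) has_real_derivative u $ i) (at t)"
            "((\<lambda>t. y t $ i) has_real_derivative v $ i) (at t)"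
            "(a $ i - c * y t $ i) * u $ i + (b $ i + c * x t $ i) * v $ i = B t $ i * gauges u v $ i"
            using elim t unfolding maximizing_velocity_def horizontal_velocity_def by blast
          have "d = 0"
            using polar_gauge_deriv_zero[OF u(1,2) d[unfolded Bi]] u(3) by (simp add: Bi gauges_def)
          then show "\<exists>d. ((\<lambda>t. B t $ i) has_real_derivative d) (at t) \<and>
              ((\<lambda>t. B 0 $ i) has_real_derivative d) (at t)" using d by (intro exI[of _ 0]) simp
        qed
      qed
    qed simp
  qed
  \<comment> \<open>Otherwise the covector would vanish at time 0, against the nontriviality
    condition.\<close>
  have "c \<noteq> 0 \<or> B 0 \<noteq> 0"
  proof (rule ccontr)
    assume "\<not> (c \<noteq> 0 \<or> B 0 \<noteq> 0)"
    then have "c = 0" "B 0 = 0" by auto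
    then have "pgauge i (a $ i, b $ i) = 0" for i using Bi[of 0 i] by simp
    then have "(a $ i, b $ i) = 0" for i by (simp add: conv_body.gauge_eq_0_iff[OF polar_body])
    then have "a = 0" "b = 0" by (simp_all add: vec_eq_iff zero_prod_def)
    then show False using nz[of 0] T \<open>c = 0\<close> by (simp add: a_def b_def c_def zero_prod_def)
  qed
  moreover have "AE t in lborel. t \<in> {0<..<T} \<longrightarrow> (\<exists>u v. maximizing_velocity x y z a b c (B 0) t u v)"
    using ae'
  proof eventually_elim
    case (elim t)
    show ?case
    proof
      assume t: "t \<in> {0<..<T}"
      then have "B t = B 0" by (intro B_const) simp
      then show "\<exists>u v. maximizing_velocity x y z a b c (B 0) t u v"
        using elim t by (simp only:)
    qed
  qed
  ultimately have "pmp_data T x y z a b c (B 0)"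
    unfolding pmp_data_def using T xL yL zL init B_const[unfolded B_def] by (simp add: B_def)
  then show thesis by (rule that)
qed

end

section \<open>Measurable multipliers, the vertical coordinate and the convex angle\<close>

lemma AE_Icc_of_Ioo:
  fixes a b :: real
  assumes "AE t in lborel. t \<in> {a<..<b} \<longrightarrow> P t"
  shows "AE t in lborel. t \<in> {a..b} \<longrightarrow> P t"
  using assms AE_lborel_singleton[of a] AE_lborel_singleton[of b]
  by eventually_elim auto

lemma integral_cong_AE_Icc:
  fixes f g :: "real \<Rightarrow> real"
  assumes ae: "AE t in lborel. t \<in> {0..T} \<longrightarrow> f t = g t" and t: "t \<in> {0..T}"
  shows "integral {0..t} f = integral {0..t} g"
proof -
  obtain N where N: "N \<in> null_sets lborel" "\<And>s. s \<notin> N \<Longrightarrow> s \<in> {0..T} \<Longrightarrow> f s = g s"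
    using ae by (auto elim!: AE_E3)
  have "negligible N" using N(1) by (simp add: negligible_iff_null_sets null_sets_completionI)
  then show ?thesis by (rule integral_spike) (use N(2) t in auto)
qed

context sub_finsler
begin

text \<open>In \<open>pmp_data\<close> the maximizing velocities exist separately at each time.
  Integration needs them as Borel functions, which the limits of difference quotients provide, and
  needs a multiplier that is bounded everywhere.\<close>

lemma pmp_data_measurable:
  assumes pmp: "pmp_data T x y z a b c A"
  obtains Dx Dy L :: "'n \<Rightarrow> real \<Rightarrow> real" and R where
    "\<And>i. Dx i \<in> borel_measurable borel" "\<And>i. Dy i \<in> borel_measurable borel"
    "\<And>i. L i \<in> borel_measurable borel" "\<And>i t. \<bar>L i t\<bar> \<le> R"
    "AE t in lborel. t \<in> {0<..<T} \<longrightarrow> horizontal_velocity x y z t (\<chi> i. Dx i t) (\<chi> i. Dy i t) \<and>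
      (\<chi> i. L i t) \<in> subdiff_Xi \<mu> A \<and> (\<forall>i. bgauge i (Dx i t, Dy i t) = L i t) \<and>
      (\<forall>i. (a $ i - c * y t $ i) * Dx i t + (b $ i + c * x t $ i) * Dy i t = A $ i * L i t)"
proof -
  have T: "0 < T" and x: "\<And>i. Lip 0 T (\<lambda>t. x t $ i)" and y: "\<And>i. Lip 0 T (\<lambda>t. y t $ i)"
    and ae: "AE t in lborel. t \<in> {0<..<T} \<longrightarrow> (\<exists>u v. maximizing_velocity x y z a b c A t u v)"
    using pmp unfolding pmp_data_def by blast+
  have "\<exists>D. D \<in> borel_measurable borel \<and> (\<forall>t d. t \<in> {0<..<T} \<longrightarrow> (f has_real_derivative d) (at t) \<longrightarrow> D t = d)"
    if f: "Lip 0 T f" for f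
  proof -
    obtain D where "D \<in> borel_measurable borel"
      "\<And>t d. t \<in> {0<..<T} \<Longrightarrow> (f has_real_derivative d) (at t) \<Longrightarrow> D t = d"
      by (rule measurable_derivative[OF Lip_continuous[OF f] less_imp_le[OF T]]) blast
    then show ?thesis by blast
  qed
  note D = this
  have "\<forall>i. \<exists>D. D \<in> borel_measurable borel \<and>
      (\<forall>t d. t \<in> {0<..<T} \<longrightarrow> ((\<lambda>t. x t $ i) has_real_derivative d) (at t) \<longrightarrow> D t = d)"
    using D[OF x] by blast
  from choice[OF this] obtain Dx where "\<forall>i. Dx i \<in> borel_measurable borel \<and>
      (\<forall>t d. t \<in> {0<..<T} \<longrightarrow> ((\<lambda>t. x t $ i) has_real_derivative d) (at t) \<longrightarrow> Dx i t = d)" ..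
  then have Dx: "\<And>i. Dx i \<in> borel_measurable borel"
    "\<And>i t d. t \<in> {0<..<T} \<Longrightarrow> ((\<lambda>t. x t $ i) has_real_derivative d) (at t) \<Longrightarrow> Dx i t = d"
    by blast+
  have "\<forall>i. \<exists>D. D \<in> borel_measurable borel \<and>
      (\<forall>t d. t \<in> {0<..<T} \<longrightarrow> ((\<lambda>t. y t $ i) has_real_derivative d) (at t) \<longrightarrow> D t = d)"
    using D[OF y] by blast
  from choice[OF this] obtain Dy where "\<forall>i. Dy i \<in> borel_measurable borel \<and>
      (\<forall>t d. t \<in> {0<..<T} \<longrightarrow> ((\<lambda>t. y t $ i) has_real_derivative d) (at t) \<longrightarrow> Dy i t = d)" ..
  then have Dy: "\<And>i. Dy i \<in> borel_measurable borel"
    "\<And>i t d. t \<in> {0<..<T} \<Longrightarrow> ((\<lambda>t. y t $ i) has_real_derivative d) (at t) \<Longrightarrow> Dy i t = d"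
    by blast+
  obtain R where R: "0 < R" "\<And>l. l \<in> Xi \<mu> \<Longrightarrow> norm l \<le> R" by (rule Xi_bounded) blast
  \<comment> \<open>Almost everywhere the gauge vector lies in \<open>Xi \<mu>\<close>, so the cut
    at \<open>R\<close> is inactive there.\<close>
  define L where "L = (\<lambda>i t. min R (bgauge i (Dx i t, Dy i t)))"
  have L_meas: "L i \<in> borel_measurable borel" for i
  proof -
    note [measurable] = Dx(1) Dy(1) conv_body.gauge_measurable[OF body]
    show ?thesis unfolding L_def by measurable
  qed
  have L_bd: "\<bar>L i t\<bar> \<le> R" for i t
    using R(1) conv_body.gauge_nonneg[OF body, of i "(Dx i t, Dy i t)"] by (auto simp: L_def)
  have L_ae: "AE t in lborel. t \<in> {0<..<T} \<longrightarrow> horizontal_velocity x y z t (\<chi> i. Dx i t) (\<chi> i. Dy i t) \<and>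
      (\<chi> i. L i t) \<in> subdiff_Xi \<mu> A \<and> (\<forall>i. bgauge i (Dx i t, Dy i t) = L i t) \<and>
      (\<forall>i. (a $ i - c * y t $ i) * Dx i t + (b $ i + c * x t $ i) * Dy i t = A $ i * L i t)"
    using ae
  proof eventually_elim
    case (elim t)
    show ?case
    proof
      assume t: "t \<in> {0<..<T}"
      then obtain u v where vel: "horizontal_velocity x y z t u v" and sub: "gauges u v \<in> subdiff_Xi \<mu> A"
        and eq: "\<And>i. (a $ i - c * y t $ i) * u $ i + (b $ i + c * x t $ i) * v $ i = A $ i * gauges u v $ i"
        using elim unfolding maximizing_velocity_def by blast
      have DxDy: "Dx i t = u $ i" "Dy i t = v $ i" for i
        using Dx(2)[OF t, of i] Dy(2)[OF t, of i] vel by (auto simp: horizontal_velocity_def)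
      then have uv: "(\<chi> i. Dx i t) = u" "(\<chi> i. Dy i t) = v" by (simp_all add: vec_eq_iff)
      have "norm (gauges u v) \<le> R" using R(2) sub by (simp add: subdiff_iff)
      then have "gauges u v $ i \<le> R" for i
        using component_le_norm_cart[of "gauges u v" i] by linarith
      then have L: "L i t = gauges u v $ i" for i
        by (simp add: L_def DxDy gauges_def min_absorb2)
      then have "(\<chi> i. L i t) = gauges u v" by (simp add: vec_eq_iff)
      then show "horizontal_velocity x y z t (\<chi> i. Dx i t) (\<chi> i. Dy i t) \<and>
        (\<chi> i. L i t) \<in> subdiff_Xi \<mu> A \<and> (\<forall>i. bgauge i (Dx i t, Dy i t) = L i t) \<and>
        (\<forall>i. (a $ i - c * y t $ i) * Dx i t + (b $ i + c * x t $ i) * Dy i t = A $ i * L i t)"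
        unfolding uv using vel sub eq by (simp add: DxDy L gauges_def)
    qed
  qed
  from Dx(1) Dy(1) L_meas L_bd L_ae show thesis by (rule that)
qed

text \<open>Summing the planar maximum conditions writes \<open>supp_Xi \<mu> A\<close> as the
  pairing of the initial momentum with the velocity plus \<open>2 * c\<close> times the derivative
  of \<open>z\<close>. Every term is a derivative in time.\<close>

lemma pmp_data_z:
  assumes pmp: "pmp_data T x y z a b c A" and t: "t \<in> {0..T}"
  shows "2 * c * z t = supp_Xi \<mu> A * t - (\<Sum>i\<in>UNIV. a $ i * x t $ i + b $ i * y t $ i)"
proof -
  have x: "\<And>i. Lip 0 T (\<lambda>t. x t $ i)" and y: "\<And>i. Lip 0 T (\<lambda>t. y t $ i)" and z: "Lip 0 T z"
    and init: "x 0 = 0" "y 0 = 0" "z 0 = 0"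
    and ae: "AE t in lborel. t \<in> {0<..<T} \<longrightarrow> (\<exists>u v. maximizing_velocity x y z a b c A t u v)"
    using pmp unfolding pmp_data_def by blast+
  show ?thesis
  proof (rule Lip_eq_if_same_deriv[OF _ _ _ t])
    show "Lip 0 T (\<lambda>t. 2 * c * z t)" by (intro Lip_cmult z)
    show "Lip 0 T (\<lambda>t. supp_Xi \<mu> A * t - (\<Sum>i\<in>UNIV. a $ i * x t $ i + b $ i * y t $ i))"
      by (intro Lip_diff Lip_cmult Lip_ident Lip_sum Lip_add x y) simp
    show "2 * c * z 0 = supp_Xi \<mu> A * 0 - (\<Sum>i\<in>UNIV. a $ i * x 0 $ i + b $ i * y 0 $ i)"
      by (simp add: init)
    show "AE t in lborel. t \<in> {0<..<T} \<longrightarrow> (\<exists>d. ((\<lambda>t. 2 * c * z t) has_real_derivative d) (at t) \<and>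
        ((\<lambda>t. supp_Xi \<mu> A * t - (\<Sum>i\<in>UNIV. a $ i * x t $ i + b $ i * y t $ i)) has_real_derivative d) (at t))"
      using ae
    proof eventually_elim
      case (elim t)
      show ?case
      proof
        assume t: "t \<in> {0<..<T}"
        then obtain u v where vel: "horizontal_velocity x y z t u v" and sub: "gauges u v \<in> subdiff_Xi \<mu> A"
          and eq: "\<And>i. (a $ i - c * y t $ i) * u $ i + (b $ i + c * x t $ i) * v $ i = A $ i * gauges u v $ i"
          using elim unfolding maximizing_velocity_def by blast
        let ?z' = "1/2 * (\<Sum>i\<in>UNIV. x t $ i * v $ i - u $ i * y t $ i)"
        have d: "\<And>i. ((\<lambda>t. x t $ i) has_real_derivative u $ i) (at t)"
          "\<And>i. ((\<lambda>t. y t $ i) has_real_derivative v $ i) (at t)" "(z has_real_derivative ?z') (at t)"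
          using vel by (auto simp: horizontal_velocity_def)
        have "supp_Xi \<mu> A = (\<Sum>i\<in>UNIV. A $ i * gauges u v $ i)"
          using sub by (simp add: subdiff_iff inner_vec_sum)
        also have "\<dots> = (\<Sum>i\<in>UNIV. (a $ i * u $ i + b $ i * v $ i) + c * (x t $ i * v $ i - u $ i * y t $ i))"
          unfolding eq[symmetric] by (intro sum.cong) (auto simp: algebra_simps)
        also have "\<dots> = (\<Sum>i\<in>UNIV. a $ i * u $ i + b $ i * v $ i) + c * (\<Sum>i\<in>UNIV. x t $ i * v $ i - u $ i * y t $ i)"
          by (simp add: sum.distrib sum_distrib_left)
        finally have key: "2 * c * ?z' = supp_Xi \<mu> A * 1 - (\<Sum>i\<in>UNIV. a $ i * u $ i + b $ i * v $ i)" by simp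
        have "((\<lambda>t. 2 * c * z t) has_real_derivative 2 * c * ?z') (at t)"
          by (rule DERIV_cmult[OF d(3)])
        moreover have "((\<lambda>t. supp_Xi \<mu> A * t - (\<Sum>i\<in>UNIV. a $ i * x t $ i + b $ i * y t $ i)) has_real_derivative
            supp_Xi \<mu> A * 1 - (\<Sum>i\<in>UNIV. a $ i * u $ i + b $ i * v $ i)) (at t)"
          by (intro DERIV_diff DERIV_cmult DERIV_ident DERIV_sum DERIV_add d)
        ultimately show "\<exists>d. ((\<lambda>t. 2 * c * z t) has_real_derivative d) (at t) \<and>
          ((\<lambda>t. supp_Xi \<mu> A * t - (\<Sum>i\<in>UNIV. a $ i * x t $ i + b $ i * y t $ i)) has_real_derivative d) (at t)"
          unfolding key by blast
      qed
    qed
  qed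
qed

text \<open>The source of the initial angles: the convex angle, with respect to the polar body, of
  the momentum at time 0.\<close>

definition polar_arg :: "real^'n \<Rightarrow> real^'n \<Rightarrow> 'n \<Rightarrow> real" where
  "polar_arg a b i = conv_body.cv_arg (polar2 (\<Omega> i)) (a $ i, b $ i)"

lemma polar_arg:
  "polar_gauges a b $ i * pcos i (polar_arg a b i) = a $ i"
  "polar_gauges a b $ i * psin i (polar_arg a b i) = b $ i"
  using conv_body.gauge_cv_arg[OF polar_body, of i "(a $ i, b $ i)"]
  by (simp_all add: polar_arg_def polar_gauges_def cv_def)

text \<open>The momentum has derivative \<open>c\<close> times \<open>(- v, u)\<close>, so its cross
  product with that derivative is \<open>c\<close> times its pairing with \<open>(u, v)\<close>,
  that is \<open>c * (A $ i * L t)\<close>. Normalizing the momentum divides this by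
  \<open>A $ i\<close> twice, which is the rate required by \<open>cv_lift\<close>.\<close>

lemma pmp_data_lift:
  assumes pmp: "pmp_data T x y z a b c A" and Ai: "0 < A $ i" and t: "t \<in> {0..T}"
    and L: "L \<in> borel_measurable borel" "\<And>t. \<bar>L t\<bar> \<le> R"
    and ae: "AE t in lborel. t \<in> {0<..<T} \<longrightarrow> (\<exists>u v. ((\<lambda>t. x t $ i) has_real_derivative u) (at t) \<and>
      ((\<lambda>t. y t $ i) has_real_derivative v) (at t) \<and>
      (a $ i - c * y t $ i) * u + (b $ i + c * x t $ i) * v = A $ i * L t)"
  defines "\<theta> \<equiv> polar_arg a b i + c / A $ i * integral {0..t} L"
  shows "a $ i - c * y t $ i = A $ i * pcos i \<theta>"
    and "b $ i + c * x t $ i = A $ i * psin i \<theta>"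
proof -
  interpret P: conv_body "polar2 (\<Omega> i)" by (rule polar_body)
  have T: "0 < T" and x: "Lip 0 T (\<lambda>t. x t $ i)" and y: "Lip 0 T (\<lambda>t. y t $ i)"
    and init: "x 0 = 0" "y 0 = 0"
    and A: "\<And>t. t \<in> {0..T} \<Longrightarrow> polar_gauges (a - c *\<^sub>R y t) (b + c *\<^sub>R x t) = A"
    using pmp unfolding pmp_data_def by blast+
  define gx where "gx = (\<lambda>t. (1 / A $ i) * (a $ i - c * y t $ i))"
  define gy where "gy = (\<lambda>t. (1 / A $ i) * (b $ i + c * x t $ i))"
  have "(gx t, gy t) = cv (polar2 (\<Omega> i)) (polar_arg a b i + integral {0..t} (\<lambda>t. c / A $ i * L t))"
  proof (rule P.cv_lift)
    show "Lip 0 T gx" "Lip 0 T gy" unfolding gx_def gy_def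
      by (intro Lip_cmult Lip_add Lip_diff Lip_const x y)+
    show "P.G (gx t, gy t) = 1" if "t \<in> {0..T}" for t
    proof -
      have "P.G (a $ i - c * y t $ i, b $ i + c * x t $ i) = A $ i"
        using arg_cong[OF A[OF that], of "\<lambda>B. B $ i"] by (simp add: polar_gauges_def)
      moreover have gxy: "(gx t, gy t) = (1 / A $ i) *\<^sub>R (a $ i - c * y t $ i, b $ i + c * x t $ i)"
        by (simp add: gx_def gy_def)
      ultimately show ?thesis unfolding gxy using Ai by (subst P.gauge_scale) simp_all
    qed
    show "(\<lambda>t. c / A $ i * L t) \<in> borel_measurable borel" using L(1) by measurable
    show "\<bar>c / A $ i * L t\<bar> \<le> \<bar>c / A $ i\<bar> * R" for t
      unfolding abs_mult by (intro mult_left_mono L(2)) simp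
    show "(gx 0, gy 0) = cv (polar2 (\<Omega> i)) (polar_arg a b i)"
      using polar_arg[of a b i] A[of 0] T Ai by (auto simp: gx_def gy_def init cv_def field_simps)
    show "AE t in lborel. t \<in> {0<..<T} \<longrightarrow> (\<exists>x' y'. (gx has_real_derivative x') (at t) \<and>
        (gy has_real_derivative y') (at t) \<and> gx t * y' - gy t * x' = c / A $ i * L t)"
      using ae
    proof eventually_elim
      case (elim t)
      show ?case
      proof
        assume "t \<in> {0<..<T}"
        then obtain u v where u: "((\<lambda>t. x t $ i) has_real_derivative u) (at t)"
          and v: "((\<lambda>t. y t $ i) has_real_derivative v) (at t)"
          and eq: "(a $ i - c * y t $ i) * u + (b $ i + c * x t $ i) * v = A $ i * L t" using elim by blast
        have "(gx has_real_derivative (1 / A $ i) * (0 - c * v)) (at t)"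
          unfolding gx_def by (intro DERIV_cmult DERIV_diff DERIV_const v)
        moreover have "(gy has_real_derivative (1 / A $ i) * (0 + c * u)) (at t)"
          unfolding gy_def by (intro DERIV_cmult DERIV_add DERIV_const u)
        moreover have "gx t * ((1 / A $ i) * (0 + c * u)) - gy t * ((1 / A $ i) * (0 - c * v)) = c / A $ i * L t"
        proof -
          have "gx t * ((1 / A $ i) * (0 + c * u)) - gy t * ((1 / A $ i) * (0 - c * v))
            = (1 / A $ i) * (1 / A $ i) * c * ((a $ i - c * y t $ i) * u + (b $ i + c * x t $ i) * v)"
            unfolding gx_def gy_def by algebra
          also have "\<dots> = c / A $ i * L t" unfolding eq using Ai by simp
          finally show ?thesis .
        qed
        ultimately show "\<exists>x' y'. (gx has_real_derivative x') (at t) \<and>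
          (gy has_real_derivative y') (at t) \<and> gx t * y' - gy t * x' = c / A $ i * L t"
          by blast
      qed
    qed
  qed (use T t in auto)
  then have "(gx t, gy t) = cv (polar2 (\<Omega> i)) \<theta>" by (simp add: \<theta>_def)
  then show "a $ i - c * y t $ i = A $ i * pcos i \<theta>"
    "b $ i + c * x t $ i = A $ i * psin i \<theta>"
    using Ai by (auto simp: cv_def gx_def gy_def field_simps)
qed

definition spiral_form :: "real \<Rightarrow> (real \<Rightarrow> real^'n) \<Rightarrow> (real \<Rightarrow> real^'n) \<Rightarrow> (real \<Rightarrow> real) \<Rightarrow>
    real \<Rightarrow> real^'n \<Rightarrow> ('n \<Rightarrow> real) \<Rightarrow> ('n \<Rightarrow> real \<Rightarrow> real) \<Rightarrow> bool" where
  "spiral_form T x y z \<gamma> A \<theta>0 th \<longleftrightarrow> (\<forall>t\<in>{0..T}.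
     (\<forall>i. 0 < A $ i \<longrightarrow> x t $ i = \<gamma> * A $ i * (psin i (th i t) - psin i (\<theta>0 i)) \<and>
        y t $ i = \<gamma> * A $ i * (pcos i (\<theta>0 i) - pcos i (th i t))) \<and>
     (\<forall>i. A $ i = 0 \<longrightarrow> x t $ i = 0 \<and> y t $ i = 0) \<and>
     2 * z t = \<gamma> * supp_Xi \<mu> A * t + (\<Sum>i\<in>{i. 0 < A $ i}. (A $ i)\<^sup>2 *
       (psin i (\<theta>0 i) * pcos i (th i t) - pcos i (\<theta>0 i) * psin i (th i t))))"

text \<open>The integrands are left general so that bounded Borel representatives can replace the
  given ones on a null set.\<close>

definition primitive_curve :: "real \<Rightarrow> (real \<Rightarrow> real^'n) \<Rightarrow> (real \<Rightarrow> real^'n) \<Rightarrow> (real \<Rightarrow> real) \<Rightarrow>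
    ('n \<Rightarrow> real \<Rightarrow> real) \<Rightarrow> ('n \<Rightarrow> real \<Rightarrow> real) \<Rightarrow> bool" where
  "primitive_curve T x y z p q \<longleftrightarrow> (\<forall>t\<in>{0..T}.
     (\<forall>i. x t $ i = integral {0..t} (p i) \<and> y t $ i = integral {0..t} (q i)) \<and>
     z t = 1/2 * integral {0..t} (\<lambda>\<tau>. \<Sum>i\<in>UNIV. x \<tau> $ i * q i \<tau> - p i \<tau> * y \<tau> $ i))"

lemma extremal_form_iff:
  "extremal_form \<Omega> \<mu> T x y z \<longleftrightarrow> (\<exists>\<gamma> A \<theta>0 lam.
     \<gamma> \<in> {0, 1, -1} \<and> (\<forall>i. 0 \<le> A $ i) \<and> \<not> (\<gamma> = 0 \<and> A = 0) \<and> lam \<in> borel_measurable lborel \<and>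
     (AE t in lborel. t \<in> {0..T} \<longrightarrow> lam t \<in> subdiff_Xi \<mu> A) \<and>
     (\<gamma> \<noteq> 0 \<longrightarrow> (\<forall>i. A $ i = 0 \<longrightarrow> (\<forall>t\<in>{0..T}. lam t $ i = 0))) \<and>
     (\<gamma> \<noteq> 0 \<longrightarrow> spiral_form T x y z \<gamma> A \<theta>0
        (\<lambda>i t. \<theta>0 i + \<gamma> / A $ i * integral {0..t} (\<lambda>\<tau>. lam \<tau> $ i))) \<and>
     (\<gamma> = 0 \<longrightarrow> (\<exists>th. (\<forall>i. th i \<in> borel_measurable lborel) \<and>
        (\<forall>i. 0 < A $ i \<longrightarrow> (AE t in lborel. t \<in> {0..T} \<longrightarrow> corresp (\<Omega> i) (th i t) (\<theta>0 i))) \<and>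
        primitive_curve T x y z (\<lambda>i \<tau>. lam \<tau> $ i * bcos i (th i \<tau>)) (\<lambda>i \<tau>. lam \<tau> $ i * bsin i (th i \<tau>)))))"
  unfolding extremal_form_def spiral_form_def primitive_curve_def Let_def by (rule refl)

lemma primitive_curve_imp:
  assumes curve: "primitive_curve T x y z p q" and T: "0 < T"
    and meas: "\<And>i. p i \<in> borel_measurable borel" "\<And>i. q i \<in> borel_measurable borel"
    and bd: "\<And>i t. \<bar>p i t\<bar> \<le> C i" "\<And>i t. \<bar>q i t\<bar> \<le> C i"
  shows "Lip 0 T (\<lambda>t. x t $ i)" "Lip 0 T (\<lambda>t. y t $ i)" "Lip 0 T z" "x 0 = 0" "y 0 = 0" "z 0 = 0"
    and "AE t in lborel. t \<in> {0<..<T} \<longrightarrow> horizontal_velocity x y z t (\<chi> i. p i t) (\<chi> i. q i t)"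
proof -
  have x: "x t $ i = integral {0..t} (p i)" and y: "y t $ i = integral {0..t} (q i)" if "t \<in> {0..T}" for t i
    using curve that by (simp_all add: primitive_curve_def)
  show xL: "Lip 0 T (\<lambda>t. x t $ i)" and yL: "Lip 0 T (\<lambda>t. y t $ i)" for i
    by (rule Lip_cong[OF Lip_integral[OF meas(1) bd(1)] x], assumption,
        rule Lip_cong[OF Lip_integral[OF meas(2) bd(2)] y], assumption)
  define cl where "cl = (\<lambda>t. max 0 (min T t))"
  have cl: "cl t \<in> {0..T}" "t \<in> {0..T} \<Longrightarrow> cl t = t" for t using T by (auto simp: cl_def)
  have cl_cont: "continuous_on UNIV cl" unfolding cl_def by (intro continuous_intros)
  \<comment> \<open>The integrand of \<open>z\<close> with the coordinates frozen outside
    \<open>{0..T}\<close>, so that it is Borel and bounded on the whole line.\<close>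
  define W where "W = (\<lambda>\<tau>. \<Sum>i\<in>UNIV. x (cl \<tau>) $ i * q i \<tau> - p i \<tau> * y (cl \<tau>) $ i)"
  have W_meas: "W \<in> borel_measurable borel"
  proof -
    have [measurable]: "(\<lambda>t. x (cl t) $ i) \<in> borel_measurable borel" "(\<lambda>t. y (cl t) $ i) \<in> borel_measurable borel" for i
      by (intro borel_measurable_continuous_onI continuous_on_compose2[OF Lip_continuous[OF xL] cl_cont]
          continuous_on_compose2[OF Lip_continuous[OF yL] cl_cont]; use cl in auto)+
    note [measurable] = meas
    show ?thesis unfolding W_def by measurable
  qed
  have "\<exists>B. \<forall>t\<in>{0..T}. \<bar>x t $ i\<bar> \<le> B" "\<exists>B. \<forall>t\<in>{0..T}. \<bar>y t $ i\<bar> \<le> B" for i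
    by (rule Lip_bounded[OF xL[of i]], blast, rule Lip_bounded[OF yL[of i]], blast)
  then obtain Bx By where Bx: "\<And>i t. t \<in> {0..T} \<Longrightarrow> \<bar>x t $ i\<bar> \<le> Bx i"
    and By: "\<And>i t. t \<in> {0..T} \<Longrightarrow> \<bar>y t $ i\<bar> \<le> By i" by metis
  have W_bd: "\<bar>W t\<bar> \<le> (\<Sum>i\<in>UNIV. Bx i * C i + C i * By i)" for t
  proof -
    have "\<bar>W t\<bar> \<le> (\<Sum>i\<in>UNIV. \<bar>x (cl t) $ i * q i t - p i t * y (cl t) $ i\<bar>)"
      unfolding W_def by (rule sum_abs)
    also have "\<dots> \<le> (\<Sum>i\<in>UNIV. Bx i * C i + C i * By i)"
    proof (rule sum_mono)
      fix i
      have "\<bar>x (cl t) $ i * q i t\<bar> \<le> Bx i * C i"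
        unfolding abs_mult using Bx[OF cl(1)[of t], of i] bd(2)[of i t]
        by (intro mult_mono) (auto intro: order_trans[OF abs_ge_zero])
      moreover have "\<bar>p i t * y (cl t) $ i\<bar> \<le> C i * By i"
        unfolding abs_mult using By[OF cl(1)[of t], of i] bd(1)[of i t]
        by (intro mult_mono) (auto intro: order_trans[OF abs_ge_zero])
      ultimately show "\<bar>x (cl t) $ i * q i t - p i t * y (cl t) $ i\<bar> \<le> Bx i * C i + C i * By i"
        by linarith
    qed
    finally show ?thesis .
  qed
  have z: "z t = 1/2 * integral {0..t} W" if t: "t \<in> {0..T}" for t
  proof -
    have "integral {0..t} (\<lambda>\<tau>. \<Sum>i\<in>UNIV. x \<tau> $ i * q i \<tau> - p i \<tau> * y \<tau> $ i) = integral {0..t} W"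
      by (rule Henstock_Kurzweil_Integration.integral_cong) (use t cl(2) in \<open>auto simp: W_def\<close>)
    then show ?thesis using curve t by (simp add: primitive_curve_def)
  qed
  show "Lip 0 T z" by (rule Lip_cong[OF Lip_cmult[OF Lip_integral[OF W_meas W_bd]] z])
  show "x 0 = 0" "y 0 = 0" "z 0 = 0"
    using x[of 0] y[of 0] z[of 0] T by (simp_all add: vec_eq_iff)
  have "AE t in lborel. \<forall>i. t \<in> {0<..<T} \<longrightarrow> ((\<lambda>t. integral {0..t} (p i)) has_real_derivative p i t) (at t)"
    using integral_deriv_AE[OF meas(1) bd(1)] by (subst AE_all_countable) blast
  moreover have "AE t in lborel. \<forall>i. t \<in> {0<..<T} \<longrightarrow> ((\<lambda>t. integral {0..t} (q i)) has_real_derivative q i t) (at t)"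
    using integral_deriv_AE[OF meas(2) bd(2)] by (subst AE_all_countable) blast
  ultimately show "AE t in lborel. t \<in> {0<..<T} \<longrightarrow> horizontal_velocity x y z t (\<chi> i. p i t) (\<chi> i. q i t)"
    using integral_deriv_AE[OF W_meas W_bd, of 0 T]
  proof eventually_elim
    case (elim t)
    show ?case
    proof
      assume t: "t \<in> {0<..<T}"
      have u: "((\<lambda>t. x t $ i) has_real_derivative p i t) (at t)" for i
        by (rule has_field_derivative_transform_within_open[OF elim(1)[rule_format, OF t] open_greaterThanLessThan t])
          (use x in simp)
      have v: "((\<lambda>t. y t $ i) has_real_derivative q i t) (at t)" for i
        by (rule has_field_derivative_transform_within_open[OF elim(2)[rule_format, OF t] open_greaterThanLessThan t])
          (use y in simp)
      have "(z has_real_derivative 1/2 * W t) (at t)"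
        by (rule has_field_derivative_transform_within_open[OF DERIV_cmult[OF elim(3)[rule_format, OF t]]
              open_greaterThanLessThan t]) (use z in simp)
      then show "horizontal_velocity x y z t (\<chi> i. p i t) (\<chi> i. q i t)"
        using u v cl(2)[of t] t by (simp add: horizontal_velocity_def W_def)
    qed
  qed
qed

text \<open>The curve built from the integrals starts at the same point and has the same derivatives
  almost everywhere. The horizontal coordinates are identified first, since the integrand of
  \<open>z\<close> contains them.\<close>

lemma primitive_curveI:
  assumes T: "0 < T" and L: "\<And>i. Lip 0 T (\<lambda>t. x t $ i)" "\<And>i. Lip 0 T (\<lambda>t. y t $ i)" "Lip 0 T z"
    and init: "x 0 = 0" "y 0 = 0" "z 0 = 0"
    and meas: "\<And>i. p i \<in> borel_measurable borel" "\<And>i. q i \<in> borel_measurable borel"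
    and bd: "\<And>i t. \<bar>p i t\<bar> \<le> C i" "\<And>i t. \<bar>q i t\<bar> \<le> C i"
    and ae: "AE t in lborel. t \<in> {0<..<T} \<longrightarrow> horizontal_velocity x y z t (\<chi> i. p i t) (\<chi> i. q i t)"
  shows "primitive_curve T x y z p q"
proof -
  define X where "X = (\<lambda>t. \<chi> i. integral {0..t} (p i))"
  define Y where "Y = (\<lambda>t. \<chi> i. integral {0..t} (q i))"
  define Z where "Z = (\<lambda>t. 1/2 * integral {0..t} (\<lambda>\<tau>. \<Sum>i\<in>UNIV. X \<tau> $ i * q i \<tau> - p i \<tau> * Y \<tau> $ i))"
  have XYZ: "primitive_curve T X Y Z p q" by (simp add: primitive_curve_def X_def Y_def Z_def)
  note prim = primitive_curve_imp[OF XYZ T meas bd]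
  have x: "x t $ i = X t $ i" if "t \<in> {0..T}" for t i
  proof (rule Lip_eq_if_same_deriv[OF L(1) prim(1) _ that])
    show "AE t in lborel. t \<in> {0<..<T} \<longrightarrow> (\<exists>d. ((\<lambda>t. x t $ i) has_real_derivative d) (at t) \<and>
        ((\<lambda>t. X t $ i) has_real_derivative d) (at t))"
      using ae prim(7) by eventually_elim (auto simp: horizontal_velocity_def)
  qed (simp add: init prim)
  have y: "y t $ i = Y t $ i" if "t \<in> {0..T}" for t i
  proof (rule Lip_eq_if_same_deriv[OF L(2) prim(2) _ that])
    show "AE t in lborel. t \<in> {0<..<T} \<longrightarrow> (\<exists>d. ((\<lambda>t. y t $ i) has_real_derivative d) (at t) \<and>
        ((\<lambda>t. Y t $ i) has_real_derivative d) (at t))"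
      using ae prim(7) by eventually_elim (auto simp: horizontal_velocity_def)
  qed (simp add: init prim)
  have z: "z t = Z t" if "t \<in> {0..T}" for t
  proof (rule Lip_eq_if_same_deriv[OF L(3) prim(3) _ that])
    show "AE t in lborel. t \<in> {0<..<T} \<longrightarrow> (\<exists>d. (z has_real_derivative d) (at t) \<and>
        (Z has_real_derivative d) (at t))"
      using ae prim(7) by eventually_elim (auto simp: horizontal_velocity_def x y)
  qed (simp add: init prim)
  have "integral {0..t} (\<lambda>\<tau>. \<Sum>i\<in>UNIV. X \<tau> $ i * q i \<tau> - p i \<tau> * Y \<tau> $ i) =
      integral {0..t} (\<lambda>\<tau>. \<Sum>i\<in>UNIV. x \<tau> $ i * q i \<tau> - p i \<tau> * y \<tau> $ i)" if "t \<in> {0..T}" for t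
    by (rule Henstock_Kurzweil_Integration.integral_cong) (use that x y in auto)
  then show ?thesis
    unfolding primitive_curve_def using x y z by (simp add: X_def Y_def Z_def)
qed

lemma primitive_curve_cong_AE:
  assumes curve: "primitive_curve T x y z p q"
    and ae: "AE t in lborel. t \<in> {0..T} \<longrightarrow> (\<forall>i. p i t = p' i t \<and> q i t = q' i t)"
  shows "primitive_curve T x y z p' q'"
proof -
  have "integral {0..t} (p i) = integral {0..t} (p' i)" "integral {0..t} (q i) = integral {0..t} (q' i)"
    "integral {0..t} (\<lambda>\<tau>. \<Sum>i\<in>UNIV. x \<tau> $ i * q i \<tau> - p i \<tau> * y \<tau> $ i) =
      integral {0..t} (\<lambda>\<tau>. \<Sum>i\<in>UNIV. x \<tau> $ i * q' i \<tau> - p' i \<tau> * y \<tau> $ i)" if t: "t \<in> {0..T}" for t i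
    by (rule integral_cong_AE_Icc[OF _ t]; use ae in eventually_elim; simp)+
  then show ?thesis using curve by (simp add: primitive_curve_def)
qed

lemma bcos_bsin_bounded:
  obtains C where "\<And>i. 0 < C i" "\<And>i \<theta>. \<bar>bcos i \<theta>\<bar> \<le> C i" "\<And>i \<theta>. \<bar>bsin i \<theta>\<bar> \<le> C i"
proof -
  have "\<exists>C. 0 < C \<and> (\<forall>\<theta>. \<bar>bcos i \<theta>\<bar> \<le> C \<and> \<bar>bsin i \<theta>\<bar> \<le> C)" for i
    by (rule conv_body.cv_bounded[OF body[of i]]) blast
  then show thesis using that by metis
qed

lemma multiplier_times_cv:
  assumes L: "\<And>i. L i \<in> borel_measurable borel" "\<And>i t. \<bar>L i t\<bar> \<le> R"
    and th: "\<And>i. th i \<in> borel_measurable borel"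
  obtains C where
    "\<And>i. (\<lambda>t. L i t * bcos i (th i t)) \<in> borel_measurable borel"
    "\<And>i. (\<lambda>t. L i t * bsin i (th i t)) \<in> borel_measurable borel"
    "\<And>i t. \<bar>L i t * bcos i (th i t)\<bar> \<le> C i" "\<And>i t. \<bar>L i t * bsin i (th i t)\<bar> \<le> C i"
proof -
  obtain C where C: "\<And>i. 0 < C i" "\<And>i \<theta>. \<bar>bcos i \<theta>\<bar> \<le> C i" "\<And>i \<theta>. \<bar>bsin i \<theta>\<bar> \<le> C i"
    by (rule bcos_bsin_bounded) blast
  have R0: "0 \<le> R" using L(2) by (meson abs_ge_zero order_trans)
  note [measurable] = L(1) th conv_body.cv_measurable[OF body]
  show thesis
  proof (rule that)
    show "(\<lambda>t. L i t * bcos i (th i t)) \<in> borel_measurable borel"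
      "(\<lambda>t. L i t * bsin i (th i t)) \<in> borel_measurable borel" for i by measurable
    show "\<bar>L i t * bcos i (th i t)\<bar> \<le> R * C i" "\<bar>L i t * bsin i (th i t)\<bar> \<le> R * C i" for i t
      unfolding abs_mult using L(2) C R0 by (intro mult_mono; simp)+
  qed
qed

end

section \<open>From the maximum principle to the explicit form\<close>

context sub_finsler
begin

lemma pmp_data_imp_form_nonzero:
  assumes pmp: "pmp_data T x y z a b c A" and c: "c \<noteq> 0"
  shows "extremal_form \<Omega> \<mu> T x y z"
proof -
  have T: "0 < T" and init: "x 0 = 0" "y 0 = 0" "z 0 = 0"
    and A: "\<And>t. t \<in> {0..T} \<Longrightarrow> polar_gauges (a - c *\<^sub>R y t) (b + c *\<^sub>R x t) = A"
    using pmp unfolding pmp_data_def by blast+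
  have Ai: "A $ i = pgauge i (a $ i - c * y t $ i, b $ i + c * x t $ i)"
    if "t \<in> {0..T}" for t i
    using arg_cong[OF A[OF that], of "\<lambda>B. B $ i"] by (simp add: polar_gauges_def)
  have A0: "polar_gauges a b = A" using A[of 0] T init by simp
  have A_nonneg: "0 \<le> A $ i" for i
    using conv_body.gauge_nonneg[OF polar_body] by (simp add: A0[symmetric] polar_gauges_def)
  \<comment> \<open>A zero gauge means zero momentum at all times, including 0; as \<open>c\<close>
    is nonzero, this determines the coordinates.\<close>
  have zero: "x t $ i = 0" "y t $ i = 0" "a $ i = 0" "b $ i = 0" if "A $ i = 0" "t \<in> {0..T}" for t i
  proof -
    have "pgauge i (a $ i - c * y t $ i, b $ i + c * x t $ i) = 0"
      using Ai[OF that(2), of i] that(1) by simp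
    then have 1: "a $ i - c * y t $ i = 0" "b $ i + c * x t $ i = 0"
      by (simp_all add: conv_body.gauge_eq_0_iff[OF polar_body] zero_prod_def)
    have "pgauge i (a $ i, b $ i) = 0"
      using Ai[of 0 i] T that(1) init by simp
    then have 2: "a $ i = 0" "b $ i = 0"
      by (simp_all add: conv_body.gauge_eq_0_iff[OF polar_body] zero_prod_def)
    show "x t $ i = 0" "y t $ i = 0" "a $ i = 0" "b $ i = 0" using 1 2 c by simp_all
  qed
  obtain Dx Dy L :: "'n \<Rightarrow> real \<Rightarrow> real" and R where
    Dm: "\<And>i. Dx i \<in> borel_measurable borel" "\<And>i. Dy i \<in> borel_measurable borel"
    and L: "\<And>i. L i \<in> borel_measurable borel" "\<And>i t. \<bar>L i t\<bar> \<le> R"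
    and ae: "AE t in lborel. t \<in> {0<..<T} \<longrightarrow> horizontal_velocity x y z t (\<chi> i. Dx i t) (\<chi> i. Dy i t) \<and>
      (\<chi> i. L i t) \<in> subdiff_Xi \<mu> A \<and> (\<forall>i. bgauge i (Dx i t, Dy i t) = L i t) \<and>
      (\<forall>i. (a $ i - c * y t $ i) * Dx i t + (b $ i + c * x t $ i) * Dy i t = A $ i * L i t)"
    by (rule pmp_data_measurable[OF pmp]) blast
  \<comment> \<open>Normalization of the covector: dividing by the absolute value of
    \<open>c\<close> turns its vertical component into \<gamma> and \<open>A\<close> into
    \<open>A'\<close>, while the quotient in the angle formula becomes
    \<open>c / A $ i\<close>.\<close>
  define \<gamma> where "\<gamma> = sgn c"
  define A' where "A' = (1 / \<bar>c\<bar>) *\<^sub>R A"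
  have \<gamma>: "\<gamma> \<noteq> 0" "\<gamma> \<in> {0, 1, -1}" using c by (auto simp: \<gamma>_def sgn_if)
  have cA: "\<gamma> * A' $ i = A $ i / c" "\<gamma> / A' $ i = c / A $ i" for i
    using c by (auto simp: \<gamma>_def A'_def sgn_if)
  have A'0: "A' $ i = 0 \<longleftrightarrow> A $ i = 0" "0 < A' $ i \<longleftrightarrow> 0 < A $ i" for i
    using c by (auto simp: A'_def zero_less_divide_iff)
  \<comment> \<open>In planes with \<open>A $ i = 0\<close> the explicit form wants the multiplier
    to vanish at every time, so the value is set by hand. The velocity in such a plane is zero, so
    almost everywhere nothing changes.\<close>
  define lam where "lam = (\<lambda>t. \<chi> i. if A $ i = 0 then 0 else L i t)"
  have lam_meas: "lam \<in> borel_measurable lborel"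
  proof -
    have "lam \<in> borel_measurable borel"
      unfolding lam_def using L(1) by (intro borel_measurable_vecI) simp
    then show ?thesis by simp
  qed
  have lam_sub: "AE t in lborel. t \<in> {0..T} \<longrightarrow> lam t \<in> subdiff_Xi \<mu> A'"
  proof (rule AE_Icc_of_Ioo)
    show "AE t in lborel. t \<in> {0<..<T} \<longrightarrow> lam t \<in> subdiff_Xi \<mu> A'"
      using ae
    proof eventually_elim
      case (elim t)
      show ?case
      proof
        assume t: "t \<in> {0<..<T}"
        have "L i t = 0" if "A $ i = 0" for i
        proof -
          have d: "((\<lambda>t. x t $ i) has_real_derivative Dx i t) (at t)" "((\<lambda>t. y t $ i) has_real_derivative Dy i t) (at t)"
            using elim t by (auto simp: horizontal_velocity_def)
          have z0: "((\<lambda>t. 0) has_real_derivative Dx i t) (at t)"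
            by (rule has_field_derivative_transform_within_open[OF d(1) open_greaterThanLessThan t])
              (use zero(1)[OF that] in auto)
          have z1: "((\<lambda>t. 0) has_real_derivative Dy i t) (at t)"
            by (rule has_field_derivative_transform_within_open[OF d(2) open_greaterThanLessThan t])
              (use zero(2)[OF that] in auto)
          have "Dx i t = 0" "Dy i t = 0"
            by (rule DERIV_unique[OF z0 DERIV_const], rule DERIV_unique[OF z1 DERIV_const])
          then have "bgauge i (Dx i t, Dy i t) = 0"
            using conv_body.gauge_zero[OF body[of i]] by (simp add: zero_prod_def)
          then show ?thesis using elim t by simp
        qed
        then have "lam t = (\<chi> i. L i t)" by (auto simp: lam_def vec_eq_iff)
        then have "lam t \<in> subdiff_Xi \<mu> A" using elim t by simp
        \<comment> \<open>A positive factor in front of \<open>A\<close> does not change which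
          points of \<open>Xi \<mu>\<close> are maximizers.\<close>
        then show "lam t \<in> subdiff_Xi \<mu> A'"
          by (simp add: subdiff_iff A'_def supp_scale)
      qed
    qed
  qed
  define th where "th = (\<lambda>i t. polar_arg a b i + \<gamma> / A' $ i * integral {0..t} (\<lambda>\<tau>. lam \<tau> $ i))"
  have lift: "a $ i - c * y t $ i = A $ i * pcos i (th i t)"
    "b $ i + c * x t $ i = A $ i * psin i (th i t)"
    if Apos: "0 < A $ i" and t: "t \<in> {0..T}" for i t
  proof -
    have th: "th i t = polar_arg a b i + c / A $ i * integral {0..t} (L i)"
      using Apos by (simp add: th_def lam_def cA)
    have aei: "AE t in lborel. t \<in> {0<..<T} \<longrightarrow> (\<exists>u v. ((\<lambda>t. x t $ i) has_real_derivative u) (at t) \<and>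
      ((\<lambda>t. y t $ i) has_real_derivative v) (at t) \<and>
      (a $ i - c * y t $ i) * u + (b $ i + c * x t $ i) * v = A $ i * L i t)"
      using ae
    proof eventually_elim
      case (elim t)
      show ?case
      proof
        assume "t \<in> {0<..<T}"
        then have "((\<lambda>t. x t $ i) has_real_derivative Dx i t) (at t)"
          "((\<lambda>t. y t $ i) has_real_derivative Dy i t) (at t)"
          "(a $ i - c * y t $ i) * Dx i t + (b $ i + c * x t $ i) * Dy i t = A $ i * L i t"
          using elim by (simp_all add: horizontal_velocity_def)
        then show "\<exists>u v. ((\<lambda>t. x t $ i) has_real_derivative u) (at t) \<and>
          ((\<lambda>t. y t $ i) has_real_derivative v) (at t) \<and>
          (a $ i - c * y t $ i) * u + (b $ i + c * x t $ i) * v = A $ i * L i t"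
          by blast
      qed
    qed
    show "a $ i - c * y t $ i = A $ i * pcos i (th i t)"
      "b $ i + c * x t $ i = A $ i * psin i (th i t)"
      unfolding th by (rule pmp_data_lift[OF pmp Apos t L aei])+
  qed
  note parg = polar_arg[of a b, unfolded A0]
  let ?\<theta>0 = "polar_arg a b"
  have xy: "x t $ i = \<gamma> * A' $ i * (psin i (th i t) - psin i (?\<theta>0 i))"
    "y t $ i = \<gamma> * A' $ i * (pcos i (?\<theta>0 i) - pcos i (th i t))"
    if Apos: "0 < A' $ i" and t: "t \<in> {0..T}" for i t
  proof -
    have "0 < A $ i" using Apos A'0 by simp
    note l = lift[OF this t]
    show "x t $ i = \<gamma> * A' $ i * (psin i (th i t) - psin i (?\<theta>0 i))"
      "y t $ i = \<gamma> * A' $ i * (pcos i (?\<theta>0 i) - pcos i (th i t))"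
      unfolding cA using l parg[of i] c by (simp_all add: right_diff_distrib field_simps)
  qed
  have zeq: "2 * z t = \<gamma> * supp_Xi \<mu> A' * t + (\<Sum>i\<in>{i. 0 < A' $ i}. (A' $ i)\<^sup>2 *
      (psin i (?\<theta>0 i) * pcos i (th i t) - pcos i (?\<theta>0 i) * psin i (th i t)))"
    if t: "t \<in> {0..T}" for t
  proof -
    define area_term where
      "area_term = (\<lambda>i. (A' $ i)\<^sup>2 * (psin i (?\<theta>0 i) * pcos i (th i t) - pcos i (?\<theta>0 i) * psin i (th i t)))"
    \<comment> \<open>Each area term is a cross product of the initial and the current momentum
      divided by the square of \<open>c\<close>. The quadratic parts cancel and leave the linear
      expression that occurs in \<open>pmp_data_z\<close>.\<close>
    have summand: "area_term i = - (1 / c) * (a $ i * x t $ i + b $ i * y t $ i)" if "0 < A' $ i" for i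
    proof -
      have Apos: "0 < A $ i" using that A'0 by simp
      have sq: "(A' $ i)\<^sup>2 = (1 / c\<^sup>2) * (A $ i * A $ i)"
        by (simp add: A'_def power2_eq_square)
      have "area_term i = (1 / c\<^sup>2) * ((A $ i * psin i (?\<theta>0 i)) * (A $ i * pcos i (th i t)) -
          (A $ i * pcos i (?\<theta>0 i)) * (A $ i * psin i (th i t)))"
        unfolding area_term_def sq by (simp add: algebra_simps)
      also have "\<dots> = (1 / c\<^sup>2) * (b $ i * (a $ i - c * y t $ i) - a $ i * (b $ i + c * x t $ i))"
        unfolding parg lift[OF Apos t] ..
      also have "\<dots> = - (1 / c) * (a $ i * x t $ i + b $ i * y t $ i)"
        using c by (simp add: power2_eq_square field_simps)
      finally show ?thesis .
    qed
    have "sum area_term {i. 0 < A' $ i} = (\<Sum>i\<in>{i. 0 < A' $ i}. - (1 / c) * (a $ i * x t $ i + b $ i * y t $ i))"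
      by (intro sum.cong refl summand) simp
    also have "\<dots> = (\<Sum>i\<in>UNIV. - (1 / c) * (a $ i * x t $ i + b $ i * y t $ i))"
    proof (rule sum.mono_neutral_left)
      show "\<forall>i\<in>UNIV - {i. 0 < A' $ i}. - (1 / c) * (a $ i * x t $ i + b $ i * y t $ i) = 0"
      proof
        fix i assume "i \<in> UNIV - {i. 0 < A' $ i}"
        then have "A $ i = 0" using A_nonneg[of i] A'0(2)[of i] by auto
        then show "- (1 / c) * (a $ i * x t $ i + b $ i * y t $ i) = 0" using zero[of i t] t by simp
      qed
    qed auto
    also have "\<dots> = - (1 / c) * (\<Sum>i\<in>UNIV. a $ i * x t $ i + b $ i * y t $ i)"
      by (rule sum_distrib_left[symmetric])
    finally have S: "sum area_term {i. 0 < A' $ i} = - (1 / c) * (\<Sum>i\<in>UNIV. a $ i * x t $ i + b $ i * y t $ i)" .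
    have "\<gamma> * supp_Xi \<mu> A' = supp_Xi \<mu> A / c"
      using c by (auto simp: A'_def supp_scale \<gamma>_def sgn_if)
    then have "\<gamma> * supp_Xi \<mu> A' * t + - (1 / c) * (\<Sum>i\<in>UNIV. a $ i * x t $ i + b $ i * y t $ i)
        = (1 / c) * (2 * c * z t)"
      unfolding pmp_data_z[OF pmp t] by (simp add: algebra_simps diff_divide_distrib)
    then show ?thesis unfolding area_term_def[symmetric] S using c by simp
  qed
  have lam0: "\<forall>i. A' $ i = 0 \<longrightarrow> (\<forall>t\<in>{0..T}. lam t $ i = 0)"
    by (simp add: lam_def A'0)
  have A'_nonneg: "\<forall>i. 0 \<le> A' $ i" using A_nonneg by (simp add: A'_def)
  have "spiral_form T x y z \<gamma> A' ?\<theta>0 th"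
    unfolding spiral_form_def using xy zeq zero A'0 by blast
  then show ?thesis
    unfolding extremal_form_iff th_def using \<gamma> A'_nonneg lam_meas lam_sub lam0 by blast
qed

end

context sub_finsler
begin

text \<open>The momentum is constant, so the task is to write the velocity in convex polar
  coordinates. The angle has to be measurable, and where \<open>A $ i\<close> is positive it must
  correspond to the fixed polar angle even at times when the velocity vanishes.\<close>

lemma pmp_data_imp_form_zero:
  assumes pmp: "pmp_data T x y z a b 0 A"
  shows "extremal_form \<Omega> \<mu> T x y z"
proof -
  have T: "0 < T" and init: "x 0 = 0" "y 0 = 0" "z 0 = 0"
    and xL: "\<And>i. Lip 0 T (\<lambda>t. x t $ i)" and yL: "\<And>i. Lip 0 T (\<lambda>t. y t $ i)" and zL: "Lip 0 T z"
    and A: "\<And>t. t \<in> {0..T} \<Longrightarrow> polar_gauges (a - 0 *\<^sub>R y t) (b + 0 *\<^sub>R x t) = A"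
    and Ane: "A \<noteq> 0"
    using pmp unfolding pmp_data_def by blast+
  have A0: "polar_gauges a b = A" using A[of 0] T by simp
  have A_nonneg: "0 \<le> A $ i" for i
    using conv_body.gauge_nonneg[OF polar_body] by (simp add: A0[symmetric] polar_gauges_def)
  note parg = polar_arg[of a b, unfolded A0]
  obtain Dx Dy L :: "'n \<Rightarrow> real \<Rightarrow> real" and R where
    Dm: "\<And>i. Dx i \<in> borel_measurable borel" "\<And>i. Dy i \<in> borel_measurable borel"
    and L: "\<And>i. L i \<in> borel_measurable borel" "\<And>i t. \<bar>L i t\<bar> \<le> R"
    and ae: "AE t in lborel. t \<in> {0<..<T} \<longrightarrow> horizontal_velocity x y z t (\<chi> i. Dx i t) (\<chi> i. Dy i t) \<and>
      (\<chi> i. L i t) \<in> subdiff_Xi \<mu> A \<and> (\<forall>i. bgauge i (Dx i t, Dy i t) = L i t) \<and>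
      (\<forall>i. (a $ i - 0 * y t $ i) * Dx i t + (b $ i + 0 * x t $ i) * Dy i t = A $ i * L i t)"
    by (rule pmp_data_measurable[OF pmp]) blast
  have "\<exists>\<zeta>. bgauge i \<zeta> = 1 \<and> (a $ i, b $ i) \<bullet> \<zeta> = A $ i" for i
  proof -
    obtain w where "bgauge i w = 1"
      "(a $ i, b $ i) \<bullet> w = pgauge i (a $ i, b $ i)"
      by (rule conv_body.support_attained[OF body])
    then show ?thesis by (intro exI[of _ w] conjI) (simp_all only: A0[symmetric] polar_gauges_def vec_lambda_beta)
  qed
  then obtain \<zeta> where \<zeta>: "\<And>i. bgauge i (\<zeta> i) = 1" "\<And>i. (a $ i, b $ i) \<bullet> \<zeta> i = A $ i"
    by metis
  \<comment> \<open>A zero velocity has no direction of its own; the fixed maximizer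
    \<open>\<zeta> i\<close> then supplies an angle that still satisfies
    \<open>corresp\<close>.\<close>
  define w where "w = (\<lambda>i t. if Dx i t = 0 \<and> Dy i t = 0 then \<zeta> i else (Dx i t, Dy i t))"
  define th where "th = (\<lambda>i t. conv_body.cv_arg (\<Omega> i) (w i t))"
  have th_meas: "th i \<in> borel_measurable borel" for i
  proof -
    note [measurable] = Dm conv_body.cv_arg_measurable[OF body]
    have [measurable]: "w i \<in> borel_measurable borel" unfolding w_def by measurable
    show ?thesis unfolding th_def by measurable
  qed
  have w_pos: "0 < bgauge i (w i t)" for i t
    by (cases "Dx i t = 0 \<and> Dy i t = 0")
      (auto simp: w_def \<zeta>(1) zero_prod_def intro!: conv_body.gauge_pos[OF body])
  have w_cv: "bgauge i (w i t) *\<^sub>R cv (\<Omega> i) (th i t) = w i t" for i t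
    unfolding th_def by (rule conv_body.gauge_cv_arg[OF body])
  have L_cv: "L i t * bcos i (th i t) = Dx i t" "L i t * bsin i (th i t) = Dy i t"
    if eq: "bgauge i (Dx i t, Dy i t) = L i t" for i t
  proof -
    have "L i t *\<^sub>R cv (\<Omega> i) (th i t) = (Dx i t, Dy i t)"
    proof (cases "Dx i t = 0 \<and> Dy i t = 0")
      case True
      then have "L i t = 0" using eq conv_body.gauge_zero[OF body[of i]] by (simp add: zero_prod_def)
      then show ?thesis using True by (simp add: zero_prod_def)
    next
      case False
      then show ?thesis using w_cv[of i t] eq by (auto simp: w_def)
    qed
    then show "L i t * bcos i (th i t) = Dx i t" "L i t * bsin i (th i t) = Dy i t"
      by (simp_all add: cv_def)
  qed
  define lam where "lam = (\<lambda>t. \<chi> i. L i t)"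
  have lam_meas: "lam \<in> borel_measurable lborel"
  proof -
    have "lam \<in> borel_measurable borel"
      unfolding lam_def using L(1) by (intro borel_measurable_vecI) simp
    then show ?thesis by simp
  qed
  have lam_sub: "AE t in lborel. t \<in> {0..T} \<longrightarrow> lam t \<in> subdiff_Xi \<mu> A"
    using ae by (intro AE_Icc_of_Ioo, eventually_elim) (simp add: lam_def)
  have cor: "AE t in lborel. t \<in> {0..T} \<longrightarrow> corresp (\<Omega> i) (th i t) (polar_arg a b i)" if Apos: "0 < A $ i" for i
  proof (rule AE_Icc_of_Ioo)
    show "AE t in lborel. t \<in> {0<..<T} \<longrightarrow> corresp (\<Omega> i) (th i t) (polar_arg a b i)"
      using ae
    proof eventually_elim
      case (elim t)
      show ?case
      proof
        assume t: "t \<in> {0<..<T}"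
        define g where "g = bgauge i (w i t)"
        have "(a $ i, b $ i) \<bullet> w i t = A $ i * g"
          using elim t \<zeta>(2)[of i] \<zeta>(1)[of i] by (auto simp: w_def g_def)
        moreover have "w i t = (g * bcos i (th i t), g * bsin i (th i t))"
          using w_cv[of i t] by (simp add: cv_def g_def)
        ultimately have "a $ i * (g * bcos i (th i t)) + b $ i * (g * bsin i (th i t)) = A $ i * g"
          by simp
        then have "(A $ i * g) * (bcos i (th i t) * pcos i (polar_arg a b i) +
            bsin i (th i t) * psin i (polar_arg a b i)) = (A $ i * g) * 1"
          unfolding parg[of i, symmetric] by (simp add: algebra_simps)
        moreover have "A $ i * g \<noteq> 0" using Apos w_pos[of i t] by (simp add: g_def)
        ultimately show "corresp (\<Omega> i) (th i t) (polar_arg a b i)"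
          unfolding corresp_def by (metis mult_cancel_left)
      qed
    qed
  qed
  obtain C where Lc: "\<And>i. (\<lambda>t. L i t * bcos i (th i t)) \<in> borel_measurable borel"
    "\<And>i. (\<lambda>t. L i t * bsin i (th i t)) \<in> borel_measurable borel"
    "\<And>i t. \<bar>L i t * bcos i (th i t)\<bar> \<le> C i" "\<And>i t. \<bar>L i t * bsin i (th i t)\<bar> \<le> C i"
    by (rule multiplier_times_cv[where L = L and R = R and th = th, OF L th_meas]) blast
  have "AE t in lborel. t \<in> {0<..<T} \<longrightarrow> horizontal_velocity x y z t
      (\<chi> i. L i t * bcos i (th i t)) (\<chi> i. L i t * bsin i (th i t))"
    using ae by eventually_elim (simp add: L_cv)
  then have "primitive_curve T x y z (\<lambda>i t. L i t * bcos i (th i t)) (\<lambda>i t. L i t * bsin i (th i t))"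
    by (rule primitive_curveI[OF T xL yL zL init Lc])
  then have curve: "primitive_curve T x y z (\<lambda>i t. lam t $ i * bcos i (th i t)) (\<lambda>i t. lam t $ i * bsin i (th i t))"
    by (simp add: lam_def)
  have "\<forall>i. th i \<in> borel_measurable lborel" using th_meas by simp
  with curve cor have "\<exists>th. (\<forall>i. th i \<in> borel_measurable lborel) \<and>
      (\<forall>i. 0 < A $ i \<longrightarrow> (AE t in lborel. t \<in> {0..T} \<longrightarrow> corresp (\<Omega> i) (th i t) (polar_arg a b i))) \<and>
      primitive_curve T x y z (\<lambda>i \<tau>. lam \<tau> $ i * bcos i (th i \<tau>)) (\<lambda>i \<tau>. lam \<tau> $ i * bsin i (th i \<tau>))"
    by blast
  then show ?thesis
    unfolding extremal_form_iff using A_nonneg lam_meas lam_sub Ane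
    by (intro exI[of _ "0::real"] exI[of _ A] exI[of _ "polar_arg a b"] exI[of _ lam]) simp
qed

end

section \<open>From the explicit form to the maximum principle\<close>

context sub_finsler
begin

text \<open>If the polar gauge of the momentum stays equal to \<open>A\<close>, the momentum moves along the line
  supporting the polar body; hence the velocity is proportional to the point \<open>\<zeta>\<close> defining that line.\<close>

lemma polar_tangent_velocity:
  fixes x y :: "real \<Rightarrow> real"
  assumes x: "(x has_real_derivative u) (at t)" and y: "(y has_real_derivative v) (at t)"
    and t: "t \<in> {\<alpha><..<\<beta>}"
    and const: "\<And>s. s \<in> {\<alpha><..<\<beta>} \<Longrightarrow> pgauge i (a - c * y s, b + c * x s) = A"
    and c: "c \<noteq> 0" and A: "0 < A" and l: "0 \<le> l"
    and eq: "(a - c * y t) * u + (b + c * x t) * v = A * l"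
  shows "bgauge i (u, v) = l"
proof -
  interpret conv_body "\<Omega> i" by (rule body)
  define h where "h = (\<lambda>t. (a - c * y t, b + c * x t))"
  obtain \<zeta> where \<zeta>: "G \<zeta> = 1" "h t \<bullet> \<zeta> = pgauge i (h t)" by (rule support_attained)
  obtain p q where pq: "\<zeta> = (p, q)" by fastforce
  define f where "f = (\<lambda>s. A - ((a - c * y s) * p + (b + c * x s) * q))"
  have f_d: "(f has_real_derivative 0 - ((0 - c * v) * p + (0 + c * u) * q)) (at t)"
    unfolding f_def by (intro DERIV_diff DERIV_add DERIV_cmult DERIV_cmult_right DERIV_const x y)
  have "f t = 0" using \<zeta>(2) const[OF t] by (simp add: f_def h_def pq)
  have f_min: "f t \<le> f s" if "s \<in> {\<alpha><..<\<beta>}" for s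
    using inner_le_gauges[of "h s" \<zeta>] \<zeta>(1) const[OF that] \<open>f t = 0\<close> by (simp add: f_def h_def pq)
  define d where "d = min (t - \<alpha>) (\<beta> - t)"
  have "0 < d" using t by (simp add: d_def)
  moreover have "\<forall>s. \<bar>t - s\<bar> < d \<longrightarrow> f t \<le> f s"
  proof (intro allI impI)
    fix s assume "\<bar>t - s\<bar> < d"
    then have "\<bar>t - s\<bar> < t - \<alpha>" "\<bar>t - s\<bar> < \<beta> - t" by (simp_all add: d_def)
    then have "\<alpha> < s" "s < \<beta>" by linarith+
    then show "f t \<le> f s" by (intro f_min) simp
  qed
  ultimately have "0 - ((0 - c * v) * p + (0 + c * u) * q) = 0"
    by (rule DERIV_local_min[OF f_d])
  then have "c * (v * p - u * q) = 0" by (simp add: algebra_simps)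
  then have perp: "v * p = u * q" using c by simp
  have "\<zeta> \<noteq> 0" using \<zeta>(1) by auto
  then have n: "0 < p * p + q * q" unfolding pq zero_prod_def
    by (metis Pair_inject sum_squares_gt_zero_iff)
  \<comment> \<open>The coefficient of the orthogonal projection of the velocity onto \<zeta>; by
    \<open>perp\<close> the velocity equals its projection.\<close>
  define k where "k = (u * p + v * q) / (p * p + q * q)"
  have "k * p = u"
  proof -
    have "k * p = (u * p + v * q) * p / (p * p + q * q)" by (simp only: k_def times_divide_eq_left)
    also have "(u * p + v * q) * p = u * (p * p + q * q)" using perp by algebra
    also have "u * (p * p + q * q) / (p * p + q * q) = u"
      using n by (intro nonzero_mult_div_cancel_right) (rule less_imp_neq[symmetric])
    finally show ?thesis .
  qed
  moreover have "k * q = v"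
  proof -
    have "k * q = (u * p + v * q) * q / (p * p + q * q)" by (simp only: k_def times_divide_eq_left)
    also have "(u * p + v * q) * q = v * (p * p + q * q)" using perp by algebra
    also have "v * (p * p + q * q) / (p * p + q * q) = v"
      using n by (intro nonzero_mult_div_cancel_right) (rule less_imp_neq[symmetric])
    finally show ?thesis .
  qed
  ultimately have uv: "(u, v) = k *\<^sub>R \<zeta>" "u = k * p" "v = k * q" by (simp_all add: pq)
  have "(a - c * y t) * p + (b + c * x t) * q = A" using \<open>f t = 0\<close> by (simp add: f_def)
  moreover have "(a - c * y t) * u + (b + c * x t) * v = k * ((a - c * y t) * p + (b + c * x t) * q)"
    unfolding uv by algebra
  ultimately have "A * l = k * A" using eq by metis
  then have "l = k" using A by simp
  then show ?thesis unfolding uv(1) using l \<zeta>(1) by (simp add: gauge_scale)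
qed

text \<open>Membership in the subdifferential holds only almost everywhere, so the given multiplier
  may be unbounded or negative on a null set. Clamping it to the range from 0 to \<open>R\<close>
  leaves its integrals over subintervals of \<open>{0..T}\<close> unchanged.\<close>

lemma clamped_multiplier:
  fixes lam :: "real \<Rightarrow> real^'n"
  assumes lam: "lam \<in> borel_measurable lborel"
    and sub: "AE t in lborel. t \<in> {0..T} \<longrightarrow> lam t \<in> subdiff_Xi \<mu> A"
  obtains L :: "'n \<Rightarrow> real \<Rightarrow> real" and R where
    "\<And>i. L i \<in> borel_measurable borel" "\<And>i t. \<bar>L i t\<bar> \<le> R" "\<And>i t. 0 \<le> L i t"
    "AE t in lborel. t \<in> {0..T} \<longrightarrow> (\<forall>i. lam t $ i = L i t)"
    "\<And>i t. lam t $ i = 0 \<Longrightarrow> L i t = 0"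
proof -
  obtain R where R: "0 < R" "\<And>l. l \<in> Xi \<mu> \<Longrightarrow> norm l \<le> R" by (rule Xi_bounded) blast
  define L where "L = (\<lambda>i t. max 0 (min R (lam t $ i)))"
  have meas: "L i \<in> borel_measurable borel" for i
  proof -
    have [measurable]: "(\<lambda>t. lam t $ i) \<in> borel_measurable borel"
      using lam by (intro borel_measurable_vec_nth) simp
    show ?thesis unfolding L_def by measurable
  qed
  have bd: "\<bar>L i t\<bar> \<le> R" "0 \<le> L i t" "lam t $ i = 0 \<Longrightarrow> L i t = 0" for i t using R(1) by (auto simp: L_def)
  have "AE t in lborel. t \<in> {0..T} \<longrightarrow> (\<forall>i. lam t $ i = L i t)"
    using sub
  proof eventually_elim
    case (elim t)
    show ?case
    proof (intro impI allI)
      fix i assume "t \<in> {0..T}"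
      then have Xi: "lam t \<in> Xi \<mu>" using elim by (simp add: subdiff_iff)
      have "lam t $ i \<le> R" using R(2)[OF Xi] component_le_norm_cart[of "lam t" i] by linarith
      moreover have "0 \<le> lam t $ i" using Xi by (simp add: Xi_def)
      ultimately show "lam t $ i = L i t" by (simp add: L_def)
    qed
  qed
  with meas bd(1,2) show thesis using bd(3) by (rule that)
qed

text \<open>The constants \<open>a\<close> and \<open>b\<close> are the momentum at time 0. Since
  the square of \<gamma> is 1, the explicit form says that the momentum of plane \<open>i\<close> is
  \<open>A $ i\<close> times the polar boundary point with parameter \<open>th i t\<close>; the
  maximum condition is recovered by differentiating this.\<close>

lemma form_nonzero_imp_pmp_data:
  fixes lam :: "real \<Rightarrow> real^'n" and \<theta>0 :: "'n \<Rightarrow> real"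
  assumes T: "0 < T" and \<gamma>: "\<gamma> = 1 \<or> \<gamma> = -1" and A: "\<And>i. 0 \<le> A $ i"
    and lam: "lam \<in> borel_measurable lborel"
    and sub: "AE t in lborel. t \<in> {0..T} \<longrightarrow> lam t \<in> subdiff_Xi \<mu> A"
    and lam0: "\<And>i t. A $ i = 0 \<Longrightarrow> t \<in> {0..T} \<Longrightarrow> lam t $ i = 0"
    and th: "\<And>i t. th i t = \<theta>0 i + \<gamma> / A $ i * integral {0..t} (\<lambda>\<tau>. lam \<tau> $ i)"
    and form: "spiral_form T x y z \<gamma> A \<theta>0 th"
  defines "a \<equiv> \<chi> i. A $ i * pcos i (\<theta>0 i)"
    and "b \<equiv> \<chi> i. A $ i * psin i (\<theta>0 i)"
  shows "pmp_data T x y z a b \<gamma> A"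
proof -
  have x: "x t $ i = \<gamma> * A $ i * (psin i (th i t) - psin i (\<theta>0 i))"
    and y: "y t $ i = \<gamma> * A $ i * (pcos i (\<theta>0 i) - pcos i (th i t))" if "t \<in> {0..T}" "0 < A $ i" for i t
    using form that unfolding spiral_form_def by blast+
  have xy0: "x t $ i = 0 \<and> y t $ i = 0" if "t \<in> {0..T}" "A $ i = 0" for i t
    using form that unfolding spiral_form_def by blast
  have z: "2 * z t = \<gamma> * supp_Xi \<mu> A * t + (\<Sum>i\<in>{i. 0 < A $ i}. (A $ i)\<^sup>2 *
       (psin i (\<theta>0 i) * pcos i (th i t) - pcos i (\<theta>0 i) * psin i (th i t)))" if "t \<in> {0..T}" for t
    using form that unfolding spiral_form_def by blast
  have \<gamma>2: "\<gamma> * \<gamma> = 1" and \<gamma>0: "\<gamma> \<noteq> 0" using \<gamma> by auto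
  obtain L :: "'n \<Rightarrow> real \<Rightarrow> real" and R where
    L: "\<And>i. L i \<in> borel_measurable borel" "\<And>i t. \<bar>L i t\<bar> \<le> R" and L_nonneg: "\<And>i t. 0 \<le> L i t"
    and L_ae: "AE t in lborel. t \<in> {0..T} \<longrightarrow> (\<forall>i. lam t $ i = L i t)"
    by (rule clamped_multiplier[OF lam sub]) blast
  \<comment> \<open>The angle rebuilt from the bounded multiplier, which makes it Lipschitz on the
    interval and differentiable almost everywhere with a known derivative.\<close>
  define \<theta> where "\<theta> = (\<lambda>i t. \<theta>0 i + \<gamma> / A $ i * integral {0..t} (L i))"
  have th_\<theta>: "th i t = \<theta> i t" if "t \<in> {0..T}" for i t
  proof -
    have "AE t in lborel. t \<in> {0..T} \<longrightarrow> lam t $ i = L i t" using L_ae by eventually_elim blast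
    then show ?thesis using integral_cong_AE_Icc[OF _ that] by (simp add: th \<theta>_def)
  qed
  have \<theta>_Lip: "Lip 0 T (\<theta> i)" for i
    unfolding \<theta>_def by (intro Lip_add Lip_const Lip_cmult Lip_integral[OF L])
  have momentum: "a $ i - \<gamma> * y t $ i = A $ i * pcos i (\<theta> i t)"
    "b $ i + \<gamma> * x t $ i = A $ i * psin i (\<theta> i t)"
    if t: "t \<in> {0..T}" for i t
  proof -
    have "a $ i - \<gamma> * y t $ i = A $ i * pcos i (\<theta> i t)
      \<and> b $ i + \<gamma> * x t $ i = A $ i * psin i (\<theta> i t)"
    proof (cases "A $ i = 0")
      case True
      then show ?thesis using xy0[OF t True] by (simp add: a_def b_def)
    next
      case False
      then have Apos: "0 < A $ i" using A[of i] by simp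
      have "\<gamma> * y t $ i = (\<gamma> * \<gamma>) * (A $ i * (pcos i (\<theta>0 i) - pcos i (\<theta> i t)))"
        "\<gamma> * x t $ i = (\<gamma> * \<gamma>) * (A $ i * (psin i (\<theta> i t) - psin i (\<theta>0 i)))"
        unfolding x[OF t Apos] y[OF t Apos] th_\<theta>[OF t] by (simp_all only: mult.assoc)
      then show ?thesis unfolding \<gamma>2 by (simp add: a_def b_def algebra_simps)
    qed
    then show "a $ i - \<gamma> * y t $ i = A $ i * pcos i (\<theta> i t)"
      "b $ i + \<gamma> * x t $ i = A $ i * psin i (\<theta> i t)" by blast+
  qed
  have xy_eq: "x t $ i = \<gamma> * (A $ i * psin i (\<theta> i t) - b $ i)"
    "y t $ i = \<gamma> * (a $ i - A $ i * pcos i (\<theta> i t))" if t: "t \<in> {0..T}" for i t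
  proof -
    have "\<gamma> * (A $ i * psin i (\<theta> i t) - b $ i) = (\<gamma> * \<gamma>) * x t $ i"
      "\<gamma> * (a $ i - A $ i * pcos i (\<theta> i t)) = (\<gamma> * \<gamma>) * y t $ i"
      unfolding momentum[OF t, symmetric] by algebra+
    then show "x t $ i = \<gamma> * (A $ i * psin i (\<theta> i t) - b $ i)"
      "y t $ i = \<gamma> * (a $ i - A $ i * pcos i (\<theta> i t))" by (simp_all add: \<gamma>2)
  qed
  have xL: "Lip 0 T (\<lambda>t. x t $ i)" for i
  proof (rule Lip_cong)
    show "Lip 0 T (\<lambda>t. \<gamma> * (A $ i * psin i (\<theta> i t) - b $ i))"
      by (intro Lip_cmult Lip_diff Lip_const conv_body.Lip_cv[OF polar_body] \<theta>_Lip)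
  qed (rule xy_eq(1))
  have yL: "Lip 0 T (\<lambda>t. y t $ i)" for i
  proof (rule Lip_cong)
    show "Lip 0 T (\<lambda>t. \<gamma> * (a $ i - A $ i * pcos i (\<theta> i t)))"
      by (intro Lip_cmult Lip_diff Lip_const conv_body.Lip_cv[OF polar_body] \<theta>_Lip)
  qed (rule xy_eq(2))
  have z_eq: "z t = (\<gamma> / 2) * (supp_Xi \<mu> A * t - (\<Sum>i\<in>UNIV. a $ i * x t $ i + b $ i * y t $ i))"
    if t: "t \<in> {0..T}" for t
  proof -
    have summand: "(A $ i)\<^sup>2 *
           (psin i (\<theta>0 i) * pcos i (th i t) -
            pcos i (\<theta>0 i) * psin i (th i t))
        = - \<gamma> * (a $ i * x t $ i + b $ i * y t $ i)" for i
    proof -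
      have "(A $ i)\<^sup>2 *
           (psin i (\<theta>0 i) * pcos i (th i t) -
            pcos i (\<theta>0 i) * psin i (th i t))
        = b $ i * (A $ i * pcos i (\<theta> i t)) - a $ i * (A $ i * psin i (\<theta> i t))"
        unfolding th_\<theta>[OF t] a_def b_def by (simp add: power2_eq_square algebra_simps)
      also have "\<dots> = b $ i * (a $ i - \<gamma> * y t $ i) - a $ i * (b $ i + \<gamma> * x t $ i)"
        unfolding momentum[OF t] ..
      also have "\<dots> = - \<gamma> * (a $ i * x t $ i + b $ i * y t $ i)" by algebra
      finally show ?thesis .
    qed
    have "2 * z t = \<gamma> * supp_Xi \<mu> A * t + (\<Sum>i\<in>{i. 0 < A $ i}. - \<gamma> * (a $ i * x t $ i + b $ i * y t $ i))"
      unfolding z[OF t] summand ..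
    also have "(\<Sum>i\<in>{i. 0 < A $ i}. - \<gamma> * (a $ i * x t $ i + b $ i * y t $ i))
        = (\<Sum>i\<in>UNIV. - \<gamma> * (a $ i * x t $ i + b $ i * y t $ i))"
    proof (rule sum.mono_neutral_left)
      show "\<forall>i\<in>UNIV - {i. 0 < A $ i}. - \<gamma> * (a $ i * x t $ i + b $ i * y t $ i) = 0"
      proof
        fix i assume "i \<in> UNIV - {i. 0 < A $ i}"
        then have "A $ i = 0" using A[of i] by auto
        then show "- \<gamma> * (a $ i * x t $ i + b $ i * y t $ i) = 0" using xy0[OF t] by simp
      qed
    qed auto
    also have "\<dots> = - \<gamma> * (\<Sum>i\<in>UNIV. a $ i * x t $ i + b $ i * y t $ i)"
      by (rule sum_distrib_left[symmetric])
    finally show ?thesis by (simp add: algebra_simps)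
  qed
  have zL: "Lip 0 T z"
  proof (rule Lip_cong)
    show "Lip 0 T (\<lambda>t. (\<gamma> / 2) * (supp_Xi \<mu> A * t - (\<Sum>i\<in>UNIV. a $ i * x t $ i + b $ i * y t $ i)))"
      by (intro Lip_cmult Lip_diff Lip_ident Lip_sum Lip_add xL yL) simp
  qed (rule z_eq)
  have gA: "polar_gauges (a - \<gamma> *\<^sub>R y t) (b + \<gamma> *\<^sub>R x t) = A" if t: "t \<in> {0..T}" for t
  proof (rule vec_eq_iff[THEN iffD2], rule allI)
    fix i
    have "pgauge i (A $ i *\<^sub>R cv (polar2 (\<Omega> i)) (\<theta> i t)) = A $ i"
      using A[of i] by (simp add: conv_body.gauge_scale[OF polar_body] conv_body.gauge_cv[OF polar_body])
    then show "polar_gauges (a - \<gamma> *\<^sub>R y t) (b + \<gamma> *\<^sub>R x t) $ i = A $ i"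
      using momentum[OF t, of i] by (simp add: polar_gauges_def cv_def)
  qed
  have \<theta>_0: "\<theta> i 0 = \<theta>0 i" for i by (simp add: \<theta>_def)
  have x0: "x 0 = 0" and y0: "y 0 = 0"
    using xy_eq[of 0] T by (simp_all add: vec_eq_iff \<theta>_0 a_def b_def)
  have z0: "z 0 = 0" using z_eq[of 0] T by (simp add: x0 y0)
  have "AE t in lborel. \<forall>i. t \<in> {0<..<T} \<longrightarrow> (\<exists>d. ((\<lambda>t. x t $ i) has_real_derivative d) (at t))"
    using Lip_differentiable_AE[OF xL] by (subst AE_all_countable) blast
  moreover have "AE t in lborel. \<forall>i. t \<in> {0<..<T} \<longrightarrow> (\<exists>d. ((\<lambda>t. y t $ i) has_real_derivative d) (at t))"
    using Lip_differentiable_AE[OF yL] by (subst AE_all_countable) blast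
  moreover have "AE t in lborel. \<forall>i. t \<in> {0<..<T} \<longrightarrow> ((\<lambda>t. integral {0..t} (L i)) has_real_derivative L i t) (at t)"
    using integral_deriv_AE[OF L] by (subst AE_all_countable) blast
  ultimately have ae: "AE t in lborel. t \<in> {0<..<T} \<longrightarrow> (\<exists>u v. maximizing_velocity x y z a b \<gamma> A t u v)"
    using L_ae sub
  proof eventually_elim
    case (elim t)
    show ?case
    proof
      assume t: "t \<in> {0<..<T}"
      then have tT: "t \<in> {0..T}" by simp
      have "\<forall>i. \<exists>d. ((\<lambda>t. x t $ i) has_real_derivative d) (at t)"
        "\<forall>i. \<exists>d. ((\<lambda>t. y t $ i) has_real_derivative d) (at t)" using elim(1,2) t by blast+
      from this[THEN choice] obtain u' v' where
        "\<forall>i. ((\<lambda>t. x t $ i) has_real_derivative u' i) (at t)"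
        "\<forall>i. ((\<lambda>t. y t $ i) has_real_derivative v' i) (at t)" by blast
      then obtain u v :: "real^'n" where u: "\<And>i. ((\<lambda>t. x t $ i) has_real_derivative u $ i) (at t)"
        and v: "\<And>i. ((\<lambda>t. y t $ i) has_real_derivative v $ i) (at t)"
        by (intro that[of "\<chi> i. u' i" "\<chi> i. v' i"]) simp_all
      have lamL: "lam t $ i = L i t" for i using elim(4) tT by blast
      have uv: "bgauge i (u $ i, v $ i) = lam t $ i \<and>
          (a $ i - \<gamma> * y t $ i) * u $ i + (b $ i + \<gamma> * x t $ i) * v $ i = A $ i * lam t $ i" for i
      proof (cases "A $ i = 0")
        case True
        have d0: "((\<lambda>t. 0) has_real_derivative u $ i) (at t)"
          by (rule has_field_derivative_transform_within_open[OF u open_greaterThanLessThan t])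
            (use xy0[OF _ True] in auto)
        have d1: "((\<lambda>t. 0) has_real_derivative v $ i) (at t)"
          by (rule has_field_derivative_transform_within_open[OF v open_greaterThanLessThan t])
            (use xy0[OF _ True] in auto)
        have "u $ i = 0" "v $ i = 0"
          by (rule DERIV_unique[OF d0 DERIV_const], rule DERIV_unique[OF d1 DERIV_const])
        then show ?thesis
          using True lam0[OF True tT] conv_body.gauge_zero[OF body[of i]] by (simp add: zero_prod_def)
      next
        case False
        then have Apos: "0 < A $ i" using A[of i] by simp
        have \<theta>_d: "(\<theta> i has_real_derivative 0 + \<gamma> / A $ i * L i t) (at t)"
          unfolding \<theta>_def using elim(3) t by (intro DERIV_add DERIV_const DERIV_cmult) blast
        have "((\<lambda>s. (1 / A $ i) * (a $ i - \<gamma> * y s $ i)) has_real_derivative (1 / A $ i) * (0 - \<gamma> * v $ i)) (at t)"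
          by (intro DERIV_cmult DERIV_diff DERIV_const v)
        then have c_d: "((\<lambda>s. pcos i (\<theta> i s)) has_real_derivative (1 / A $ i) * (0 - \<gamma> * v $ i)) (at t)"
          by (rule has_field_derivative_transform_within_open[OF _ open_greaterThanLessThan t])
            (use momentum(1) Apos in simp)
        have "((\<lambda>s. (1 / A $ i) * (b $ i + \<gamma> * x s $ i)) has_real_derivative (1 / A $ i) * (0 + \<gamma> * u $ i)) (at t)"
          by (intro DERIV_cmult DERIV_add DERIV_const u)
        then have s_d: "((\<lambda>s. psin i (\<theta> i s)) has_real_derivative (1 / A $ i) * (0 + \<gamma> * u $ i)) (at t)"
          by (rule has_field_derivative_transform_within_open[OF _ open_greaterThanLessThan t])
            (use momentum(2) Apos in simp)
        let ?C = "pcos i (\<theta> i t)" and ?S = "psin i (\<theta> i t)"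
        \<comment> \<open>The area rate of the boundary curve, expressed through the velocities,
          becomes the pairing of momentum and velocity.\<close>
        have "?C * ((1 / A $ i) * (0 + \<gamma> * u $ i)) - ?S * ((1 / A $ i) * (0 - \<gamma> * v $ i)) = 0 + \<gamma> / A $ i * L i t"
          by (rule conv_body.cv_area_rate[OF polar_body \<theta>_d c_d s_d])
        then have "\<gamma> / A $ i * (?C * u $ i + ?S * v $ i) = \<gamma> / A $ i * L i t"
          by (simp add: algebra_simps)
        then have "?C * u $ i + ?S * v $ i = L i t" using \<gamma>0 Apos by simp
        then have "A $ i * ?C * u $ i + A $ i * ?S * v $ i = A $ i * L i t"
          by (simp add: algebra_simps flip: distrib_left)
        then have eq: "(a $ i - \<gamma> * y t $ i) * u $ i + (b $ i + \<gamma> * x t $ i) * v $ i = A $ i * L i t"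
          unfolding momentum[OF tT] .
        have const: "pgauge i (a $ i - \<gamma> * y s $ i, b $ i + \<gamma> * x s $ i) = A $ i"
          if "s \<in> {0<..<T}" for s
          using arg_cong[OF gA[of s], of "\<lambda>B. B $ i"] that by (simp add: polar_gauges_def)
        \<comment> \<open>The pairing alone bounds the gauge of the velocity from below; equality
          comes from the momentum moving along a supporting line of the polar body.\<close>
        have "bgauge i (u $ i, v $ i) = L i t"
          by (rule polar_tangent_velocity[OF u v t const \<gamma>0 Apos L_nonneg eq])
        then show ?thesis using eq lamL by simp
      qed
      then have g: "gauges u v = lam t" by (simp add: gauges_def vec_eq_iff)
      then have g_sub: "gauges u v \<in> subdiff_Xi \<mu> A" using elim(5) tT by simp
      have eqs: "\<forall>i. (a $ i - \<gamma> * y t $ i) * u $ i + (b $ i + \<gamma> * x t $ i) * v $ i = A $ i * gauges u v $ i"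
        using uv g by simp
      \<comment> \<open>Conservation of the Hamiltonian read backwards: it converts the derivative
        of the closed formula for \<open>z\<close> into the horizontality condition.\<close>
      have "supp_Xi \<mu> A = (\<Sum>i\<in>UNIV. A $ i * gauges u v $ i)"
        using g_sub by (simp add: subdiff_iff inner_vec_sum)
      also have "\<dots> = (\<Sum>i\<in>UNIV. (a $ i * u $ i + b $ i * v $ i) + \<gamma> * (x t $ i * v $ i - u $ i * y t $ i))"
        using eqs by (intro sum.cong) (auto simp: algebra_simps)
      also have "\<dots> = (\<Sum>i\<in>UNIV. a $ i * u $ i + b $ i * v $ i) + \<gamma> * (\<Sum>i\<in>UNIV. x t $ i * v $ i - u $ i * y t $ i)"
        by (simp add: sum.distrib sum_distrib_left)
      finally have "(\<gamma> / 2) * (supp_Xi \<mu> A * 1 - (\<Sum>i\<in>UNIV. a $ i * u $ i + b $ i * v $ i))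
          = (\<gamma> * \<gamma>) / 2 * (\<Sum>i\<in>UNIV. x t $ i * v $ i - u $ i * y t $ i)" by simp
      then have key: "(\<gamma> / 2) * (supp_Xi \<mu> A * 1 - (\<Sum>i\<in>UNIV. a $ i * u $ i + b $ i * v $ i))
          = 1 / 2 * (\<Sum>i\<in>UNIV. x t $ i * v $ i - u $ i * y t $ i)" unfolding \<gamma>2 .
      have "((\<lambda>t. (\<gamma> / 2) * (supp_Xi \<mu> A * t - (\<Sum>i\<in>UNIV. a $ i * x t $ i + b $ i * y t $ i))) has_real_derivative
          (\<gamma> / 2) * (supp_Xi \<mu> A * 1 - (\<Sum>i\<in>UNIV. a $ i * u $ i + b $ i * v $ i))) (at t)"
        by (intro DERIV_cmult DERIV_diff DERIV_ident DERIV_sum DERIV_add u v)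
      then have "(z has_real_derivative 1 / 2 * (\<Sum>i\<in>UNIV. x t $ i * v $ i - u $ i * y t $ i)) (at t)"
        unfolding key
        by (rule has_field_derivative_transform_within_open[OF _ open_greaterThanLessThan t])
          (use z_eq in simp)
      then have "horizontal_velocity x y z t u v" using u v by (simp add: horizontal_velocity_def)
      then show "\<exists>u v. maximizing_velocity x y z a b \<gamma> A t u v"
        using g_sub eqs unfolding maximizing_velocity_def by blast
    qed
  qed
  show ?thesis
    unfolding pmp_data_def using T xL yL zL x0 y0 z0 gA \<gamma>0 ae by blast
qed

text \<open>Here the velocity is explicit. Its gauge is the multiplier because points
  \<open>cv\<close> have gauge 1, and \<open>corresp\<close> is the equality case of the pairing in
  each plane with positive \<open>A $ i\<close>; in the other planes the constant momentum is
  zero.\<close>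

lemma form_zero_imp_pmp_data:
  fixes lam :: "real \<Rightarrow> real^'n" and \<theta>0 :: "'n \<Rightarrow> real" and th :: "'n \<Rightarrow> real \<Rightarrow> real"
  assumes T: "0 < T" and A: "\<And>i. 0 \<le> A $ i" and Ane: "A \<noteq> 0"
    and lam: "lam \<in> borel_measurable lborel"
    and sub: "AE t in lborel. t \<in> {0..T} \<longrightarrow> lam t \<in> subdiff_Xi \<mu> A"
    and th: "\<And>i. th i \<in> borel_measurable lborel"
    and cor: "\<And>i. 0 < A $ i \<Longrightarrow> AE t in lborel. t \<in> {0..T} \<longrightarrow> corresp (\<Omega> i) (th i t) (\<theta>0 i)"
    and curve: "primitive_curve T x y z (\<lambda>i t. lam t $ i * bcos i (th i t)) (\<lambda>i t. lam t $ i * bsin i (th i t))"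
  defines "a \<equiv> \<chi> i. A $ i * pcos i (\<theta>0 i)"
    and "b \<equiv> \<chi> i. A $ i * psin i (\<theta>0 i)"
  shows "pmp_data T x y z a b 0 A"
proof -
  obtain L :: "'n \<Rightarrow> real \<Rightarrow> real" and R where
    L: "\<And>i. L i \<in> borel_measurable borel" "\<And>i t. \<bar>L i t\<bar> \<le> R" and L_nonneg: "\<And>i t. 0 \<le> L i t"
    and L_ae: "AE t in lborel. t \<in> {0..T} \<longrightarrow> (\<forall>i. lam t $ i = L i t)"
    by (rule clamped_multiplier[OF lam sub]) blast
  have th': "th i \<in> borel_measurable borel" for i using th by simp
  define p where "p = (\<lambda>i t. L i t * bcos i (th i t))"
  define q where "q = (\<lambda>i t. L i t * bsin i (th i t))"
  obtain C where pq: "\<And>i. p i \<in> borel_measurable borel" "\<And>i. q i \<in> borel_measurable borel"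
    "\<And>i t. \<bar>p i t\<bar> \<le> C i" "\<And>i t. \<bar>q i t\<bar> \<le> C i"
    unfolding p_def q_def by (rule multiplier_times_cv[where L = L and R = R and th = th, OF L th']) blast
  have "AE t in lborel. t \<in> {0..T} \<longrightarrow> (\<forall>i. lam t $ i * bcos i (th i t) = p i t \<and> lam t $ i * bsin i (th i t) = q i t)"
    using L_ae by eventually_elim (simp add: p_def q_def)
  with curve have "primitive_curve T x y z p q" by (rule primitive_curve_cong_AE)
  note prim = primitive_curve_imp[OF this T pq]
  have gA: "polar_gauges a b = A"
  proof (rule vec_eq_iff[THEN iffD2], rule allI)
    fix i
    have "pgauge i (A $ i *\<^sub>R cv (polar2 (\<Omega> i)) (\<theta>0 i)) = A $ i"
      using A[of i] by (simp add: conv_body.gauge_scale[OF polar_body] conv_body.gauge_cv[OF polar_body])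
    then show "polar_gauges a b $ i = A $ i" by (simp add: polar_gauges_def cv_def a_def b_def)
  qed
  have "AE t in lborel. \<forall>i. 0 < A $ i \<longrightarrow> t \<in> {0..T} \<longrightarrow> corresp (\<Omega> i) (th i t) (\<theta>0 i)"
    using cor by (subst AE_all_countable) (auto intro: AE_impI)
  then have ae: "AE t in lborel. t \<in> {0<..<T} \<longrightarrow> (\<exists>u v. maximizing_velocity x y z a b 0 A t u v)"
    using prim(7) L_ae sub
  proof eventually_elim
    case (elim t)
    show ?case
    proof
      assume t: "t \<in> {0<..<T}"
      then have tT: "t \<in> {0..T}" by simp
      have lamL: "lam t $ i = L i t" for i using elim(3) tT by blast
      define u where "u = (\<chi> i. p i t)"
      define v where "v = (\<chi> i. q i t)"
      have vel: "horizontal_velocity x y z t u v" using elim(2) t by (simp add: u_def v_def)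
      have g: "gauges u v = lam t"
      proof (rule vec_eq_iff[THEN iffD2], rule allI)
        fix i
        have "bgauge i (L i t *\<^sub>R cv (\<Omega> i) (th i t)) = L i t"
          using L_nonneg[of i t] by (simp add: conv_body.gauge_scale[OF body] conv_body.gauge_cv[OF body])
        then show "gauges u v $ i = lam t $ i"
          by (simp add: gauges_def u_def v_def p_def q_def cv_def lamL)
      qed
      have "(a $ i - 0 * y t $ i) * u $ i + (b $ i + 0 * x t $ i) * v $ i = A $ i * gauges u v $ i" for i
      proof (cases "A $ i = 0")
        case False
        then have "0 < A $ i" using A[of i] by simp
        then have "bcos i (th i t) * pcos i (\<theta>0 i) + bsin i (th i t) * psin i (\<theta>0 i) = 1"
          using elim(1) tT by (simp add: corresp_def)
        moreover have "a $ i * u $ i + b $ i * v $ i =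
            A $ i * L i t * (bcos i (th i t) * pcos i (\<theta>0 i) + bsin i (th i t) * psin i (\<theta>0 i))"
          by (simp add: a_def b_def u_def v_def p_def q_def algebra_simps)
        ultimately show ?thesis by (simp add: g lamL)
      qed (simp add: a_def b_def)
      moreover have "gauges u v \<in> subdiff_Xi \<mu> A" using elim(4) tT g by simp
      ultimately show "\<exists>u v. maximizing_velocity x y z a b 0 A t u v"
        using vel unfolding maximizing_velocity_def by blast
    qed
  qed
  show ?thesis
    unfolding pmp_data_def using T prim(1-6) gA Ane ae by simp
qed

end

section \<open>The main theorem\<close>

theorem theorem1:
  fixes \<Omega> :: "'n::finite \<Rightarrow> (real \<times> real) set"
    and \<mu> :: "real^'n \<Rightarrow> real"
    and U :: "((real^'n) \<times> (real^'n)) set"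
    and T :: real
    and x y :: "real \<Rightarrow> real^'n"
    and z :: "real \<Rightarrow> real"
  assumes "main_assumption \<Omega> \<mu>"
    and "U = U_of \<Omega> \<mu>"
  shows "extremal U T x y z \<longleftrightarrow> (0 < T \<and> extremal_form \<Omega> \<mu> T x y z)"
proof -
  interpret sub_finsler \<Omega> \<mu> by unfold_locales (rule assms(1))
  show ?thesis
    unfolding assms(2)
  proof
    assume "extremal (U_of \<Omega> \<mu>) T x y z"
    then obtain a b c A where pmp: "pmp_data T x y z a b c A" by (rule extremal_imp_pmp_data)
    have "extremal_form \<Omega> \<mu> T x y z"
    proof (cases "c = 0")
      case True
      then show ?thesis using pmp pmp_data_imp_form_zero by simp
    next
      case False
      then show ?thesis by (rule pmp_data_imp_form_nonzero[OF pmp])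
    qed
    moreover have "0 < T" using pmp by (simp add: pmp_data_def)
    ultimately show "0 < T \<and> extremal_form \<Omega> \<mu> T x y z" by blast
  next
    assume "0 < T \<and> extremal_form \<Omega> \<mu> T x y z"
    then have T: "0 < T" and form: "extremal_form \<Omega> \<mu> T x y z" by auto
    from form[unfolded extremal_form_iff] obtain \<gamma> A \<theta>0 lam where
      \<gamma>: "\<gamma> \<in> {0, 1, -1}" and A: "\<forall>i. 0 \<le> A $ i" and ne: "\<not> (\<gamma> = 0 \<and> A = 0)"
      and lam: "lam \<in> borel_measurable lborel"
      and sub: "AE t in lborel. t \<in> {0..T} \<longrightarrow> lam t \<in> subdiff_Xi \<mu> A"
      and lam0: "\<gamma> \<noteq> 0 \<longrightarrow> (\<forall>i. A $ i = 0 \<longrightarrow> (\<forall>t\<in>{0..T}. lam t $ i = 0))"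
      and nonzero: "\<gamma> \<noteq> 0 \<longrightarrow> spiral_form T x y z \<gamma> A \<theta>0
        (\<lambda>i t. \<theta>0 i + \<gamma> / A $ i * integral {0..t} (\<lambda>\<tau>. lam \<tau> $ i))"
      and zero: "\<gamma> = 0 \<longrightarrow> (\<exists>th. (\<forall>i. th i \<in> borel_measurable lborel) \<and>
        (\<forall>i. 0 < A $ i \<longrightarrow> (AE t in lborel. t \<in> {0..T} \<longrightarrow> corresp (\<Omega> i) (th i t) (\<theta>0 i))) \<and>
        primitive_curve T x y z (\<lambda>i \<tau>. lam \<tau> $ i * cos_cv (\<Omega> i) (th i \<tau>)) (\<lambda>i \<tau>. lam \<tau> $ i * sin_cv (\<Omega> i) (th i \<tau>)))"
      by (elim exE conjE) (rule that)
    show "extremal (U_of \<Omega> \<mu>) T x y z"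
    proof (cases "\<gamma> = 0")
      case False
      have "\<gamma> = 1 \<or> \<gamma> = - 1" using \<gamma> False by blast
      from form_nonzero_imp_pmp_data[OF T this A[rule_format] lam sub _ _ mp[OF nonzero False]]
      show ?thesis using lam0 False by (intro pmp_data_imp_extremal) blast
    next
      case True
      then obtain th where th: "\<And>i. th i \<in> borel_measurable lborel"
        "\<And>i. 0 < A $ i \<Longrightarrow> AE t in lborel. t \<in> {0..T} \<longrightarrow> corresp (\<Omega> i) (th i t) (\<theta>0 i)"
        "primitive_curve T x y z (\<lambda>i \<tau>. lam \<tau> $ i * cos_cv (\<Omega> i) (th i \<tau>)) (\<lambda>i \<tau>. lam \<tau> $ i * sin_cv (\<Omega> i) (th i \<tau>))"
        using zero by blast
      have "A \<noteq> 0" using ne True by blast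
      then show ?thesis
        by (rule pmp_data_imp_extremal[OF form_zero_imp_pmp_data[OF T A[rule_format] _ lam sub th]])
    qed
  qed
qed

end
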